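(* Let $\mathbb{D}=\{z\in\mathbb{C}:|z|<1\}$ and let $\phi:\mathbb{D}\to\mathbb{D}$ be an analytic self-map which is not an elliptic automorphism. Let $p\in\overline{\mathbb{D}}$ be the Denjoy-Wolff point of $\phi$, let $\phi_n=\phi\circ\cdots\circ\phi$ ($n$ times) and let $\phi_n^{\star}(\zeta)=\lim_{r\uparrow 1}\phi_n(r\zeta)$ be the radial boundary function of $\phi_n$ (defined for almost every $\zeta\in\partial\mathbb{D}$, simultaneously for all $n\ge 1$). Then: (1) If $\phi$ is elliptic, then $\phi_n^{\star}(\zeta)\to p$ as $n\to\infty$ for almost every $\zeta\in\partial\mathbb{D}$ if and only if $\phi$ is not an inner function. (2) If $\phi$ is hyperbolic or type I parabolic, then $\phi_n^{\star}(\zeta)\to p$ as $n\to\infty$ for almost every $\zeta\in\partial\mathbb{D}$. ("Almost every" refers to linear measure on $\partial\mathbb{D}$.)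
   Context: An elliptic automorphism of $\mathbb{D}$ is an automorphism that can be conjugated (by an automorphism of $\mathbb{D}$) to a rotation about $0$ (the identity is included). Denjoy-Wolff theorem: if an analytic self-map $\phi$ of $\mathbb{D}$ is not an elliptic automorphism, there is a point $p\in\overline{\mathbb{D}}$, called the Denjoy-Wolff point of $\phi$, such that the iterates $\phi_n$ converge to $p$ uniformly on compact subsets of $\mathbb{D}$. If $p\in\mathbb{D}$ then $\phi(p)=p$ and $|\phi'(p)|<1$; if $p\in\partial\mathbb{D}$ then $\phi(p)=p$ and $0<\phi'(p)\le 1$ in the sense of non-tangential limits (so $\phi'(p)$ is the angular derivative at $p$). Classification: $\phi$ is elliptic if $p\in\mathbb{D}$; if $p\in\partial\mathbb{D}$, $\phi$ is hyperbolic if $\phi'(p)<1$ and parabolic if $\phi'(p)=1$. Hyperbolic distance: for $z,w\in\mathbb{D}$, $\rho(z,w)=\log\dfrac{1+\left|\frac{z-w}{1-\overline{w}z}\right|}{1-\left|\frac{z-w}{1-\overline{w}z}\right|}$. For $\phi$ parabolic, pick $z_0\in\mathbb{D}$ and put $z_n=\phi_n(z_0)$, $s_n=\rho(z_n,z_{n+1})$. The sequence $s_n$ is non-increasing, so $s_\infty=\lim_{n\to\infty} s_n$ exists. $\phi$ is type I parabolic if $s_\infty>0$ and type II parabolic if $s_\infty=0$ (this does not depend on the choice of $z_0$). A bounded analytic function $f$ on $\mathbb{D}$ is inner if its radial boundary function satisfies $|f^{\star}(e^{i\theta})|=1$ for almost every $e^{i\theta}\in\partial\mathbb{D}$. *)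

theory Defs
  imports "HOL-Complex_Analysis.Complex_Analysis"
begin

text \<open>
  Analytic self-maps of the unit disc are functions on all of \<open>complex\<close>, of which
  only the values on \<open>\<bbbD>\<close> matter. Iterates are written \<open>\<phi> ^^ n\<close>.
\<close>

abbreviation unit_disc :: "complex set" ("\<bbbD>") where
  "\<bbbD> \<equiv> ball 0 1"

definition analytic_self_map :: "(complex \<Rightarrow> complex) \<Rightarrow> bool" where
  "analytic_self_map \<phi> \<longleftrightarrow> \<phi> holomorphic_on \<bbbD> \<and> \<phi> ` \<bbbD> \<subseteq> \<bbbD>"

definition disc_automorphism :: "(complex \<Rightarrow> complex) \<Rightarrow> bool" where
  "disc_automorphism \<phi> \<longleftrightarrow> \<phi> holomorphic_on \<bbbD> \<and> bij_betw \<phi> \<bbbD> \<bbbD>"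

text \<open>The equation says that \<open>\<psi> \<circ> \<phi> \<circ> \<psi>\<^sup>-\<^sup>1\<close> is the rotation \<open>w \<mapsto> c * w\<close> of \<open>\<bbbD>\<close>.\<close>

definition elliptic_automorphism :: "(complex \<Rightarrow> complex) \<Rightarrow> bool" where
  "elliptic_automorphism \<phi> \<longleftrightarrow> disc_automorphism \<phi> \<and>
     (\<exists>\<psi> c. disc_automorphism \<psi> \<and> norm c = 1 \<and> (\<forall>z\<in>\<bbbD>. \<psi> (\<phi> z) = c * \<psi> z))"

definition denjoy_wolff_point :: "(complex \<Rightarrow> complex) \<Rightarrow> complex \<Rightarrow> bool" where
  "denjoy_wolff_point \<phi> p \<longleftrightarrow> p \<in> cball 0 1 \<and>
     (\<forall>K. compact K \<and> K \<subseteq> \<bbbD> \<longrightarrow> uniform_limit K (\<lambda>n. \<phi> ^^ n) (\<lambda>_. p) sequentially)"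


text \<open>Non-tangential approach to \<open>p \<in> \<partial>\<bbbD>\<close> is approach within every Stolz region at \<open>p\<close>.\<close>

definition stolz_region :: "complex \<Rightarrow> real \<Rightarrow> complex set" where
  "stolz_region p M = {z \<in> \<bbbD>. norm (z - p) < M * (1 - norm z)}"

definition has_nontangential_limit ::
    "(complex \<Rightarrow> complex) \<Rightarrow> complex \<Rightarrow> complex \<Rightarrow> bool" where
  "has_nontangential_limit f p l \<longleftrightarrow> (\<forall>M>1. (f \<longlongrightarrow> l) (at p within stolz_region p M))"

text \<open>
  Angular derivative \<open>d\<close> at the boundary point \<open>p\<close> of a map whose non-tangential
  boundary value there is \<open>q\<close>.
\<close>

definition has_angular_derivative ::
    "(complex \<Rightarrow> complex) \<Rightarrow> complex \<Rightarrow> complex \<Rightarrow> complex \<Rightarrow> bool" where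
  "has_angular_derivative f p q d \<longleftrightarrow>
     has_nontangential_limit f p q \<and>
     has_nontangential_limit (\<lambda>z. (f z - q) / (z - p)) p d"

definition elliptic_map :: "(complex \<Rightarrow> complex) \<Rightarrow> bool" where
  "elliptic_map \<phi> \<longleftrightarrow> (\<exists>p. denjoy_wolff_point \<phi> p \<and> p \<in> \<bbbD>)"

definition hyperbolic_map :: "(complex \<Rightarrow> complex) \<Rightarrow> bool" where
  "hyperbolic_map \<phi> \<longleftrightarrow>
     (\<exists>p d. denjoy_wolff_point \<phi> p \<and> p \<in> sphere 0 1 \<and>
            has_angular_derivative \<phi> p p (complex_of_real d) \<and> d < 1)"

definition parabolic_map :: "(complex \<Rightarrow> complex) \<Rightarrow> bool" where
  "parabolic_map \<phi> \<longleftrightarrow>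
     (\<exists>p. denjoy_wolff_point \<phi> p \<and> p \<in> sphere 0 1 \<and> has_angular_derivative \<phi> p p 1)"

definition hyperbolic_distance :: "complex \<Rightarrow> complex \<Rightarrow> real" where
  "hyperbolic_distance z w =
     ln ((1 + norm ((z - w) / (1 - cnj w * z))) / (1 - norm ((z - w) / (1 - cnj w * z))))"

text \<open>
  The limit exists for every \<open>z0 \<in> \<bbbD>\<close>, and whether it is positive does not depend on
  \<open>z0\<close>, so the existential quantifier over \<open>z0\<close> is equivalent to a universal one.
\<close>

definition type_I_parabolic :: "(complex \<Rightarrow> complex) \<Rightarrow> bool" where
  "type_I_parabolic \<phi> \<longleftrightarrow> parabolic_map \<phi> \<and>
     (\<exists>z0\<in>\<bbbD>. \<exists>s>0.
        (\<lambda>n. hyperbolic_distance ((\<phi> ^^ n) z0) ((\<phi> ^^ Suc n) z0)) \<longlonglongrightarrow> s)"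


text \<open>Linear measure (arc length) on the unit circle.\<close>

definition circle_measure :: "complex measure" where
  "circle_measure =
     distr (restrict_space lborel {0..<2 * pi}) (restrict_space borel (sphere 0 1)) cis"

definition has_radial_limit :: "(complex \<Rightarrow> complex) \<Rightarrow> complex \<Rightarrow> complex \<Rightarrow> bool" where
  "has_radial_limit f \<zeta> l \<longleftrightarrow> ((\<lambda>r. f (complex_of_real r * \<zeta>)) \<longlongrightarrow> l) (at_left 1)"

text \<open>Unspecified at those \<open>\<zeta>\<close> where the radial limit does not exist.\<close>

definition radial_boundary :: "(complex \<Rightarrow> complex) \<Rightarrow> complex \<Rightarrow> complex" where
  "radial_boundary f \<zeta> = Lim (at_left 1) (\<lambda>r. f (complex_of_real r * \<zeta>))"

definition inner_function :: "(complex \<Rightarrow> complex) \<Rightarrow> bool" where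
  "inner_function f \<longleftrightarrow> f holomorphic_on \<bbbD> \<and> bounded (f ` \<bbbD>) \<and>
     (AE \<zeta> in circle_measure. norm (radial_boundary f \<zeta>) = 1)"

lemma radial_boundary_eq:
  assumes "has_radial_limit f \<zeta> l"
  shows "radial_boundary f \<zeta> = l"
  using assms unfolding has_radial_limit_def radial_boundary_def
  by (intro tendsto_Lim) auto

lemma measurable_cis_circle:
  "cis \<in> restrict_space lborel {0..<2 * pi} \<rightarrow>\<^sub>M restrict_space borel (sphere 0 1)"
proof (rule measurable_restrict_space2)
  have "cis \<in> borel_measurable borel"
    by (intro borel_measurable_continuous_onI continuous_intros)
  then show "cis \<in> restrict_space lborel {0..<2 * pi} \<rightarrow>\<^sub>M borel"
    by (intro measurable_restrict_space1) simp
qed auto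

lemma space_circle_measure: "space circle_measure = sphere 0 1"
  by (simp add: circle_measure_def space_restrict_space)

lemma emeasure_circle_measure_space:
  "emeasure circle_measure (sphere 0 1) = ennreal (2 * pi)"
proof -
  have "cis -` sphere 0 1 \<inter> {0..<2 * pi} = {0..<2 * pi}" by auto
  moreover have "sphere 0 1 \<in> sets (restrict_space borel (sphere (0::complex) 1))"
    using sets.top[of "restrict_space borel (sphere (0::complex) 1)"]
    by (simp add: space_restrict_space)
  ultimately show ?thesis
    by (simp add: circle_measure_def emeasure_distr[OF measurable_cis_circle]
        space_restrict_space emeasure_restrict_space)
qed

end

theory Submission imports Defs begin

text \<open>
  Write \<open>\<phi>\<^sub>n\<^sup>*\<close> for the boundary function of the \<open>n\<close>-th iterate. Its radial limits exist by Fatou's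
  theorem, which follows from a weak-type inequality for the radial maximal function applied to
  the tails of the Taylor series.

  If some \<open>\<phi>\<^sub>k\<^sup>*(\<zeta>)\<close> lies in the disc, then \<open>\<phi>\<^sub>n\<^sup>*(\<zeta>) \<longrightarrow> p\<close> because
  \<open>\<phi>\<^sub>n\<^sup>*(\<zeta>) = \<phi>\<^bsub>n-k\<^esub>(\<phi>\<^sub>k\<^sup>*(\<zeta>))\<close>. In the elliptic case with \<open>\<phi>\<close> not inner this
  happens almost everywhere: the energy \<open>\<integral> |\<phi>\<^sub>n\<^sup>* - p|\<^sup>2\<close> against harmonic measure at \<open>p\<close>
  decreases at each step by a fixed proportion of itself, up to an error tending to \<open>0\<close>, hence
  tends to \<open>0\<close>. If \<open>\<phi>\<close> is inner then so are all iterates, and \<open>|\<phi>\<^sub>n\<^sup>*| = 1\<close> excludes a limit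
  in the disc.

  In the other cases \<open>\<Sum> (1 - |\<phi>\<^sub>n(a)|\<^sup>2) < \<infinity>\<close> for some \<open>a\<close>. Since \<open>\<phi>\<^sub>n\<^sup>*\<close> has mean \<open>\<phi>\<^sub>n(a)\<close> with
  respect to harmonic measure at \<open>a\<close>, its variance is at most \<open>1 - |\<phi>\<^sub>n(a)|\<^sup>2\<close>, and summability
  gives \<open>\<phi>\<^sub>n\<^sup>* - \<phi>\<^sub>n(a) \<longrightarrow> 0\<close> almost everywhere. In the hyperbolic case the series is geometric
  by Julia's lemma. For type I parabolic maps, pass to the half-plane: the orbit \<open>x\<^sub>n + i y\<^sub>n\<close>
  has slowly varying steps \<open>(z\<^bsub>n+1\<^esub> - z\<^sub>n) / y\<^sub>n\<close> whose imaginary parts converge, so either \<open>y\<^sub>n\<close>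
  grows geometrically or \<open>x\<^sub>n\<close> is eventually monotone with steps comparable to \<open>y\<^sub>n\<close>; either way
  \<open>\<Sum> y\<^sub>n / |z\<^sub>n + i|\<^sup>2\<close> converges.
\<close>

subsection \<open>Integration on the circle and the Poisson kernel\<close>

text \<open>The obstacle throughout is composition on the circle. Where the boundary value of
  \<open>\<phi>\<close> has modulus 1, the image of a radius may approach the circle tangentially,
  so the boundary function of \<open>f (\<phi> z)\<close> cannot be read off from that of
  \<open>f\<close>. Composition is used pointwise only where the inner boundary value lies in the
  disc. Elsewhere it is replaced by integral identities: moments for inner functions, and Poisson
  averages over circles of radius below 1 for the energy.

  The point at which harmonic measure is taken matters. At a fixed point \<open>p\<close> the
  average of a harmonic function along \<open>\<phi>\<close> returns its value at \<open>p\<close>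
  itself, so energies at successive steps can be compared. At the base point of an orbit the mean of
  a boundary iterate is exactly an orbit point.

  In the parabolic case slow variation of the steps does not by itself make the height ratios
  \<open>a\<close> converge. A second invariant is used, the limit of the two-step distance: nearly
  equal consecutive steps turn the quotient of the two-step and one-step limits into
  \<open>a + 1 / a + 2\<close>, and \<open>a \<ge> 1\<close> makes this invertible.\<close>

abbreviation (input) circle_mu :: "complex measure" ("\<mu>") where
  "\<mu> \<equiv> circle_measure"

lemma sets_circle_measure: "sets \<mu> = sets (restrict_space borel (sphere 0 1))"
  by (simp add: circle_measure_def)

lemma borel_measurable_circle_continuous:
  fixes f :: "complex \<Rightarrow> 'a::topological_space"
  assumes "continuous_on (sphere 0 1) f"
  shows "f \<in> borel_measurable \<mu>"
  using borel_measurable_continuous_on_restrict[OF assms]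
  by (simp cong: measurable_cong_sets add: sets_circle_measure)

interpretation circle: finite_measure \<mu>
  by standard (simp add: space_circle_measure emeasure_circle_measure_space)

lemma measure_circle_space: "measure \<mu> (space \<mu>) = 2 * pi"
  by (simp add: measure_def space_circle_measure emeasure_circle_measure_space)

lemma integral_circle_measure:
  fixes f :: "complex \<Rightarrow> 'a::{banach, second_countable_topology}"
  assumes "f \<in> borel_measurable \<mu>"
  shows "integral\<^sup>L \<mu> f = (LINT t:{0..<2*pi}|lborel. f (cis t))"
proof -
  have f: "f \<in> borel_measurable (restrict_space borel (sphere 0 1))"
    using assms by (simp cong: measurable_cong_sets add: sets_circle_measure)
  show ?thesis
    unfolding circle_measure_def set_lebesgue_integral_def
    by (subst integral_distr[OF measurable_cis_circle f], subst integral_restrict_space) auto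
qed

lemma nn_integral_circle_measure:
  assumes "f \<in> borel_measurable \<mu>"
  shows "integral\<^sup>N \<mu> f = (\<integral>\<^sup>+t\<in>{0..<2*pi}. f (cis t) \<partial>lborel)"
proof -
  have f: "f \<in> borel_measurable (restrict_space borel (sphere 0 1))"
    using assms by (simp cong: measurable_cong_sets add: sets_circle_measure)
  show ?thesis
    unfolding circle_measure_def
    by (subst nn_integral_distr[OF measurable_cis_circle])
       (use f in \<open>simp cong: measurable_cong_sets\<close>, subst nn_integral_restrict_space, auto)
qed

lemma emeasure_circle_measure:
  assumes "S \<in> sets \<mu>"
  shows "emeasure \<mu> S = emeasure lborel (cis -` S \<inter> {0..<2*pi})"
    and "cis -` S \<inter> {0..<2*pi} \<in> sets lborel"
proof -
  have S: "S \<in> sets (restrict_space borel (sphere 0 1))"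
    using assms by (simp add: sets_circle_measure)
  have m: "cis -` S \<inter> {0..<2*pi} \<in> sets (restrict_space lborel {0..<2 * pi})"
    using measurable_sets[OF measurable_cis_circle S] by (simp add: space_restrict_space)
  then show "cis -` S \<inter> {0..<2*pi} \<in> sets lborel"
    by (auto simp: sets_restrict_space_iff)
  show "emeasure \<mu> S = emeasure lborel (cis -` S \<inter> {0..<2*pi})"
    unfolding circle_measure_def
    by (subst emeasure_distr[OF measurable_cis_circle S], simp add: space_restrict_space,
        subst emeasure_restrict_space) auto
qed

lemma AE_circle_norm: "AE \<zeta> in \<mu>. norm \<zeta> = 1"
  by (rule AE_I2) (simp add: space_circle_measure)

lemma set_integral_Icc_Ico:
  fixes f :: "real \<Rightarrow> 'a::{banach, second_countable_topology}"
  shows "(LINT t:{a..<b}|lborel. f t) = (LINT t:{a..b}|lborel. f t)"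
  unfolding set_lebesgue_integral_def
  by (rule integral_discrete_difference[of "{b}"]) (auto simp: indicator_def)

lemma integral_circle_power:
  assumes "k \<ge> 1"
  shows "(\<integral>\<zeta>. \<zeta> ^ k \<partial>\<mu>) = 0"
proof -
  have "(\<integral>\<zeta>. \<zeta> ^ k \<partial>\<mu>) = (LINT t:{0..2*pi}|lborel. cis t ^ k)"
    by (subst integral_circle_measure)
       (auto intro!: borel_measurable_circle_continuous continuous_intros simp: set_integral_Icc_Ico)
  also have "\<dots> = cis (2*pi) ^ k / (\<i> * k) - cis 0 ^ k / (\<i> * k)"
    unfolding set_lebesgue_integral_def
  proof (rule integral_FTC_Icc)
    show "((\<lambda>t. cis t ^ k / (\<i> * k)) has_vector_derivative cis x ^ k) (at x within {0..2*pi})" for x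
    proof -
      have "((\<lambda>z. exp (\<i> * of_nat k * z) / (\<i> * k)) has_field_derivative
          exp (\<i> * of_nat k * of_real x)) (at (of_real x))"
        using assms by (auto intro!: derivative_eq_intros)
      from has_vector_derivative_real_field[OF this]
      have "((\<lambda>t. exp (\<i> * of_nat k * of_real t) / (\<i> * k)) has_vector_derivative
          exp (\<i> * of_nat k * of_real x)) (at x within {0..2*pi})" .
      moreover have "exp (\<i> * of_nat k * of_real t) = cis t ^ k" for t
        by (simp add: cis_conv_exp DeMoivre mult_ac flip: exp_of_nat_mult)
      ultimately show ?thesis by simp
    qed
    show "continuous_on {0..2*pi} (\<lambda>t. cis t ^ k)" by (intro continuous_intros)
  qed auto
  also have "\<dots> = 0" by simp
  finally show ?thesis .
qed

text \<open>Termwise integration of the Taylor series at 0 leaves only its constant term. Holomorphy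
  past the closed disc makes the series converge absolutely on the circle; boundary values of
  functions on the open disc are reached from here by dilation.\<close>

lemma circle_mean_value:
  fixes G :: "complex \<Rightarrow> complex"
  assumes G: "G holomorphic_on ball 0 R" and R: "R > 1"
  shows "(\<integral>\<zeta>. G \<zeta> \<partial>\<mu>) = 2 * pi * G 0"
proof -
  define c where "c k = (deriv ^^ k) G 0 / fact k" for k
  have sums: "(\<lambda>k. c k * z ^ k) sums G z" if "norm z < R" for z
    using holomorphic_power_series[OF G, of z] that by (simp add: c_def)
  \<comment> \<open>Any modulus strictly between 1 and \<open>R\<close> would do: convergence there
    forces absolute convergence at modulus 1.\<close>
  define x where "x = complex_of_real ((1 + R) / 2)"
  have x: "norm x = (1 + R) / 2" using R unfolding x_def norm_of_real by simp
  have "summable (\<lambda>k. c k * x ^ k)"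
    using R x by (intro sums_summable[OF sums]) simp
  then have ns: "summable (\<lambda>k. norm (c k * 1 ^ k))"
    using R x by (intro powser_insidea[of c x]) auto
  have int: "integrable \<mu> (\<lambda>\<zeta>. c k * \<zeta> ^ k)" for k
  proof (rule circle.integrable_const_bound[where B = "norm (c k)"])
    show "AE \<zeta> in \<mu>. norm (c k * \<zeta> ^ k) \<le> norm (c k)"
      using AE_circle_norm by eventually_elim (simp add: norm_mult norm_power)
  qed (intro borel_measurable_circle_continuous continuous_intros)
  have "(\<lambda>k. \<integral>\<zeta>. c k * \<zeta> ^ k \<partial>\<mu>) sums (\<integral>\<zeta>. (\<Sum>k. c k * \<zeta> ^ k) \<partial>\<mu>)"
  proof (rule sums_integral[OF int])
    show "AE \<zeta> in \<mu>. summable (\<lambda>k. norm (c k * \<zeta> ^ k))"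
      using AE_circle_norm by eventually_elim (use ns in \<open>simp add: norm_mult norm_power\<close>)
    have "(\<integral>\<zeta>. norm (c k * \<zeta> ^ k) \<partial>\<mu>) = norm (c k) * (2 * pi)" for k
    proof -
      have "(\<integral>\<zeta>. norm (c k * \<zeta> ^ k) \<partial>\<mu>) = (\<integral>\<zeta>. norm (c k) \<partial>\<mu>)"
        by (rule Bochner_Integration.integral_cong) (auto simp: space_circle_measure norm_mult norm_power)
      then show ?thesis by (simp add: measure_circle_space)
    qed
    then show "summable (\<lambda>k. \<integral>\<zeta>. norm (c k * \<zeta> ^ k) \<partial>\<mu>)"
      using ns by (simp add: summable_mult2)
  qed
  moreover have "(\<integral>\<zeta>. c k * \<zeta> ^ k \<partial>\<mu>) = (if k = 0 then 2 * pi * G 0 else 0)" for k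
    using integral_circle_power[of k] by (auto simp: measure_circle_space c_def scaleR_conv_of_real)
  moreover have "(\<integral>\<zeta>. (\<Sum>k. c k * \<zeta> ^ k) \<partial>\<mu>) = (\<integral>\<zeta>. G \<zeta> \<partial>\<mu>)"
    by (rule Bochner_Integration.integral_cong)
       (use R in \<open>auto simp: space_circle_measure intro!: sums_unique[OF sums, symmetric]\<close>)
  ultimately have "(\<lambda>k. if k = 0 then 2 * pi * G 0 else 0) sums (\<integral>\<zeta>. G \<zeta> \<partial>\<mu>)"
    by simp
  from sums_unique2[OF sums_single[of 0 "\<lambda>_. 2 * pi * G 0"] this[unfolded if_distrib[of complex_of_real]]]
  show ?thesis by simp
qed

text \<open>Density at \<open>\<zeta>\<close> of harmonic measure at \<open>a\<close> with respect
  to arc length. The factor \<open>2 * pi\<close> matches the total mass of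
  \<open>circle_measure\<close>, so this is a probability density.\<close>

definition poisson :: "complex \<Rightarrow> complex \<Rightarrow> real" where
  "poisson a \<zeta> = (1 - norm a ^ 2) / (2 * pi * norm (\<zeta> - a) ^ 2)"

text \<open>All three follow from
  \<open>1 - norm a \<le> norm (\<zeta> - a) \<le> 1 + norm a\<close>. They serve as Harnack's
  inequality and as uniform bounds for dominated convergence and Fubini.\<close>

lemma poisson_bounds:
  assumes "norm a < 1" "norm \<zeta> = 1"
  shows "(1 - norm a) / (2 * pi * (1 + norm a)) \<le> poisson a \<zeta>"
    and "poisson a \<zeta> \<le> (1 + norm a) / (2 * pi * (1 - norm a))"
    and "0 < poisson a \<zeta>"
proof -
  have l: "1 - norm a \<le> norm (\<zeta> - a)" and u: "norm (\<zeta> - a) \<le> 1 + norm a"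
    using norm_triangle_ineq2[of \<zeta> a] norm_triangle_ineq4[of \<zeta> a] assms by auto
  have e: "1 - norm a ^ 2 = (1 - norm a) * (1 + norm a)" by (simp add: power2_eq_square algebra_simps)
  have p: "1 - norm a ^ 2 > 0" unfolding e using assms by (intro mult_pos_pos) (auto intro: add_pos_nonneg)
  have n: "norm (\<zeta> - a) > 0" using l assms by linarith
  show "0 < poisson a \<zeta>"
    unfolding poisson_def using p n by simp
  have "(1 - norm a) / (2 * pi * (1 + norm a)) = (1 - norm a ^ 2) / (2 * pi * (1 + norm a)^2)"
    unfolding e using assms by (auto simp: power2_eq_square add_nonneg_eq_0_iff add_eq_0_iff)
  also have "\<dots> \<le> poisson a \<zeta>"
    unfolding poisson_def using p n u
    by (intro divide_left_mono mult_left_mono power_mono mult_pos_pos) auto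
  finally show "(1 - norm a) / (2 * pi * (1 + norm a)) \<le> poisson a \<zeta>" .
  have "poisson a \<zeta> \<le> (1 - norm a ^ 2) / (2 * pi * (1 - norm a)^2)"
    unfolding poisson_def using p n l assms
    by (intro divide_left_mono mult_left_mono power_mono mult_pos_pos) auto
  also have "\<dots> = (1 + norm a) / (2 * pi * (1 - norm a))"
    unfolding e using assms by (simp add: power2_eq_square)
  finally show "poisson a \<zeta> \<le> (1 + norm a) / (2 * pi * (1 - norm a))" .
qed

text \<open>The kernel is written with \<open>cnj a * \<zeta>\<close> instead of the usual
  \<open>(\<zeta> + a) / (\<zeta> - a)\<close>. Both have the same real part on the circle, but this
  one is holomorphic in \<open>\<zeta>\<close> across the closed disc, so the mean value property
  applies to it.\<close>

lemma poisson_Re: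
  assumes "norm a < 1" "norm \<zeta> = 1"
  shows "2 * pi * poisson a \<zeta> = Re ((1 + cnj a * \<zeta>) / (1 - cnj a * \<zeta>))"
proof -
  define w where "w = cnj a * \<zeta>"
  have nw: "norm w = norm a" using assms by (simp add: w_def norm_mult)
  have "norm (1 - w) = norm (\<zeta> * (cnj \<zeta> - cnj a))"
    using assms complex_norm_square[of \<zeta>] by (simp add: w_def algebra_simps)
  also have "\<dots> = norm (\<zeta> - a)"
    using assms by (metis complex_cnj_diff complex_mod_cnj mult_1 norm_mult)
  finally have d: "norm (1 - w) = norm (\<zeta> - a)" .
  have "Re ((1 + w) / (1 - w)) = (1 - norm w ^ 2) / norm (1 - w) ^ 2"
    unfolding cmod_power2 by (simp add: Re_divide algebra_simps) (simp add: power2_eq_square)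
  then show ?thesis
    by (simp add: poisson_def d nw flip: w_def)
qed

lemma integral_poisson:
  assumes "norm a < 1"
  shows "(\<integral>\<zeta>. poisson a \<zeta> \<partial>\<mu>) = 1"
proof -
  \<comment> \<open>\<open>1 / norm a\<close> is the modulus of the pole \<open>1 / cnj a\<close>;
    for \<open>a = 0\<close> there is no pole and 2 is arbitrary.\<close>
  define R where "R = (if a = 0 then 2 else 1 / norm a)"
  have R: "R > 1" using assms by (auto simp: R_def)
  have nz: "1 - cnj a * z \<noteq> 0" if "norm z < R" for z
  proof
    assume "1 - cnj a * z = 0"
    then have "norm (cnj a * z) = 1" by (simp add: algebra_simps flip: eq_iff_diff_eq_0)
    then show False using that by (auto simp: R_def norm_mult field_simps split: if_splits)
  qed
  let ?G = "\<lambda>z::complex. (1 + cnj a * z) / (1 - cnj a * z)"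
  have G: "?G holomorphic_on ball 0 R" by (intro holomorphic_intros) (use nz in auto)
  have int: "integrable \<mu> ?G"
  proof (rule Bochner_Integration.integrable_bound[of \<mu> "\<lambda>_. 2 / (1 - norm a)"])
    show "AE \<zeta> in \<mu>. norm (?G \<zeta>) \<le> norm (2 / (1 - norm a))"
      using AE_circle_norm
    proof eventually_elim
      case (elim \<zeta>)
      have "norm (1 + cnj a * \<zeta>) \<le> 2" using norm_triangle_ineq[of 1 "cnj a * \<zeta>"] elim assms by (simp add: norm_mult)
      moreover have "norm (1 - cnj a * \<zeta>) \<ge> 1 - norm a" using norm_triangle_ineq2[of 1 "cnj a * \<zeta>"] elim by (simp add: norm_mult)
      ultimately show ?case using assms by (auto simp: norm_divide intro!: frac_le)
    qed
    show "?G \<in> borel_measurable \<mu>"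
      by (intro borel_measurable_circle_continuous holomorphic_on_imp_continuous_on
          holomorphic_on_subset[OF G]) (use R in auto)
  qed simp
  have "(\<integral>\<zeta>. poisson a \<zeta> \<partial>\<mu>) = (\<integral>\<zeta>. Re (?G \<zeta>) / (2 * pi) \<partial>\<mu>)"
    by (rule Bochner_Integration.integral_cong)
       (simp_all add: space_circle_measure poisson_Re[OF assms, symmetric])
  also have "\<dots> = Re (\<integral>\<zeta>. ?G \<zeta> \<partial>\<mu>) / (2 * pi)"
    using integral_Re[OF int] by simp
  also have "\<dots> = 1" using circle_mean_value[OF G R] by simp
  finally show ?thesis .
qed

lemma poisson_measurable [measurable]:
  assumes [measurable]: "f \<in> borel_measurable M" "g \<in> borel_measurable M"
  shows "(\<lambda>x. poisson (f x) (g x)) \<in> borel_measurable M"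
  unfolding poisson_def by measurable

lemma id_measurable_circle [measurable]: "(\<lambda>\<zeta>. \<zeta>) \<in> borel_measurable \<mu>"
  by (intro borel_measurable_circle_continuous continuous_intros)

lemma integrable_circle_bounded:
  fixes f :: "complex \<Rightarrow> 'a::{banach, second_countable_topology}"
  assumes "f \<in> borel_measurable \<mu>" "\<And>\<zeta>. norm \<zeta> = 1 \<Longrightarrow> norm (f \<zeta>) \<le> B"
  shows "integrable \<mu> f"
  using assms AE_circle_norm
  by (intro circle.integrable_const_bound[where B = B]) (auto elim!: eventually_mono)

lemma integrable_poisson: "norm a < 1 \<Longrightarrow> integrable \<mu> (poisson a)"
  using poisson_bounds(2,3)[of a]
  by (intro integrable_circle_bounded[where B = "(1 + norm a) / (2 * pi * (1 - norm a))"])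
     (auto simp: abs_of_pos)

lemma integrable_mult_bounded:
  fixes f :: "complex \<Rightarrow> 'a::{real_normed_field, banach, second_countable_topology}"
  assumes "f \<in> borel_measurable \<mu>" "AE \<zeta> in \<mu>. norm (f \<zeta>) \<le> B"
    and g: "integrable \<mu> g"
  shows "integrable \<mu> (\<lambda>\<zeta>. of_real (g \<zeta>) * f \<zeta>)"
proof (rule Bochner_Integration.integrable_bound)
  show "integrable \<mu> (\<lambda>\<zeta>. B * g \<zeta>)" using g by simp
  show "AE \<zeta> in \<mu>. norm (of_real (g \<zeta>) * f \<zeta>) \<le> norm (B * g \<zeta>)"
    using assms(2)
  proof eventually_elim
    case (elim \<zeta>)
    have "\<bar>g \<zeta>\<bar> * norm (f \<zeta>) \<le> \<bar>g \<zeta>\<bar> * \<bar>B\<bar>" using elim by (intro mult_left_mono) auto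
    then show ?case by (simp add: norm_mult abs_mult mult_ac)
  qed
qed (use assms in measurable)

lemma integrable_poisson_mult:
  fixes f :: "complex \<Rightarrow> real"
  assumes "f \<in> borel_measurable \<mu>" "AE \<zeta> in \<mu>. norm (f \<zeta>) \<le> B" "norm a < 1"
  shows "integrable \<mu> (\<lambda>\<zeta>. poisson a \<zeta> * f \<zeta>)"
  using integrable_mult_bounded[OF assms(1,2) integrable_poisson[OF assms(3)]] by simp

lemma continuous_circle_bounded:
  fixes f :: "complex \<Rightarrow> 'a::real_normed_vector"
  assumes "continuous_on (sphere 0 1) f"
  obtains B where "\<And>\<zeta>. norm \<zeta> = 1 \<Longrightarrow> norm (f \<zeta>) \<le> B"
proof -
  have "bounded (f ` sphere 0 1)" by (intro compact_imp_bounded compact_continuous_image assms) auto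
  then obtain B where "\<forall>x\<in>f ` sphere 0 1. norm x \<le> B" unfolding bounded_iff by blast
  then show ?thesis using that[of B] by simp
qed

text \<open>On the circle \<open>norm (\<zeta> - a) ^ 2\<close> factors as
  \<open>(\<zeta> - a) * cnj (\<zeta> - a)\<close>, and
  \<open>cnj (\<zeta> - a) = (1 - cnj a * \<zeta>) / \<zeta>\<close>. After subtracting
  \<open>F a\<close> the first factor cancels, and the integrand agrees with a holomorphic function
  \<open>G\<close> vanishing at 0, whose mean is 0.\<close>

lemma poisson_integral_disc:
  assumes F: "F holomorphic_on ball 0 R" and R: "R > 1" and a: "norm a < 1"
  shows "(\<integral>\<zeta>. of_real (poisson a \<zeta>) * F \<zeta> \<partial>\<mu>) = F a"
proof -
  define R' where "R' = (if a = 0 then R else min R (1 / norm a))"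
  have R': "R' > 1" "R' \<le> R" using a R by (auto simp: R'_def)
  have nz: "1 - cnj a * z \<noteq> 0" if "norm z < R'" for z
  proof
    assume "1 - cnj a * z = 0"
    then have "norm (cnj a * z) = 1" by (simp add: algebra_simps flip: eq_iff_diff_eq_0)
    then show False using that by (auto simp: R'_def norm_mult field_simps split: if_splits)
  qed
  define Q where "Q z = (if z = a then deriv F a else (F z - F a) / (z - a))" for z
  have Q: "Q holomorphic_on ball 0 R"
    unfolding Q_def by (rule pole_lemma_open[OF F]) auto
  define G where "G z = (1 - (norm a)\<^sup>2) * z * Q z / (1 - cnj a * z) / (2 * pi)" for z :: complex
  have G: "G holomorphic_on ball 0 R'"
    unfolding G_def by (intro holomorphic_intros holomorphic_on_subset[OF Q]) (use nz R' in auto)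
  have G_eq: "of_real (poisson a \<zeta>) * (F \<zeta> - F a) = G \<zeta>" if "norm \<zeta> = 1" for \<zeta>
  proof -
    have ne: "\<zeta> \<noteq> a" using that a by auto
    define d where "d = cnj (\<zeta> - a)"
    have "\<zeta> * d = \<zeta> * cnj \<zeta> - cnj a * \<zeta>" by (simp add: d_def algebra_simps)
    then have d1: "1 - cnj a * \<zeta> = \<zeta> * d"
      using complex_norm_square[of \<zeta>] that by simp
    have d0: "d \<noteq> 0" unfolding d_def using ne by simp
    have "complex_of_real ((norm (\<zeta> - a))\<^sup>2) = (\<zeta> - a) * d"
      unfolding d_def by (rule complex_norm_square)
    then have "complex_of_real (poisson a \<zeta>) = (1 - (norm a)\<^sup>2) / (2 * pi * ((\<zeta> - a) * d))"
      by (simp add: poisson_def)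
    moreover have "\<zeta> \<noteq> 0" using that by auto
    ultimately show ?thesis using ne d0
      by (simp add: G_def Q_def d1 mult.assoc)
  qed
  have Fm: "F \<in> borel_measurable \<mu>"
    by (intro borel_measurable_circle_continuous holomorphic_on_imp_continuous_on
          holomorphic_on_subset[OF F]) (use R in auto)
  have "continuous_on (sphere 0 1) F"
    by (intro holomorphic_on_imp_continuous_on holomorphic_on_subset[OF F]) (use R in auto)
  from continuous_circle_bounded[OF this]
  obtain B where B: "\<And>\<zeta>. norm \<zeta> = 1 \<Longrightarrow> norm (F \<zeta>) \<le> B" by blast
  have int: "integrable \<mu> (\<lambda>\<zeta>. of_real (poisson a \<zeta>) * F \<zeta>)"
    by (rule integrable_mult_bounded[OF Fm, where B = B])
       (use B AE_circle_norm in \<open>auto elim!: eventually_mono simp: integrable_poisson a\<close>)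
  have ip: "integrable \<mu> (\<lambda>\<zeta>. of_real (poisson a \<zeta>) * F a)"
    using integrable_of_real[OF integrable_poisson[OF a]] by (rule integrable_mult_left)
  have "(\<integral>\<zeta>. of_real (poisson a \<zeta>) * F \<zeta> \<partial>\<mu>) -
      (\<integral>\<zeta>. of_real (poisson a \<zeta>) * F a \<partial>\<mu>)
     = (\<integral>\<zeta>. of_real (poisson a \<zeta>) * F \<zeta> - of_real (poisson a \<zeta>) * F a \<partial>\<mu>)"
    by (rule Bochner_Integration.integral_diff[OF int ip, symmetric])
  also have "\<dots> = (\<integral>\<zeta>. G \<zeta> \<partial>\<mu>)"
    by (rule Bochner_Integration.integral_cong)
       (use G_eq in \<open>simp_all add: space_circle_measure right_diff_distrib\<close>)
  also have "\<dots> = 0" using circle_mean_value[OF G R'(1)] by (simp add: G_def)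
  finally show ?thesis
    using integral_poisson[OF a] by simp
qed

text \<open>For partial sums this is orthogonality of powers, one new coefficient at a time;
  summability of the norms bounds all of them by one constant, and dominated convergence gives the
  full series. In its uses the coefficients carry a factor \<open>R ^ k\<close> with
  \<open>R < 1\<close>, which supplies the summability.\<close>

lemma circle_parseval:
  fixes c :: "nat \<Rightarrow> complex"
  assumes c: "summable (\<lambda>k. norm (c k))"
  shows "(\<lambda>k. norm (c k) ^ 2) sums ((\<integral>\<zeta>. norm (\<Sum>k. c k * \<zeta> ^ k) ^ 2 \<partial>\<mu>) / (2 * pi))"
proof -
  define S where "S K \<zeta> = (\<Sum>k<K. c k * \<zeta> ^ k)" for K :: nat and \<zeta> :: complex
  have S_cont: "continuous_on (sphere 0 1) (S K)" for K unfolding S_def by (intro continuous_intros)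
  have S_meas: "S K \<in> borel_measurable \<mu>" for K
    by (rule borel_measurable_circle_continuous[OF S_cont])
  define B where "B = (\<Sum>k. norm (c k))"
  have S_bd: "norm (S K \<zeta>) \<le> B" if "norm \<zeta> = 1" for K \<zeta>
  proof -
    have "norm (S K \<zeta>) \<le> (\<Sum>k<K. norm (c k * \<zeta> ^ k))" unfolding S_def by (rule norm_sum)
    also have "\<dots> \<le> B" using that c unfolding B_def
      by (simp add: norm_mult norm_power) (rule sum_le_suminf, auto)
    finally show ?thesis .
  qed
  have B0: "B \<ge> 0" unfolding B_def using c by (intro suminf_nonneg) auto
  have fin: "(\<integral>\<zeta>. norm (S K \<zeta>) ^ 2 \<partial>\<mu>) = 2 * pi * (\<Sum>k<K. norm (c k) ^ 2)" for K
  proof (induction K)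
    case 0
    then show ?case by (simp add: S_def)
  next
    case (Suc K)
    have i1: "integrable \<mu> (\<lambda>\<zeta>. norm (S K \<zeta>) ^ 2)"
      by (rule integrable_circle_bounded[where B = "B^2"])
         (use S_meas S_bd in \<open>auto intro!: power_mono\<close>)
    have ik: "integrable \<mu> (\<lambda>\<zeta>. c k * \<zeta> ^ k * cnj (c K * \<zeta> ^ K))" for k
      by (rule integrable_circle_bounded[where B = "norm (c k) * norm (c K)"])
         (auto simp: norm_mult norm_power intro!: borel_measurable_circle_continuous continuous_intros)
    have cross0: "(\<integral>\<zeta>. c k * \<zeta> ^ k * cnj (c K * \<zeta> ^ K) \<partial>\<mu>) = 0" if "k < K" for k
    proof -
      have "(\<integral>\<zeta>. c k * \<zeta> ^ k * cnj (c K * \<zeta> ^ K) \<partial>\<mu>)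
          = (\<integral>\<zeta>. c k * cnj (c K) * cnj (\<zeta> ^ (K - k)) \<partial>\<mu>)"
      proof (rule Bochner_Integration.integral_cong[OF refl])
        fix \<zeta> assume "\<zeta> \<in> space \<mu>"
        then have "\<zeta> * cnj \<zeta> = 1" using complex_norm_square[of \<zeta>] by (simp add: space_circle_measure)
        then have "\<zeta> ^ k * cnj \<zeta> ^ k = 1" by (metis power_mult_distrib power_one)
        moreover have "cnj \<zeta> ^ K = cnj \<zeta> ^ k * cnj \<zeta> ^ (K - k)" using that by (simp flip: power_add)
        ultimately show "c k * \<zeta> ^ k * cnj (c K * \<zeta> ^ K) = c k * cnj (c K) * cnj (\<zeta> ^ (K - k))"
          by (simp add: mult_ac)
      qed
      also have "\<dots> = c k * cnj (c K) * cnj (\<integral>\<zeta>. \<zeta> ^ (K - k) \<partial>\<mu>)"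
        by (simp del: complex_cnj_power)
      also have "\<dots> = 0" using integral_circle_power[of "K - k"] that by simp
      finally show ?thesis .
    qed
    have iS: "integrable \<mu> (\<lambda>\<zeta>. S K \<zeta> * cnj (c K * \<zeta> ^ K))"
      unfolding S_def sum_distrib_right by (intro Bochner_Integration.integrable_sum ik)
    have "(\<integral>\<zeta>. S K \<zeta> * cnj (c K * \<zeta> ^ K) \<partial>\<mu>) = 0"
      unfolding S_def sum_distrib_right
    proof -
      have "(\<integral>\<zeta>. (\<Sum>k<K. c k * \<zeta> ^ k * cnj (c K * \<zeta> ^ K)) \<partial>\<mu>)
          = (\<Sum>k<K. \<integral>\<zeta>. c k * \<zeta> ^ k * cnj (c K * \<zeta> ^ K) \<partial>\<mu>)"
        by (rule Bochner_Integration.integral_sum[OF ik])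
      also have "\<dots> = 0"
      proof (rule sum.neutral, rule ballI)
        fix k assume "k \<in> {..<K}"
        then have "k < K" by simp
        then show "(\<integral>\<zeta>. c k * \<zeta> ^ k * cnj (c K * \<zeta> ^ K) \<partial>\<mu>) = 0" by (rule cross0)
      qed
      finally show "(\<integral>\<zeta>. (\<Sum>k<K. c k * \<zeta> ^ k * cnj (c K * \<zeta> ^ K)) \<partial>\<mu>) = 0" .
    qed
    then have cross: "(\<integral>\<zeta>. Re (S K \<zeta> * cnj (c K * \<zeta> ^ K)) \<partial>\<mu>) = 0"
      using integral_Re[OF iS] by simp
    have "(\<integral>\<zeta>. norm (S (Suc K) \<zeta>) ^ 2 \<partial>\<mu>)
       = (\<integral>\<zeta>. norm (S K \<zeta>) ^ 2 + norm (c K) ^ 2 + 2 * Re (S K \<zeta> * cnj (c K * \<zeta> ^ K)) \<partial>\<mu>)"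
    proof (rule Bochner_Integration.integral_cong[OF refl])
      fix \<zeta> assume "\<zeta> \<in> space \<mu>"
      then have n: "norm (c K * \<zeta> ^ K) = norm (c K)" by (simp add: space_circle_measure norm_mult norm_power)
      have "norm (x + y) ^ 2 = norm x ^ 2 + norm y ^ 2 + 2 * Re (x * cnj y)" for x y :: complex
        unfolding cmod_power2 by (simp add: power2_eq_square algebra_simps)
      from this[of "S K \<zeta>" "c K * \<zeta> ^ K"]
      show "norm (S (Suc K) \<zeta>) ^ 2 = norm (S K \<zeta>) ^ 2 + norm (c K) ^ 2 + 2 * Re (S K \<zeta> * cnj (c K * \<zeta> ^ K))"
        by (simp add: n S_def)
    qed
    also have "\<dots> = (\<integral>\<zeta>. norm (S K \<zeta>) ^ 2 \<partial>\<mu>) + 2 * pi * norm (c K) ^ 2"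
    proof -
      define W where "W \<zeta> = Re (S K \<zeta> * cnj (c K * \<zeta> ^ K))" for \<zeta>
      have "integrable \<mu> W" "(\<integral>\<zeta>. W \<zeta> \<partial>\<mu>) = 0"
        using integrable_Re[OF iS] cross by (simp_all only: W_def[abs_def])
      then show ?thesis unfolding W_def[symmetric] using i1 by (simp add: measure_circle_space)
    qed
    finally show ?case using Suc by (simp add: algebra_simps)
  qed
  have pw: "(\<lambda>K. S K \<zeta>) \<longlonglongrightarrow> (\<Sum>k. c k * \<zeta> ^ k)" if "norm \<zeta> = 1" for \<zeta>
  proof -
    have "summable (\<lambda>k. norm (c k * \<zeta> ^ k))" using c that by (simp add: norm_mult norm_power)
    then have "summable (\<lambda>k. c k * \<zeta> ^ k)" by (rule summable_norm_cancel)
    then show ?thesis unfolding S_def by (rule summable_LIMSEQ)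
  qed
  have "(\<lambda>K. \<integral>\<zeta>. norm (S K \<zeta>) ^ 2 \<partial>\<mu>) \<longlonglongrightarrow> (\<integral>\<zeta>. norm (\<Sum>k. c k * \<zeta> ^ k) ^ 2 \<partial>\<mu>)"
  proof (rule integral_dominated_convergence[where w = "\<lambda>_. B ^ 2"])
    show "AE \<zeta> in \<mu>. norm (norm (S K \<zeta>) ^ 2) \<le> B ^ 2" for K
      using AE_circle_norm by eventually_elim (use S_bd in \<open>auto intro!: power_mono\<close>)
    show "AE \<zeta> in \<mu>. (\<lambda>K. norm (S K \<zeta>) ^ 2) \<longlonglongrightarrow> norm (\<Sum>k. c k * \<zeta> ^ k) ^ 2"
      using AE_circle_norm by eventually_elim (intro tendsto_intros pw)
    have "(\<lambda>\<zeta>. \<Sum>k. c k * \<zeta> ^ k) \<in> borel_measurable \<mu>" by measurable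
    then show "(\<lambda>\<zeta>. norm (\<Sum>k. c k * \<zeta> ^ k) ^ 2) \<in> borel_measurable \<mu>" by measurable
  qed (use S_meas in measurable)
  then have "(\<lambda>K. (\<integral>\<zeta>. norm (S K \<zeta>) ^ 2 \<partial>\<mu>) / (2 * pi))
      \<longlonglongrightarrow> (\<integral>\<zeta>. norm (\<Sum>k. c k * \<zeta> ^ k) ^ 2 \<partial>\<mu>) / (2 * pi)"
    by (intro tendsto_intros) auto
  then show ?thesis unfolding sums_def by (simp add: fin)
qed

text \<open>Expanding the square, the cross term is determined by the mean \<open>m\<close>.
  Nonnegativity of the left side gives Jensen's inequality for the squared modulus; the right side
  is what becomes summable along orbits.\<close>

lemma poisson_variance:
  fixes F :: "complex \<Rightarrow> complex"
  assumes F: "F \<in> borel_measurable \<mu>" "AE \<zeta> in \<mu>. norm (F \<zeta>) \<le> B"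
    and a: "norm a < 1"
    and m: "(\<integral>\<zeta>. of_real (poisson a \<zeta>) * F \<zeta> \<partial>\<mu>) = m"
  shows "(\<integral>\<zeta>. poisson a \<zeta> * norm (F \<zeta> - m) ^ 2 \<partial>\<mu>)
       = (\<integral>\<zeta>. poisson a \<zeta> * norm (F \<zeta>) ^ 2 \<partial>\<mu>) - norm m ^ 2"
proof -
  note [measurable] = F(1)
  note ik = integrable_poisson[OF a]
  have i1: "integrable \<mu> (\<lambda>\<zeta>. of_real (poisson a \<zeta>) * F \<zeta>)"
    by (rule integrable_mult_bounded[OF F ik])
  have i2: "integrable \<mu> (\<lambda>\<zeta>. poisson a \<zeta> * norm (F \<zeta>) ^ 2)"
  proof -
    have "AE \<zeta> in \<mu>. norm (norm (F \<zeta>) ^ 2) \<le> B ^ 2"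
      using F(2) by eventually_elim (auto intro!: power_mono)
    then show ?thesis by (intro integrable_poisson_mult a) measurable
  qed
  have i3: "integrable \<mu> (\<lambda>\<zeta>. of_real (poisson a \<zeta>) * F \<zeta> * cnj m)"
    using i1 by (rule integrable_mult_left)
  have "Re (\<integral>\<zeta>. of_real (poisson a \<zeta>) * F \<zeta> * cnj m \<partial>\<mu>) = norm m ^ 2"
    unfolding integral_mult_left_zero m complex_norm_square[symmetric] by (simp only: Re_complex_of_real)
  then have cross: "(\<integral>\<zeta>. Re (of_real (poisson a \<zeta>) * F \<zeta> * cnj m) \<partial>\<mu>) = norm m ^ 2"
    using integral_Re[OF i3] by simp
  have "(\<integral>\<zeta>. poisson a \<zeta> * norm (F \<zeta> - m) ^ 2 \<partial>\<mu>)
    = (\<integral>\<zeta>. poisson a \<zeta> * norm (F \<zeta>) ^ 2 - 2 * Re (of_real (poisson a \<zeta>) * F \<zeta> * cnj m)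
        + norm m ^ 2 * poisson a \<zeta> \<partial>\<mu>)"
  proof (rule Bochner_Integration.integral_cong[OF refl])
    fix \<zeta>
    show "poisson a \<zeta> * norm (F \<zeta> - m) ^ 2
      = poisson a \<zeta> * norm (F \<zeta>) ^ 2 - 2 * Re (of_real (poisson a \<zeta>) * F \<zeta> * cnj m)
        + norm m ^ 2 * poisson a \<zeta>"
      unfolding cmod_power2 by (simp add: power2_eq_square algebra_simps)
  qed
  also have "\<dots> = (\<integral>\<zeta>. poisson a \<zeta> * norm (F \<zeta>) ^ 2 \<partial>\<mu>) - 2 * norm m ^ 2 + norm m ^ 2"
  proof -
    define W where "W \<zeta> = Re (of_real (poisson a \<zeta>) * F \<zeta> * cnj m)" for \<zeta>
    have "integrable \<mu> W" "(\<integral>\<zeta>. W \<zeta> \<partial>\<mu>) = norm m ^ 2"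
      using integrable_Re[OF i3] cross by (simp_all only: W_def[abs_def])
    then show ?thesis unfolding W_def[symmetric] using i2 ik by (simp add: integral_poisson[OF a])
  qed
  finally show ?thesis by simp
qed

text \<open>The lower half of the circle is reflected onto the upper one by
  \<open>2 * pi - t\<close>. The folded form suits the Poisson kernel at a real point, which is even
  in \<open>t\<close>, and averages over arcs centred at 1.\<close>

lemma circle_integral_symmetric:
  fixes u :: "complex \<Rightarrow> real"
  assumes u: "continuous_on (sphere 0 1) u"
  shows "((\<lambda>t. u (cis t) + u (cis (- t))) has_integral (\<integral>\<zeta>. u \<zeta> \<partial>\<mu>)) {0..pi}"
proof -
  have c: "continuous_on A (\<lambda>t. u (cis (f t)))" if "continuous_on A f" for A and f :: "real \<Rightarrow> real"
    by (rule continuous_on_compose2[OF u]) (auto intro!: continuous_intros that)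
  have "(\<integral>\<zeta>. u \<zeta> \<partial>\<mu>) = (LINT t:{0..2*pi}|lborel. u (cis t))"
    by (subst integral_circle_measure[OF borel_measurable_circle_continuous[OF u]])
       (simp add: set_integral_Icc_Ico)
  also have "\<dots> = integral {0..2*pi} (\<lambda>t. u (cis t))"
    by (intro set_borel_integral_eq_integral borel_integrable_atLeastAtMost' c continuous_intros)
  also have "\<dots> = integral {0..pi} (\<lambda>t. u (cis t)) + integral {pi..2*pi} (\<lambda>t. u (cis t))"
    by (rule Henstock_Kurzweil_Integration.integral_combine[symmetric])
       (auto intro!: integrable_continuous_interval c continuous_intros)
  finally have eq: "(\<integral>\<zeta>. u \<zeta> \<partial>\<mu>)
      = integral {0..pi} (\<lambda>t. u (cis t)) + integral {pi..2*pi} (\<lambda>t. u (cis t))" .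
  have "((\<lambda>t. u (cis t)) has_integral integral {pi..2*pi} (\<lambda>t. u (cis t))) (cbox pi (2*pi))"
    by (auto intro!: integrable_integral integrable_continuous_interval c continuous_intros)
  from has_integral_affinity[OF this, of "-1" "2*pi"]
  have "((\<lambda>t. u (cis (2*pi - t))) has_integral integral {pi..2*pi} (\<lambda>t. u (cis t)))
      ((\<lambda>x. 2*pi - x) ` {pi..2*pi})"
    by simp
  moreover have "(\<lambda>x. 2*pi - x) ` {pi..2*pi} = {0..pi}" by auto
  moreover have "cis (2 * pi - t) = cis (- t)" for t by (simp add: complex_eq_iff)
  ultimately have "((\<lambda>t. u (cis (- t))) has_integral integral {pi..2*pi} (\<lambda>t. u (cis t))) {0..pi}"
    by simp
  moreover have "((\<lambda>t. u (cis t)) has_integral integral {0..pi} (\<lambda>t. u (cis t))) {0..pi}"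
    by (auto intro!: integrable_integral integrable_continuous_interval c continuous_intros)
  ultimately show ?thesis unfolding eq by (intro has_integral_add)
qed

subsection \<open>Fatou's theorem\<close>

text \<open>Integrating by parts against the Poisson kernel, which decreases away from \<open>r\<close>, bounds
  the value at \<open>r\<close> by the averages over centred arcs.\<close>

lemma radial_value_le_of_averages:
  fixes g :: "complex \<Rightarrow> complex"
  assumes g: "g holomorphic_on ball 0 R" "R > 1" and r: "0 \<le> r" "r < 1"
    and avg: "\<And>x. 0 \<le> x \<Longrightarrow> x \<le> pi \<Longrightarrow>
      integral {0..x} (\<lambda>t. norm (g (cis t)) ^ 2 + norm (g (cis (- t))) ^ 2) \<le> 2 * l * x"
  shows "norm (g (of_real r)) ^ 2 \<le> l"
proof -
  define h where "h t = norm (g (cis t)) ^ 2 + norm (g (cis (- t))) ^ 2" for t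
  have gc: "continuous_on (sphere 0 1) g"
    by (intro holomorphic_on_imp_continuous_on holomorphic_on_subset[OF g(1)]) (use g in auto)
  have hc: "continuous_on A h" for A
    unfolding h_def by (intro continuous_intros continuous_on_compose2[OF gc]) auto
  define D where "D t = 2 * pi * (1 - 2 * r * cos t + r ^ 2)" for t
  define P where "P t = poisson (of_real r) (cis t)" for t
  have nrm: "norm (cis t - of_real r) ^ 2 = 1 - 2 * r * cos t + r ^ 2" for t
    unfolding cmod_power2 using sin_cos_squared_add[of t] by (simp add: power2_eq_square algebra_simps)
  have P_eq: "P t = (1 - r ^ 2) / D t" for t
    by (simp add: P_def poisson_def nrm D_def)
  have P_neg: "P (- t) = P t" for t by (simp add: P_eq D_def)
  have D_pos: "D t > 0" for t
  proof -
    have "cis t \<noteq> of_real r" using r by (metis abs_of_nonneg less_irrefl norm_cis norm_of_real)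
    then show ?thesis unfolding D_def nrm[symmetric] by simp
  qed
  have P_pos: "P t > 0" for t
    unfolding P_eq using D_pos r by (auto simp: power_less_one_iff abs_square_less_1)
  define P' where "P' t = - ((1 - r ^ 2) * (2 * pi * (2 * r * sin t)) / (D t) ^ 2)" for t
  have D_deriv: "(D has_real_derivative 2 * pi * (2 * r * sin t)) (at t within A)" for t A
    unfolding D_def[abs_def] by (auto intro!: derivative_eq_intros)
  have P_deriv: "(P has_real_derivative P' t) (at t within A)" for t A
  proof -
    have "((\<lambda>t. (1 - r ^ 2) / D t) has_real_derivative
        (0 * D t - (1 - r ^ 2) * (2 * pi * (2 * r * sin t))) / (D t * D t)) (at t within A)"
      by (intro DERIV_divide D_deriv DERIV_const) (use D_pos[of t] in auto)
    then show ?thesis unfolding P_eq[abs_def] P'_def by (simp add: power2_eq_square)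
  qed
  have P_cont: "continuous_on A P" for A
    by (rule DERIV_continuous_on) (rule P_deriv)
  have P'_neg: "P' t \<le> 0" if "t \<in> {0..pi}" for t
    unfolding P'_def using that r D_pos[of t] sin_ge_zero[of t]
    by (auto simp: power_le_one intro!: divide_nonneg_nonneg mult_nonneg_nonneg)
  \<comment> \<open>\<open>L\<close> is the slack in the hypothesis on averages. The derivative of
    \<open>P t * L t\<close> is \<open>P' t * L t + (2 * l - h t) * P t\<close>; its first summand
    is at most 0 and \<open>P * L\<close> does not decrease from 0 to \<open>pi\<close>, so the
    second summand has nonnegative integral.\<close>
  define L where "L x = 2 * l * x - integral {0..x} h" for x
  have L_pos: "L x \<ge> 0" if "x \<in> {0..pi}" for x using avg[of x, folded h_def] that by (simp add: L_def)
  have L_deriv: "(L has_real_derivative (2 * l - h x)) (at x within {0..pi})" if "x \<in> {0..pi}" for x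
    unfolding L_def[abs_def]
    by (auto intro!: derivative_eq_intros integral_has_real_derivative hc that)
  have "((\<lambda>t. P' t * L t + (2 * l - h t) * P t) has_integral (P pi * L pi - P 0 * L 0)) {0..pi}"
    by (rule fundamental_theorem_of_calculus)
       (auto intro!: DERIV_mult P_deriv L_deriv simp flip: has_real_derivative_iff_has_vector_derivative)
  moreover have "((\<lambda>t. (2 * l - h t) * P t) has_integral integral {0..pi} (\<lambda>t. (2 * l - h t) * P t)) {0..pi}"
    by (intro integrable_integral integrable_continuous_interval continuous_intros hc P_cont)
  ultimately have "P pi * L pi - P 0 * L 0 \<le> integral {0..pi} (\<lambda>t. (2 * l - h t) * P t)"
    by (rule has_integral_le) (use P'_neg L_pos in \<open>auto intro: mult_nonpos_nonneg\<close>)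
  moreover have "L 0 = 0" by (simp add: L_def)
  moreover have "P pi * L pi \<ge> 0" using P_pos[of pi] L_pos[of pi] by simp
  ultimately have *: "0 \<le> integral {0..pi} (\<lambda>t. (2 * l - h t) * P t)" by simp
  have kc: "continuous_on (sphere 0 1) (poisson (of_real r))"
    unfolding poisson_def using r by (intro continuous_intros) (auto simp: norm_of_real)
  have "((\<lambda>t. P t + P (- t)) has_integral 1) {0..pi}"
    using circle_integral_symmetric[OF kc] integral_poisson[of "of_real r"] r by (simp add: P_def)
  then have h1: "((\<lambda>t. P t * 2) has_integral 1) {0..pi}" by (simp add: P_neg mult.commute)
  define I where "I = (\<integral>\<zeta>. poisson (of_real r) \<zeta> * norm (g \<zeta>) ^ 2 \<partial>\<mu>)"
  have "((\<lambda>t. poisson (of_real r) (cis t) * norm (g (cis t)) ^ 2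
      + poisson (of_real r) (cis (-t)) * norm (g (cis (-t))) ^ 2) has_integral I) {0..pi}"
    unfolding I_def by (rule circle_integral_symmetric) (intro continuous_intros kc gc)
  then have h2: "((\<lambda>t. h t * P t) has_integral I) {0..pi}"
    by (simp add: h_def P_neg algebra_simps flip: P_def)
  have "((\<lambda>t. l * (P t * 2) - h t * P t) has_integral (l * 1 - I)) {0..pi}"
    by (intro has_integral_diff has_integral_mult_right h1 h2)
  then have "I \<le> l" using * by (simp add: integral_unique algebra_simps)
  \<comment> \<open>Nonnegative variance: \<open>g (of_real r)\<close> is the mean of
    \<open>g\<close> under \<open>poisson (of_real r)\<close>, and \<open>I\<close> is the second
    moment.\<close>
  moreover have "norm (g (of_real r)) ^ 2 \<le> I"
  proof -
    obtain B where B: "\<And>\<zeta>. norm \<zeta> = 1 \<Longrightarrow> norm (g \<zeta>) \<le> B"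
      using continuous_circle_bounded[OF gc] by blast
    have "(\<integral>\<zeta>. of_real (poisson (of_real r) \<zeta>) * g \<zeta> \<partial>\<mu>) = g (of_real r)"
      using r by (intro poisson_integral_disc[OF g]) auto
    moreover have "AE \<zeta> in \<mu>. norm (g \<zeta>) \<le> B"
      using AE_circle_norm by eventually_elim (rule B)
    ultimately
    have "(\<integral>\<zeta>. poisson (of_real r) \<zeta> * norm (g \<zeta> - g (of_real r)) ^ 2 \<partial>\<mu>) = I - norm (g (of_real r)) ^ 2"
      unfolding I_def using r by (intro poisson_variance[OF borel_measurable_circle_continuous[OF gc]]) auto
    moreover have "(\<integral>\<zeta>. poisson (of_real r) \<zeta> * norm (g \<zeta> - g (of_real r)) ^ 2 \<partial>\<mu>) \<ge> 0"
      by (rule Bochner_Integration.integral_nonneg_AE)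
         (use AE_circle_norm in eventually_elim, use r poisson_bounds(3)[of "of_real r"] in \<open>auto intro!: mult_nonneg_nonneg intro: less_imp_le\<close>)
    ultimately show ?thesis by simp
  qed
  ultimately show ?thesis by simp
qed

section \<open>Weak-type inequality for the radial maximal function\<close>

lemma sets_circle_radial_sup:
  assumes g: "g holomorphic_on ball 0 R" "R \<ge> 1"
  shows "{\<zeta> \<in> sphere 0 1. \<exists>r. 0 \<le> r \<and> r < 1 \<and> l < norm (g (of_real r * \<zeta>)) ^ 2} \<in> sets \<mu>"
proof -
  \<comment> \<open>The supremum runs over uncountably many radii, so measurability is obtained from
    openness of each \<open>V r\<close>. The first condition keeps the argument of \<open>g\<close>
    inside its domain.\<close>
  define V where "V r = {z. norm (of_real r * z) < R \<and> l < norm (g (of_real r * z)) ^ 2}" for r :: real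
  have "open (V r)" for r
  proof -
    have o: "open {z::complex. norm (of_real r * z) < R}" by (intro open_Collect_less continuous_intros)
    have "continuous_on {z. norm (of_real r * z) < R} (\<lambda>z. norm (g (of_real r * z)) ^ 2)"
      by (intro continuous_intros continuous_on_compose2[OF holomorphic_on_imp_continuous_on[OF g(1)]]) auto
    from continuous_open_preimage[OF this o, of "{l<..}"]
    have "open ({z. norm (of_real r * z) < R} \<inter> (\<lambda>z. norm (g (of_real r * z)) ^ 2) -` {l<..})" by simp
    moreover have "{z. norm (of_real r * z) < R} \<inter> (\<lambda>z. norm (g (of_real r * z)) ^ 2) -` {l<..} = V r"
      by (auto simp: V_def)
    ultimately show ?thesis by simp
  qed
  then have "open (\<Union>r\<in>{0..<1}. V r)" by auto
  moreover have "{\<zeta> \<in> sphere 0 1. \<exists>r. 0 \<le> r \<and> r < 1 \<and> l < norm (g (of_real r * \<zeta>)) ^ 2}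
      = sphere 0 1 \<inter> (\<Union>r\<in>{0..<1}. V r)"
    using g(2) by (auto simp: V_def norm_mult)
  ultimately show ?thesis
    unfolding sets_circle_measure sets_restrict_space by auto
qed

text \<open>Integer periods other than the first occur because the intervals of the covering
  argument stick out of \<open>{0..<2*pi}\<close>.\<close>

lemma nn_integral_circle_window:
  fixes f :: "complex \<Rightarrow> ennreal"
  assumes f: "continuous_on (sphere 0 1) f"
  shows "(\<integral>\<^sup>+t. f (cis t) * indicator {2*pi * of_int k..<2*pi * of_int k+2*pi} t \<partial>lborel) = (\<integral>\<^sup>+\<zeta>. f \<zeta> \<partial>\<mu>)"
proof -
  have c: "continuous_on UNIV (\<lambda>t. f (cis t))"
    by (rule continuous_on_compose2[OF f]) (auto intro!: continuous_intros)
  have [measurable]: "(\<lambda>t. f (cis t)) \<in> borel_measurable borel" by (rule borel_measurable_continuous_onI[OF c])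
  have "cis (2 * pi * of_int k + t) = cis t" for t
    by (simp add: cis_mult[symmetric] cis_multiple_2pi)
  then have "(\<integral>\<^sup>+t. f (cis t) * indicator {2*pi * of_int k..<2*pi * of_int k+2*pi} t \<partial>lborel)
      = (\<integral>\<^sup>+t. f (cis t) * indicator {0..<2*pi} t \<partial>lborel)"
    by (subst nn_integral_real_affine[of _ 1 "2*pi * of_int k"]) (auto intro!: nn_integral_cong simp: indicator_def)
  also have "\<dots> = (\<integral>\<^sup>+\<zeta>. f \<zeta> \<partial>\<mu>)"
    by (subst nn_integral_circle_measure[OF borel_measurable_circle_continuous[OF f]]) simp
  finally show ?thesis .
qed

text \<open>The Hardy-Littlewood argument, with \<open>l\<close> a level for the squared modulus. A
  radial value above the level yields a centred arc whose average exceeds it. In the constant 15,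
  the factor 5 is the enlargement in Vitali's covering lemma and the factor 3 counts the periods
  that contain all arcs.\<close>

lemma radial_maximal_inequality:
  fixes g :: "complex \<Rightarrow> complex"
  assumes g: "g holomorphic_on ball 0 R" "R > 1" and l: "l > 0"
  defines "S \<equiv> {\<zeta> \<in> sphere 0 1. \<exists>r. 0 \<le> r \<and> r < 1 \<and> l < norm (g (of_real r * \<zeta>)) ^ 2}"
  shows "emeasure \<mu> S \<le> ennreal (15 / l * (\<integral>\<zeta>. norm (g \<zeta>) ^ 2 \<partial>\<mu>))"
proof -
  have gc: "continuous_on (sphere 0 1) g"
    by (intro holomorphic_on_imp_continuous_on holomorphic_on_subset[OF g(1)]) (use g in auto)
  define v where "v t = norm (g (cis t)) ^ 2" for t
  have vc: "continuous_on A v" for A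
    unfolding v_def by (intro continuous_intros continuous_on_compose2[OF gc]) auto
  have [measurable]: "v \<in> borel_measurable borel" by (intro borel_measurable_continuous_onI vc)
  have S: "S \<in> sets \<mu>" unfolding S_def by (rule sets_circle_radial_sup[OF g(1)]) (use g in simp)
  define K where "K = cis -` S \<inter> {0..<2*pi}"
  have ex: "\<exists>x. 0 < x \<and> x \<le> pi \<and> 2 * l * x < integral {\<theta>-x..\<theta>+x} v" if "\<theta> \<in> K" for \<theta>
  proof (rule ccontr)
    assume "\<not> ?thesis"
    then have le: "integral {\<theta>-x..\<theta>+x} v \<le> 2 * l * x" if "0 < x" "x \<le> pi" for x
      using that by (meson not_le)
    obtain r where r: "0 \<le> r" "r < 1" "l < norm (g (of_real r * cis \<theta>)) ^ 2"
      using \<open>\<theta> \<in> K\<close> by (auto simp: K_def S_def)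
    \<comment> \<open>Rotating \<open>\<theta>\<close> to angle 0 turns arcs centred at
      \<open>\<theta>\<close> into the symmetric arcs of
      \<open>radial_value_le_of_averages\<close>.\<close>
    have "norm ((\<lambda>z. g (z * cis \<theta>)) (of_real r)) ^ 2 \<le> l"
    proof (rule radial_value_le_of_averages[OF _ g(2) r(1,2)])
      show "(\<lambda>z. g (z * cis \<theta>)) holomorphic_on ball 0 R"
        by (rule holomorphic_on_compose_gen[OF _ g(1), of "\<lambda>z. z * cis \<theta>", unfolded comp_def])
           (auto intro!: holomorphic_intros simp: norm_mult)
      fix x :: real assume x: "0 \<le> x" "x \<le> pi"
      have "(v has_integral integral {\<theta>..\<theta>+x} v) (cbox \<theta> (\<theta>+x))"
        by (auto intro!: integrable_integral integrable_continuous_interval vc)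
      from has_integral_affinity[OF this, of 1 \<theta>]
      have 1: "((\<lambda>t. v (t + \<theta>)) has_integral integral {\<theta>..\<theta>+x} v) {0..x}" by simp
      have "(v has_integral integral {\<theta>-x..\<theta>} v) (cbox (\<theta>-x) \<theta>)"
        by (auto intro!: integrable_integral integrable_continuous_interval vc)
      from has_integral_affinity[OF this, of "-1" \<theta>]
      have "((\<lambda>t. v (\<theta> - t)) has_integral integral {\<theta>-x..\<theta>} v) ((\<lambda>y. \<theta> - y) ` {\<theta>-x..\<theta>})" by simp
      moreover have "(\<lambda>y. \<theta> - y) ` {\<theta>-x..\<theta>} = {0..x}" by auto
      ultimately have 2: "((\<lambda>t. v (\<theta> - t)) has_integral integral {\<theta>-x..\<theta>} v) {0..x}" by simp
      have "((\<lambda>t. v (t + \<theta>) + v (\<theta> - t)) has_integral integral {\<theta>..\<theta>+x} v + integral {\<theta>-x..\<theta>} v) {0..x}"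
        by (rule has_integral_add[OF 1 2])
      moreover have "integral {\<theta>-x..\<theta>} v + integral {\<theta>..\<theta>+x} v = integral {\<theta>-x..\<theta>+x} v"
        by (rule Henstock_Kurzweil_Integration.integral_combine) (use x in \<open>auto intro!: integrable_continuous_interval vc\<close>)
      ultimately have "integral {0..x} (\<lambda>t. v (t + \<theta>) + v (\<theta> - t)) = integral {\<theta>-x..\<theta>+x} v"
        by (simp add: integral_unique add.commute)
      moreover have "cis t * cis \<theta> = cis (t + \<theta>)" "cis (- t) * cis \<theta> = cis (\<theta> - t)" for t
        by (simp_all add: cis_mult)
      ultimately have "integral {0..x} (\<lambda>t. norm (g (cis t * cis \<theta>)) ^ 2 + norm (g (cis (- t) * cis \<theta>)) ^ 2)
          = integral {\<theta>-x..\<theta>+x} v" by (simp add: v_def)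
      also have "\<dots> \<le> 2 * l * x" using le[of x] x by (cases "x = 0") auto
      finally show "integral {0..x} (\<lambda>t. norm (g (cis t * cis \<theta>)) ^ 2 + norm (g (cis (- t) * cis \<theta>)) ^ 2) \<le> 2 * l * x" .
    qed
    with r(3) show False by simp
  qed
  then obtain X where X: "\<And>\<theta>. \<theta> \<in> K \<Longrightarrow> 0 < X \<theta> \<and> X \<theta> \<le> pi \<and> 2 * l * X \<theta> < integral {\<theta>-X \<theta>..\<theta>+X \<theta>} v"
    by metis
  \<comment> \<open>Mass is measured on the line rather than on the circle, so that intervals around
    points of \<open>{0..<2*pi}\<close> need not be wrapped.\<close>
  define \<nu> where "\<nu> = density lborel (\<lambda>t. ennreal (v t))"
  have nu: "ennreal (2 * l * X \<theta>) \<le> emeasure \<nu> (cball \<theta> (X \<theta>))" if "\<theta> \<in> K" for \<theta>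
  proof -
    have "emeasure \<nu> {\<theta>-X \<theta>..\<theta>+X \<theta>} = (\<integral>\<^sup>+t. ennreal (v t) * indicator {\<theta>-X \<theta>..\<theta>+X \<theta>} t \<partial>lborel)"
      unfolding \<nu>_def by (rule emeasure_density) measurable
    also have "\<dots> = ennreal (integral {\<theta>-X \<theta>..\<theta>+X \<theta>} v)"
      by (rule nn_integral_has_integral_lebesgue')
         (auto simp: v_def[symmetric] intro!: integrable_integral integrable_continuous_interval vc, simp add: v_def)
    finally show ?thesis using X[OF that] by (auto simp: cball_eq_atLeastAtMost intro!: ennreal_leI)
  qed
  obtain C where C: "countable C" "C \<subseteq> K"
      "pairwise (\<lambda>i j. disjnt (cball i (X i)) (cball j (X j))) C"
      "K \<subseteq> (\<Union>i\<in>C. cball i (5 * X i))"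
  proof (rule Vitali_covering_lemma_cballs[where S = K and K = K and a = "\<lambda>\<theta>. \<theta>" and r = X and B = pi])
    show "K \<subseteq> (\<Union>i\<in>K. cball i (X i))" using X by (force simp: less_imp_le)
  qed (use X in auto)
  have "emeasure \<mu> S = emeasure lborel K"
    unfolding K_def by (rule emeasure_circle_measure(1)[OF S])
  also have "\<dots> \<le> emeasure lborel (\<Union>i\<in>C. cball i (5 * X i))"
    using C(1,4) by (intro emeasure_mono) auto
  also have "\<dots> = (\<integral>\<^sup>+t. indicator (\<Union>i\<in>C. cball i (5 * X i)) t \<partial>lborel)"
    using C(1) by (subst nn_integral_indicator) auto
  also have "\<dots> \<le> (\<integral>\<^sup>+t. (\<integral>\<^sup>+i. indicator (cball i (5 * X i)) t \<partial>count_space C) \<partial>lborel)"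
  proof (rule nn_integral_mono)
    fix t :: real
    show "indicator (\<Union>i\<in>C. cball i (5 * X i)) t \<le> (\<integral>\<^sup>+i. indicator (cball i (5 * X i)) t \<partial>count_space C)"
    proof (cases "t \<in> (\<Union>i\<in>C. cball i (5 * X i))")
      case True
      then obtain j where j: "j \<in> C" "t \<in> cball j (5 * X j)" by auto
      have "(1::ennreal) = (\<integral>\<^sup>+i. indicator {j} i \<partial>count_space C)" using j(1) by simp
      also have "\<dots> \<le> (\<integral>\<^sup>+i. indicator (cball i (5 * X i)) t \<partial>count_space C)"
        using j by (intro nn_integral_mono) (auto simp: indicator_def)
      finally show ?thesis using True by simp
    qed simp
  qed
  also have "\<dots> = (\<integral>\<^sup>+i. (\<integral>\<^sup>+t. indicator (cball i (5 * X i)) t \<partial>lborel) \<partial>count_space C)"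
    by (rule nn_integral_count_space_nn_integral[OF C(1)]) (auto intro!: borel_measurable_indicator)
  also have "\<dots> \<le> (\<integral>\<^sup>+i. ennreal (5 / l) * emeasure \<nu> (cball i (X i)) \<partial>count_space C)"
  proof (rule nn_integral_mono)
    fix i assume "i \<in> space (count_space C)"
    then have i: "i \<in> K" using C(2) by auto
    have "(\<integral>\<^sup>+t. indicator (cball i (5 * X i)) t \<partial>lborel) = ennreal (10 * X i)"
      using X[OF i] by (subst nn_integral_indicator) (auto simp: cball_eq_atLeastAtMost)
    also have "\<dots> = ennreal (5 / l) * ennreal (2 * l * X i)"
      using l X[OF i] by (subst ennreal_mult[symmetric]) auto
    also have "\<dots> \<le> ennreal (5 / l) * emeasure \<nu> (cball i (X i))"
      by (intro mult_left_mono nu i) simp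
    finally show "(\<integral>\<^sup>+t. indicator (cball i (5 * X i)) t \<partial>lborel) \<le> \<dots>" .
  qed
  also have "\<dots> = ennreal (5 / l) * (\<integral>\<^sup>+i. emeasure \<nu> (cball i (X i)) \<partial>count_space C)"
    by (rule nn_integral_cmult) simp
  also have "(\<integral>\<^sup>+i. emeasure \<nu> (cball i (X i)) \<partial>count_space C) = emeasure \<nu> (\<Union>i\<in>C. cball i (X i))"
    by (rule emeasure_UN_countable[symmetric])
       (use C(1,3) in \<open>auto simp: \<nu>_def disjoint_family_on_def pairwise_def disjnt_def\<close>)
  \<comment> \<open>Radii are at most \<open>pi\<close>, so the intervals lie between
    \<open>- pi\<close> and \<open>3 * pi\<close>. Three whole periods are taken, each contributing
    the full circle integral.\<close>
  also have "\<dots> \<le> emeasure \<nu> {2*pi * of_int (-1)..<4*pi}"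
  proof (rule emeasure_mono)
    show "(\<Union>i\<in>C. cball i (X i)) \<subseteq> {2*pi * of_int (-1)..<4*pi}"
    proof (rule UN_least)
      fix i assume "i \<in> C"
      then have "i \<in> K" using C by auto
      then show "cball i (X i) \<subseteq> {2*pi * of_int (-1)..<4*pi}"
        using X[of i] pi_gt_zero by (auto simp: cball_eq_atLeastAtMost K_def)
    qed
  qed (simp add: \<nu>_def)
  also have "\<dots> = (\<integral>\<^sup>+t. ennreal (v t) * indicator {2*pi * of_int (-1)..<4*pi} t \<partial>lborel)"
    unfolding \<nu>_def by (rule emeasure_density) auto
  also have "\<dots> = (\<integral>\<^sup>+t. ennreal (v t) * indicator {2*pi * of_int (-1)..<2*pi * of_int (-1)+2*pi} t
      + ennreal (v t) * indicator {2*pi * of_int 0..<2*pi * of_int 0+2*pi} t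
      + ennreal (v t) * indicator {2*pi * of_int 1..<2*pi * of_int 1+2*pi} t \<partial>lborel)"
    by (rule nn_integral_cong) (auto simp: indicator_def)
  also have "\<dots> = (\<integral>\<^sup>+t. ennreal (v t) * indicator {2*pi * of_int (-1)..<2*pi * of_int (-1)+2*pi} t \<partial>lborel)
      + (\<integral>\<^sup>+t. ennreal (v t) * indicator {2*pi * of_int 0..<2*pi * of_int 0+2*pi} t \<partial>lborel)
      + (\<integral>\<^sup>+t. ennreal (v t) * indicator {2*pi * of_int 1..<2*pi * of_int 1+2*pi} t \<partial>lborel)"
    by (simp add: nn_integral_add del: of_int_minus of_int_0 of_int_1)
  also have "\<dots> = 3 * (\<integral>\<^sup>+\<zeta>. ennreal (norm (g \<zeta>) ^ 2) \<partial>\<mu>)"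
  proof -
    have "continuous_on (sphere 0 1) (\<lambda>\<zeta>. ennreal (norm (g \<zeta>) ^ 2))"
      by (intro continuous_on_ennreal continuous_intros gc)
    note window = nn_integral_circle_window[OF this]
    have "(3::ennreal) = 1 + 1 + 1" by simp
    then show ?thesis
      unfolding v_def window by (simp only: distrib_right mult_1)
  qed
  also have "(\<integral>\<^sup>+\<zeta>. ennreal (norm (g \<zeta>) ^ 2) \<partial>\<mu>) = ennreal (\<integral>\<zeta>. norm (g \<zeta>) ^ 2 \<partial>\<mu>)"
  proof (rule nn_integral_eq_integral)
    obtain B where B: "\<And>\<zeta>. norm \<zeta> = 1 \<Longrightarrow> norm (g \<zeta>) \<le> B"
      using continuous_circle_bounded[OF gc] by blast
    then show "integrable \<mu> (\<lambda>\<zeta>. norm (g \<zeta>) ^ 2)"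
      by (intro integrable_circle_bounded[where B = "B ^ 2"] borel_measurable_circle_continuous
          continuous_intros gc) (auto intro!: power_mono)
  qed simp
  also have "ennreal (5 / l) * (3 * ennreal (\<integral>\<zeta>. norm (g \<zeta>) ^ 2 \<partial>\<mu>))
     = ennreal (15 / l * (\<integral>\<zeta>. norm (g \<zeta>) ^ 2 \<partial>\<mu>))"
  proof -
    have "(\<integral>\<zeta>. norm (g \<zeta>) ^ 2 \<partial>\<mu>) \<ge> 0" by simp
    moreover have "(3::ennreal) = ennreal 3" by simp
    ultimately show ?thesis using l by (simp only: ennreal_mult[symmetric] mult_nonneg_nonneg divide_nonneg_pos) (simp add: mult_ac flip: ennreal_mult)
  qed
  finally show ?thesis by (simp add: mult_left_mono)
qed

text \<open>One fixed sequence makes boundary functions limits of sequences, hence Borel, and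
  provides the dilations. The shift by 2 gives \<open>radii 0 = 1 / 2\<close>, so division by
  \<open>radii n\<close> is harmless.\<close>

definition radii :: "nat \<Rightarrow> real" where "radii n = 1 - 1 / (real n + 2)"

lemma radii: "0 < radii n" "radii n < 1" "radii \<longlonglongrightarrow> 1" "incseq radii"
proof -
  show "0 < radii n" "radii n < 1" by (auto simp: radii_def field_simps)
  show "radii \<longlonglongrightarrow> 1" unfolding radii_def by real_asymp
  show "incseq radii" by (auto simp: incseq_def radii_def intro!: divide_left_mono)
qed

lemma filterlim_radii: "filterlim radii (at_left 1) sequentially"
  unfolding filterlim_at using radii(2,3) by (auto simp: less_le)

lemma has_radial_limit_if_Cauchy:
  assumes "\<And>e. e > 0 \<Longrightarrow> \<exists>d<1. \<forall>r s. d < r \<longrightarrow> r < 1 \<longrightarrow> d < s \<longrightarrow> s < 1 \<longrightarrow>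
    dist (f (complex_of_real r * \<zeta>)) (f (of_real s * \<zeta>)) < e"
  shows "\<exists>l. has_radial_limit f \<zeta> l"
proof -
  let ?x = "\<lambda>n. f (of_real (radii n) * \<zeta>)"
  have ev: "\<exists>N. \<forall>n\<ge>N. d < radii n" if "d < 1" for d
    using order_tendstoD(1)[OF radii(3) that] by (simp add: eventually_sequentially)
  have "Cauchy ?x"
  proof (rule metric_CauchyI)
    fix e :: real assume "e > 0"
    then obtain d where "d < 1" and d: "\<And>r s. d < r \<Longrightarrow> r < 1 \<Longrightarrow> d < s \<Longrightarrow> s < 1 \<Longrightarrow>
      dist (f (complex_of_real r * \<zeta>)) (f (of_real s * \<zeta>)) < e" using assms by metis
    from ev[OF \<open>d < 1\<close>] show "\<exists>M. \<forall>m\<ge>M. \<forall>n\<ge>M. dist (?x m) (?x n) < e"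
      using d radii(2) by blast
  qed
  then obtain l where l: "?x \<longlonglongrightarrow> l" using Cauchy_convergent_iff convergent_def by blast
  have "((\<lambda>r. f (complex_of_real r * \<zeta>)) \<longlongrightarrow> l) (at_left 1)"
  proof (rule tendstoI)
    fix e :: real assume "e > 0"
    then obtain d where "d < 1" and d: "\<And>r s. d < r \<Longrightarrow> r < 1 \<Longrightarrow> d < s \<Longrightarrow> s < 1 \<Longrightarrow>
      dist (f (complex_of_real r * \<zeta>)) (f (of_real s * \<zeta>)) < e / 2" using assms[of "e / 2"] by auto
    obtain N where N: "\<And>n. n \<ge> N \<Longrightarrow> d < radii n" using ev[OF \<open>d < 1\<close>] by blast
    obtain N' where N': "\<And>n. n \<ge> N' \<Longrightarrow> dist (?x n) l < e / 2"
      using metric_LIMSEQ_D[OF l, of "e / 2"] \<open>e > 0\<close> by auto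
    define n where "n = max N N'"
    have "dist (f (complex_of_real r * \<zeta>)) l < e" if "d < r" "r < 1" for r
      using d[OF that N[of n] radii(2)] N'[of n] dist_triangle[of "f (complex_of_real r * \<zeta>)" l "?x n"]
      by (simp add: n_def)
    then show "\<forall>\<^sub>F r in at_left 1. dist (f (complex_of_real r * \<zeta>)) l < e"
      using \<open>d < 1\<close> by (auto simp: eventually_at_left)
  qed
  then show ?thesis by (auto simp: has_radial_limit_def)
qed

lemma summable_norm_taylor:
  assumes f: "f holomorphic_on \<bbbD>" and R: "0 \<le> R" "R < 1"
  shows "summable (\<lambda>k. norm ((deriv ^^ k) f 0 / fact k * of_real R ^ k))"
proof -
  define x where "x = complex_of_real ((1 + R) / 2)"
  have x: "norm x = (1 + R) / 2" unfolding x_def norm_of_real using R by simp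
  have "summable (\<lambda>k. (deriv ^^ k) f 0 / fact k * x ^ k)"
    using sums_summable[OF holomorphic_power_series[OF f, of x]] R x by simp
  then show ?thesis by (rule powser_insidea) (use R x in simp)
qed

text \<open>The Taylor polynomial \<open>P N\<close> is continuous at the boundary, so failure of
  the Cauchy condition along a radius puts \<open>\<zeta>\<close>, for every \<open>N\<close>, into
  the set where the tail \<open>g N\<close> gets large. That set has measure at most a constant
  times \<open>T N\<close>, the tail of the square sum of the coefficients, so the intersection over
  \<open>N\<close> is null.\<close>

theorem fatou_radial_limits:
  assumes f: "f holomorphic_on \<bbbD>" and B: "\<And>z. z \<in> \<bbbD> \<Longrightarrow> norm (f z) \<le> B"
  shows "AE \<zeta> in \<mu>. \<exists>l. has_radial_limit f \<zeta> l"
proof -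
  define a where "a k = (deriv ^^ k) f 0 / fact k" for k
  have sums: "(\<lambda>k. a k * z ^ k) sums f z" if "norm z < 1" for z
    using holomorphic_power_series[OF f, of z] that by (simp add: a_def)
  have abs_summable: "summable (\<lambda>k. norm (a k * of_real R ^ k))" if "0 \<le> R" "R < 1" for R
    unfolding a_def by (rule summable_norm_taylor[OF f that])
  \<comment> \<open>At radius \<open>R < 1\<close> Parseval and the bound \<open>B\<close> apply; in
    a finite partial sum \<open>R\<close> may then tend to 1 along \<open>radii\<close>.\<close>
  have part: "(\<Sum>k<K. norm (a k) ^ 2) \<le> B ^ 2" for K
  proof -
    have le: "(\<Sum>k<K. (norm (a k) * R ^ k) ^ 2) \<le> B ^ 2" if R: "0 \<le> R" "R < 1" for R
    proof -
      have s: "(\<lambda>k. norm (a k * of_real R ^ k) ^ 2) sums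
          ((\<integral>\<zeta>. norm (\<Sum>k. a k * of_real R ^ k * \<zeta> ^ k) ^ 2 \<partial>\<mu>) / (2 * pi))"
        by (rule circle_parseval[OF abs_summable[OF R]])
      have "(\<integral>\<zeta>. norm (\<Sum>k. a k * of_real R ^ k * \<zeta> ^ k) ^ 2 \<partial>\<mu>) \<le> (\<integral>\<zeta>. B ^ 2 \<partial>\<mu>)"
      proof (rule integral_mono_AE')
        show "AE \<zeta> in \<mu>. norm (\<Sum>k. a k * of_real R ^ k * \<zeta> ^ k) ^ 2 \<le> B ^ 2"
          using AE_circle_norm
        proof eventually_elim
          case (elim \<zeta>)
          then have n: "norm (of_real R * \<zeta>) < 1" using R by (simp add: norm_mult)
          have "(\<Sum>k. a k * of_real R ^ k * \<zeta> ^ k) = f (of_real R * \<zeta>)"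
            using sums_unique[OF sums[OF n]] by (simp add: power_mult_distrib mult_ac)
          then show ?case using B[of "of_real R * \<zeta>"] n by (auto intro!: power_mono)
        qed
      qed auto
      then have I: "(\<integral>\<zeta>. norm (\<Sum>k. a k * of_real R ^ k * \<zeta> ^ k) ^ 2 \<partial>\<mu>) / (2 * pi) \<le> B ^ 2"
        by (simp add: measure_circle_space field_simps)
      have "(\<Sum>k<K. norm (a k * of_real R ^ k) ^ 2)
          \<le> (\<integral>\<zeta>. norm (\<Sum>k. a k * of_real R ^ k * \<zeta> ^ k) ^ 2 \<partial>\<mu>) / (2 * pi)"
        unfolding sums_unique[OF s] by (rule sum_le_suminf[OF sums_summable[OF s]]) auto
      also note I
      finally show ?thesis using R by (simp add: norm_mult norm_power)
    qed
    have "(\<lambda>n. \<Sum>k<K. (norm (a k) * radii n ^ k) ^ 2) \<longlonglongrightarrow> (\<Sum>k<K. (norm (a k) * 1 ^ k) ^ 2)"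
      by (intro tendsto_intros radii(3))
    from LIMSEQ_le_const2[OF this] show ?thesis using le radii(1,2) by (auto simp: less_imp_le)
  qed
  have summ: "summable (\<lambda>k. norm (a k) ^ 2)"
    by (rule summableI_nonneg_bounded[OF _ part]) simp
  define T where "T N = (\<Sum>k. norm (a k) ^ 2) - (\<Sum>k<N. norm (a k) ^ 2)" for N
  have T_lim: "T \<longlonglongrightarrow> 0"
    unfolding T_def using tendsto_diff[OF tendsto_const[of "\<Sum>k. norm (a k) ^ 2"] summable_LIMSEQ[OF summ]] by simp
  define P where "P N z = (\<Sum>k<N. a k * z ^ k)" for N z
  define g where "g N z = f z - P N z" for N z
  have g_hol: "g N holomorphic_on \<bbbD>" for N
    unfolding g_def P_def by (intro holomorphic_intros f)
  have g_L2: "(\<integral>\<zeta>. norm (g N (of_real R * \<zeta>)) ^ 2 \<partial>\<mu>) \<le> 2 * pi * T N"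
    if R: "0 \<le> R" "R < 1" for N R
  proof -
    define c where "c k = (if k < N then 0 else a k * of_real R ^ k)" for k
    have cs: "summable (\<lambda>k. norm (c k))"
      by (rule summable_comparison_test'[OF abs_summable[OF R], of 0]) (simp add: c_def)
    have "(\<lambda>k. norm (c k) ^ 2) sums ((\<integral>\<zeta>. norm (\<Sum>k. c k * \<zeta> ^ k) ^ 2 \<partial>\<mu>) / (2 * pi))"
      by (rule circle_parseval[OF cs])
    moreover have "(\<integral>\<zeta>. norm (\<Sum>k. c k * \<zeta> ^ k) ^ 2 \<partial>\<mu>)
        = (\<integral>\<zeta>. norm (g N (of_real R * \<zeta>)) ^ 2 \<partial>\<mu>)"
    proof (rule Bochner_Integration.integral_cong[OF refl])
      fix \<zeta> assume "\<zeta> \<in> space \<mu>"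
      then have n: "norm (of_real R * \<zeta>) < 1" using R by (simp add: norm_mult space_circle_measure)
      have "(\<lambda>k. if k < N then a k * (of_real R * \<zeta>) ^ k else 0) sums P N (of_real R * \<zeta>)"
        unfolding P_def using sums_If_finite_set[of "{..<N}" "\<lambda>k. a k * (of_real R * \<zeta>) ^ k"] by simp
      from sums_diff[OF sums[OF n] this]
      have "(\<lambda>k. a k * (of_real R * \<zeta>) ^ k - (if k < N then a k * (of_real R * \<zeta>) ^ k else 0)) sums g N (of_real R * \<zeta>)"
        by (simp add: g_def)
      moreover have "a k * (of_real R * \<zeta>) ^ k - (if k < N then a k * (of_real R * \<zeta>) ^ k else 0) = c k * \<zeta> ^ k" for k
        by (simp add: c_def power_mult_distrib)
      ultimately show "norm (\<Sum>k. c k * \<zeta> ^ k) ^ 2 = norm (g N (of_real R * \<zeta>)) ^ 2"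
        by (simp add: sums_iff)
    qed
    ultimately have s: "(\<lambda>k. norm (c k) ^ 2) sums ((\<integral>\<zeta>. norm (g N (of_real R * \<zeta>)) ^ 2 \<partial>\<mu>) / (2 * pi))"
      by simp
    have "(\<lambda>k. if k < N then norm (a k) ^ 2 else 0) sums (\<Sum>k<N. norm (a k) ^ 2)"
      using sums_If_finite_set[of "{..<N}" "\<lambda>k. norm (a k) ^ 2"] by simp
    from sums_diff[OF summable_sums[OF summ] this]
    have t: "(\<lambda>k. norm (a k) ^ 2 - (if k < N then norm (a k) ^ 2 else 0)) sums T N" by (simp add: T_def)
    have "(\<integral>\<zeta>. norm (g N (of_real R * \<zeta>)) ^ 2 \<partial>\<mu>) / (2 * pi) \<le> T N"
    proof (rule sums_le[OF _ s t])
      fix k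
      have "norm (a k) ^ 2 * (R ^ k) ^ 2 \<le> norm (a k) ^ 2 * 1"
        using R by (intro mult_left_mono) (auto intro!: power_le_one)
      then show "norm (c k) ^ 2 \<le> norm (a k) ^ 2 - (if k < N then norm (a k) ^ 2 else 0)"
        using R by (simp add: c_def norm_mult norm_power power_mult_distrib)
    qed
    then show ?thesis by (simp add: field_simps)
  qed
  define E where "E l N = {\<zeta> \<in> sphere 0 1. \<exists>r. 0 \<le> r \<and> r < 1 \<and> l < norm (g N (of_real r * \<zeta>)) ^ 2}" for l N
  have E_sets: "E l N \<in> sets \<mu>" for l N
    unfolding E_def by (rule sets_circle_radial_sup[OF g_hol]) simp
  \<comment> \<open>The tail \<open>g N\<close> is only known to be holomorphic inside the disc, so
    the maximal inequality is applied to its dilations. The exceptional sets \<open>S n\<close>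
    increase and cover \<open>E l N\<close>, and the bound is uniform in \<open>n\<close> because
    the mean square of \<open>g N\<close> at every radius is at most
    \<open>2 * pi * T N\<close>.\<close>
  have E_le: "emeasure \<mu> (E l N) \<le> ennreal (15 / l * (2 * pi * T N))" if l: "l > 0" for l N
  proof -
    define G where "G n z = g N (of_real (radii n) * z)" for n z
    have G_hol: "G n holomorphic_on ball 0 (1 / radii n)" for n
      unfolding G_def
      by (rule holomorphic_on_compose_gen[OF _ g_hol, of "\<lambda>z. of_real (radii n) * z", unfolded comp_def])
         (use radii(1)[of n] in \<open>auto intro!: holomorphic_intros simp: norm_mult field_simps\<close>)
    define S where "S n = {\<zeta> \<in> sphere 0 1. \<exists>r. 0 \<le> r \<and> r < 1 \<and> l < norm (G n (of_real r * \<zeta>)) ^ 2}" for n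
    have R1: "1 / radii n > 1" for n using radii(1,2)[of n] by simp
    have S_sets: "S n \<in> sets \<mu>" for n
      unfolding S_def by (rule sets_circle_radial_sup[OF G_hol]) (use R1[of n] in simp)
    have S_le: "emeasure \<mu> (S n) \<le> ennreal (15 / l * (2 * pi * T N))" for n
    proof -
      have "emeasure \<mu> (S n) \<le> ennreal (15 / l * (\<integral>\<zeta>. norm (G n \<zeta>) ^ 2 \<partial>\<mu>))"
        unfolding S_def by (rule radial_maximal_inequality[OF G_hol R1 l])
      also have "\<dots> \<le> ennreal (15 / l * (2 * pi * T N))"
        unfolding G_def using radii(1,2)[of n] l
        by (intro ennreal_leI mult_left_mono g_L2) (auto simp: less_imp_le)
      finally show ?thesis .
    qed
    have inc: "incseq S"
    proof (rule incseq_SucI, rule subsetI)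
      fix n \<zeta> assume "\<zeta> \<in> S n"
      then obtain r where r: "norm \<zeta> = 1" "0 \<le> r" "r < 1" "l < norm (g N (of_real (radii n) * (of_real r * \<zeta>))) ^ 2"
        by (auto simp: S_def G_def)
      let ?r = "r * radii n / radii (Suc n)"
      have "radii n \<le> radii (Suc n)" using radii(4) by (simp add: incseq_Suc_iff)
      then have "r * radii n < 1 * radii (Suc n)"
        using r radii(1)[of n] by (intro mult_less_le_imp_less) auto
      then have "0 \<le> ?r" "?r < 1" using r radii(1)[of n] radii(1)[of "Suc n"] by auto
      moreover have "complex_of_real (radii (Suc n)) * (of_real ?r * \<zeta>) = of_real (radii n) * (of_real r * \<zeta>)"
        using radii(1)[of "Suc n"] by simp
      ultimately show "\<zeta> \<in> S (Suc n)" using r unfolding S_def G_def by (smt (verit) mem_Collect_eq mem_sphere_0)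
    qed
    have "E l N \<subseteq> (\<Union>n. S n)"
    proof
      fix \<zeta> assume "\<zeta> \<in> E l N"
      then obtain r where r: "norm \<zeta> = 1" "0 \<le> r" "r < 1" "l < norm (g N (of_real r * \<zeta>)) ^ 2"
        by (auto simp: E_def)
      obtain n where n: "r < radii n"
        using order_tendstoD(1)[OF radii(3) r(3)] by (auto simp: eventually_sequentially)
      let ?r = "r / radii n"
      have "0 \<le> ?r" "?r < 1" using r n radii(1)[of n] by auto
      moreover have "complex_of_real (radii n) * (of_real ?r * \<zeta>) = of_real r * \<zeta>"
        using radii(1)[of n] by simp
      ultimately have "\<zeta> \<in> S n" using r unfolding S_def G_def by (smt (verit) mem_Collect_eq mem_sphere_0)
      then show "\<zeta> \<in> (\<Union>n. S n)" by blast
    qed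
    then have "emeasure \<mu> (E l N) \<le> emeasure \<mu> (\<Union>n. S n)"
      by (rule emeasure_mono) (use S_sets in auto)
    also have "\<dots> = (SUP n. emeasure \<mu> (S n))"
      using S_sets inc by (intro SUP_emeasure_incseq[symmetric]) auto
    also have "\<dots> \<le> ennreal (15 / l * (2 * pi * T N))" by (intro SUP_least S_le)
    finally show ?thesis .
  qed
  define Q where "Q e \<zeta> \<longleftrightarrow> (\<exists>d<1. \<forall>r s. d < r \<longrightarrow> r < 1 \<longrightarrow> d < s \<longrightarrow> s < 1 \<longrightarrow>
    dist (f (complex_of_real r * \<zeta>)) (f (of_real s * \<zeta>)) < e)" for e \<zeta>
  have "AE \<zeta> in \<mu>. Q e \<zeta>" if e: "e > 0" for e
  proof (rule AE_I)
    \<comment> \<open>Four contributions to the oscillation: the tail at two radii, at most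
      \<open>e / 4\<close> each, and the polynomial at two radii, below \<open>e / 4\<close>
      each.\<close>
    define l where "l = (e / 4) ^ 2"
    have l: "l > 0" using e by (simp add: l_def)
    show "(\<Inter>N. E l N) \<in> sets \<mu>" using E_sets by auto
    have "emeasure \<mu> (\<Inter>N. E l N) \<le> ennreal (15 / l * (2 * pi * T N))" for N
      using E_sets by (intro order_trans[OF emeasure_mono E_le[OF l]]) auto
    moreover have "(\<lambda>N. ennreal (15 / l * (2 * pi * T N))) \<longlonglongrightarrow> ennreal (15 / l * (2 * pi * 0))"
      by (intro tendsto_intros tendsto_ennrealI T_lim)
    ultimately have "emeasure \<mu> (\<Inter>N. E l N) \<le> ennreal (15 / l * (2 * pi * 0))"
      by (intro LIMSEQ_le_const) auto
    then show "emeasure \<mu> (\<Inter>N. E l N) = 0" by simp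
    show "{\<zeta> \<in> space \<mu>. \<not> Q e \<zeta>} \<subseteq> (\<Inter>N. E l N)"
    proof safe
      fix \<zeta> N assume \<zeta>: "\<zeta> \<in> space \<mu>" and nQ: "\<not> Q e \<zeta>"
      show "\<zeta> \<in> E l N"
      proof (rule ccontr)
        assume "\<zeta> \<notin> E l N"
        then have "norm (g N (of_real r * \<zeta>)) ^ 2 \<le> (e / 4) ^ 2" if "0 \<le> r" "r < 1" for r
          using \<zeta> that by (auto simp: E_def l_def space_circle_measure not_less)
        then have small: "norm (g N (of_real r * \<zeta>)) \<le> e / 4" if "0 \<le> r" "r < 1" for r
          using that e by (meson power2_le_imp_le less_imp_le divide_pos_pos zero_less_numeral)
        have "isCont (P N) \<zeta>" unfolding P_def by (intro continuous_intros)
        then obtain d where d: "d > 0" "\<And>z. dist z \<zeta> < d \<Longrightarrow> dist (P N z) (P N \<zeta>) < e / 4"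
          unfolding continuous_at_eps_delta using e by (meson divide_pos_pos zero_less_numeral)
        have "dist (f (complex_of_real r * \<zeta>)) (f (of_real s * \<zeta>)) < e"
          if r: "max 0 (1 - d) < r" "r < 1" and s: "max 0 (1 - d) < s" "s < 1" for r s
        proof -
          have "dist (of_real u * \<zeta>) \<zeta> < d" if "max 0 (1 - d) < u" "u < 1" for u
          proof -
            have "of_real u * \<zeta> - \<zeta> = of_real (u - 1) * \<zeta>" by (simp add: algebra_simps)
            then have "dist (of_real u * \<zeta>) \<zeta> = \<bar>u - 1\<bar>"
              using \<zeta> by (simp only: dist_norm norm_mult norm_of_real) (simp add: space_circle_measure)
            then show ?thesis using that by simp
          qed
          then have "dist (P N (of_real r * \<zeta>)) (P N \<zeta>) < e / 4" "dist (P N (of_real s * \<zeta>)) (P N \<zeta>) < e / 4"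
            using d(2) r s by blast+
          then have PP: "norm (P N (of_real r * \<zeta>) - P N (of_real s * \<zeta>)) < e / 2"
            using dist_triangle2[of "P N (of_real r * \<zeta>)" "P N (of_real s * \<zeta>)" "P N \<zeta>"] by (simp add: dist_norm)
          have "f (of_real r * \<zeta>) - f (of_real s * \<zeta>) = (P N (of_real r * \<zeta>) - P N (of_real s * \<zeta>))
              + (g N (of_real r * \<zeta>) - g N (of_real s * \<zeta>))" by (simp add: g_def)
          then have "dist (f (of_real r * \<zeta>)) (f (of_real s * \<zeta>)) \<le> norm (P N (of_real r * \<zeta>) - P N (of_real s * \<zeta>))
              + (norm (g N (of_real r * \<zeta>)) + norm (g N (of_real s * \<zeta>)))"
            unfolding dist_norm by (metis (no_types, opaque_lifting) add_left_mono norm_triangle_ineq norm_triangle_ineq4 order_trans)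
          also have "\<dots> < e" using PP small[of r] small[of s] r s by simp
          finally show ?thesis .
        qed
        moreover have "max 0 (1 - d) < 1" using d(1) by simp
        ultimately have "Q e \<zeta>" unfolding Q_def by blast
        with nQ show False by simp
      qed
    qed
  qed
  then have "AE \<zeta> in \<mu>. \<forall>n. Q (1 / real (Suc n)) \<zeta>"
    by (subst AE_all_countable) simp
  then show ?thesis
  proof eventually_elim
    case (elim \<zeta>)
    show ?case
    proof (rule has_radial_limit_if_Cauchy)
      fix e :: real assume "e > 0"
      then obtain n where n: "1 / real (Suc n) < e" by (metis nat_approx_posE)
      from elim have "Q (1 / real (Suc n)) \<zeta>" by blast
      then show "\<exists>d<1. \<forall>r s. d < r \<longrightarrow> r < 1 \<longrightarrow> d < s \<longrightarrow> s < 1 \<longrightarrow>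
          dist (f (complex_of_real r * \<zeta>)) (f (of_real s * \<zeta>)) < e"
        unfolding Q_def using n by (meson less_trans)
    qed
  qed
qed

subsection \<open>Summability of orbits\<close>

text \<open>With \<open>\<rho>\<close> the hyperbolic distance, this is \<open>4 sinh\<^sup>2 (\<rho> / 2)\<close>.\<close>

definition disc_step :: "complex \<Rightarrow> complex \<Rightarrow> real" where
  "disc_step z w = 4 * norm (z - w) ^ 2 / ((1 - norm z ^ 2) * (1 - norm w ^ 2))"

lemma norm_power2_less_1: "norm (z::complex) < 1 \<Longrightarrow> norm z ^ 2 < 1"
  by (simp add: power_less_one_iff)

lemma disc_norm_identity:
  "norm (1 - cnj w * z) ^ 2 = norm (z - w) ^ 2 + (1 - norm z ^ 2) * (1 - norm w ^ 2)"
  unfolding cmod_power2 by (simp add: algebra_simps power2_eq_square)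

text \<open>\<open>4 * t ^ 2 / (1 - t ^ 2)\<close> is increasing in the pseudo-hyperbolic distance
  \<open>t\<close>, so contraction and convergence to 0 can be moved between \<open>t\<close> and
  \<open>disc_step\<close>.\<close>

lemma disc_step_eq:
  assumes "norm z < 1" "norm w < 1"
  defines "t \<equiv> norm ((z - w) / (1 - cnj w * z))"
  shows "disc_step z w = 4 * t ^ 2 / (1 - t ^ 2)" "t < 1"
proof -
  let ?A = "norm (z - w) ^ 2" and ?P = "(1 - norm z ^ 2) * (1 - norm w ^ 2)"
  have P: "?P > 0" using assms norm_power2_less_1 by (intro mult_pos_pos) auto
  have t2: "t ^ 2 = ?A / (?A + ?P)"
    unfolding t_def norm_divide power_divide disc_norm_identity ..
  have AP: "?A + ?P > 0" using P by (intro add_nonneg_pos) auto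
  have "1 - t ^ 2 = ?P / (?A + ?P)" unfolding t2 using AP by (simp add: field_simps)
  then show "disc_step z w = 4 * t ^ 2 / (1 - t ^ 2)"
    unfolding t2 disc_step_def using AP P by (simp add: divide_simps)
  have "t ^ 2 < 1" unfolding t2 using AP P by simp
  then show "t < 1" by (simp add: t_def power_less_one_iff)
qed

lemma disc_step_nonneg: "norm z < 1 \<Longrightarrow> norm w < 1 \<Longrightarrow> 0 \<le> disc_step z w"
  unfolding disc_step_def using norm_power2_less_1[of z] norm_power2_less_1[of w] by (intro divide_nonneg_nonneg mult_nonneg_nonneg) auto

text \<open>Moving \<open>w\<close> and \<open>f w\<close> to 0 by Moebius maps reduces to the
  Schwarz lemma, which bounds the pseudo-hyperbolic distance; monotonicity of
  \<open>4 * t ^ 2 / (1 - t ^ 2)\<close> does the rest.\<close>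

lemma Schwarz_Pick_disc:
  assumes f: "f holomorphic_on \<bbbD>" "f ` \<bbbD> \<subseteq> \<bbbD>" and z: "z \<in> \<bbbD>" and w: "w \<in> \<bbbD>"
  shows "disc_step (f z) (f w) \<le> disc_step z w"
proof -
  let ?m = "Moebius_function 0"
  define h where "h = ?m (f w) \<circ> f \<circ> ?m (- w)"
  have nw: "norm (- w) < 1" "norm w < 1" "norm z < 1" using w z by auto
  have fn: "norm (f u) < 1" if "norm u < 1" for u using f(2) that by (auto simp: image_subset_iff)
  have mw: "norm (?m (- w) u) < 1" if "norm u < 1" for u
    using Moebius_function_norm_lt_1[OF nw(1) that] .
  have "(?m (f w) \<circ> f) holomorphic_on \<bbbD>"
    by (rule holomorphic_on_compose_gen[OF f(1) Moebius_function_holomorphic f(2)]) (rule fn[OF nw(2)])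
  then have "h holomorphic_on \<bbbD>" unfolding h_def
    by (rule holomorphic_on_compose_gen[OF Moebius_function_holomorphic[OF nw(1)]]) (use mw in auto)
  moreover have "h 0 = 0" by (simp add: h_def Moebius_function_def)
  moreover have "norm (h u) < 1" if "norm u < 1" for u
    unfolding h_def comp_def using that mw fn nw by (intro Moebius_function_norm_lt_1) auto
  ultimately have h: "norm (h u) \<le> norm u" if "norm u < 1" for u
    using Schwarz_Lemma[of h u] that by blast
  define u where "u = ?m w z"
  have nu: "norm u < 1" unfolding u_def using nw by (intro Moebius_function_norm_lt_1) auto
  have "?m (- w) u = z" unfolding u_def using nw by (intro Moebius_function_compose) auto
  then have hu: "h u = ?m (f w) (f z)" by (simp add: h_def)
  define s where "s = norm (h u)" define t where "t = norm u"
  have st: "0 \<le> s" "s \<le> t" "t < 1" using h[OF nu] nu by (auto simp: s_def t_def)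
  have "disc_step (f z) (f w) = 4 * s ^ 2 / (1 - s ^ 2)"
    using disc_step_eq(1)[OF fn[OF nw(3)] fn[OF nw(2)]] unfolding s_def hu Moebius_function_simple .
  also have "\<dots> \<le> 4 * t ^ 2 / (1 - t ^ 2)"
    using st by (intro frac_le) (auto intro!: power_mono simp: power_less_one_iff)
  also have "\<dots> = disc_step z w"
    using disc_step_eq(1)[OF nw(3) nw(2)] unfolding t_def u_def Moebius_function_simple by simp
  finally show ?thesis .
qed

text \<open>For \<open>norm p = 1\<close> this is the Cayley transform of the disc onto the upper
  half-plane that sends \<open>p\<close> to infinity and 0 to \<open>\<i>\<close>.\<close>

definition to_half_plane :: "complex \<Rightarrow> complex \<Rightarrow> complex" where
  "to_half_plane p w = \<i> * (p + w) / (p - w)"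

lemma Im_to_half_plane:
  assumes "norm p = 1"
  shows "Im (to_half_plane p w) = (1 - norm w ^ 2) / norm (p - w) ^ 2"
proof -
  have "Re p ^ 2 + Im p ^ 2 = 1" using assms by (metis cmod_power2 one_power2)
  then have "Re ((p + w) * cnj (p - w)) = 1 - norm w ^ 2"
    unfolding cmod_power2 by (simp add: algebra_simps power2_eq_square)
  then have "Re ((p + w) / (p - w)) = (1 - norm w ^ 2) / norm (p - w) ^ 2"
    by (simp add: Re_divide_numeral complex_div_cnj[of "p + w" "p - w"] Re_divide_of_real flip: of_real_power)
  moreover have "to_half_plane p w = \<i> * ((p + w) / (p - w))" by (simp add: to_half_plane_def)
  ultimately show ?thesis by (simp only: Im_i_times)
qed

text \<open>In half-plane coordinates \<open>disc_step\<close> becomes a squared Euclidean distance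
  divided by the two heights, so steps of an orbit can be measured in units of its height.\<close>

lemma to_half_plane_diff:
  assumes "norm p = 1" "norm z < 1" "norm w < 1"
  shows "norm (to_half_plane p z - to_half_plane p w) ^ 2
       = disc_step z w * (Im (to_half_plane p z) * Im (to_half_plane p w))"
proof -
  have ne: "p - z \<noteq> 0" "p - w \<noteq> 0" using assms by auto
  have "to_half_plane p z - to_half_plane p w = 2 * \<i> * p * (z - w) / ((p - z) * (p - w))"
    unfolding to_half_plane_def using ne by (simp add: divide_simps) (simp add: algebra_simps)
  then have "norm (to_half_plane p z - to_half_plane p w) ^ 2
      = 4 * norm (z - w) ^ 2 / (norm (p - z) ^ 2 * norm (p - w) ^ 2)"
    using assms by (simp add: norm_divide norm_mult power_divide power_mult_distrib)
  moreover have "1 - norm z ^ 2 \<noteq> 0" "1 - norm w ^ 2 \<noteq> 0"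
    using norm_power2_less_1 assms by (metis diff_gt_0_iff_gt less_irrefl)+
  ultimately show ?thesis
    unfolding disc_step_def Im_to_half_plane[OF assms(1)] by simp
qed

lemma Im_to_half_plane_pos:
  assumes "norm p = 1" "norm w < 1"
  shows "Im (to_half_plane p w) > 0"
  using assms norm_power2_less_1[of w] unfolding Im_to_half_plane[OF assms(1)]
  by (intro divide_pos_pos) auto

text \<open>Translates the terms of the series to be summed along an orbit. The identity
  \<open>to_half_plane p w + \<i> = 2 * \<i> * p / (p - w)\<close> is behind it.\<close>

lemma one_minus_norm_to_half_plane:
  assumes "norm p = 1" "norm w < 1"
  shows "1 - norm w ^ 2 = 4 * Im (to_half_plane p w) / norm (to_half_plane p w + \<i>) ^ 2"
proof -
  have ne: "p - w \<noteq> 0" using assms by auto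
  then have "to_half_plane p w + \<i> = 2 * \<i> * p / (p - w)"
    unfolding to_half_plane_def by (simp add: divide_simps) (simp add: algebra_simps)
  then have "norm (to_half_plane p w + \<i>) ^ 2 = 4 / norm (p - w) ^ 2"
    using assms by (simp add: norm_divide norm_mult power_divide)
  then show ?thesis using ne by (simp add: Im_to_half_plane assms)
qed

text \<open>Adding \<open>\<i> * e\<close> moves the values into the open half-plane, where an
  inverse Cayley transform turns \<open>F\<close> into a self-map of the disc; then \<open>e\<close>
  tends to 0. The displacement map to which this is applied has only a nonstrict sign.\<close>

lemma Schwarz_Pick_half_plane:
  assumes F: "F holomorphic_on \<bbbD>" and Im: "\<And>z. z \<in> \<bbbD> \<Longrightarrow> Im (F z) \<ge> 0"
    and z: "z \<in> \<bbbD>" and w: "w \<in> \<bbbD>"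
  shows "norm (F z - F w) ^ 2 \<le> disc_step z w * (Im (F z) * Im (F w))"
proof -
  have pos: "norm (F z - F w) ^ 2 \<le> disc_step z w * ((Im (F z) + e) * (Im (F w) + e))" if e: "e > 0" for e
  proof -
    \<comment> \<open>Inverse of \<open>to_half_plane 1\<close>, applied to the shifted map.\<close>
    define f where "f u = (F u + \<i> * e - \<i>) / (F u + \<i> * e + \<i>)" for u
    have ne: "F u + \<i> * e + \<i> \<noteq> 0" if "u \<in> \<bbbD>" for u
    proof -
      have "Im (F u + \<i> * e + \<i>) > 0" using Im[OF that] e by simp
      then show ?thesis by (metis less_irrefl zero_complex.simps(2))
    qed
    have f_hp: "to_half_plane 1 (f u) = F u + \<i> * e" if "u \<in> \<bbbD>" for u
      using ne[OF that] unfolding to_half_plane_def f_def by (simp add: divide_simps)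
    have f_in: "norm (f u) < 1" if "u \<in> \<bbbD>" for u
    proof -
      have "norm (F u + \<i> * e - \<i>) ^ 2 < norm (F u + \<i> * e + \<i>) ^ 2"
        unfolding cmod_power2 using Im[OF that] e by (simp add: power2_eq_square algebra_simps)
      then have "norm (F u + \<i> * e - \<i>) < norm (F u + \<i> * e + \<i>)" by (rule power2_less_imp_less) simp
      then show ?thesis using ne[OF that] by (simp add: f_def norm_divide divide_simps)
    qed
    have "f holomorphic_on \<bbbD>" unfolding f_def
      by (intro holomorphic_intros F) (use ne in auto)
    then have SP: "disc_step (f z) (f w) \<le> disc_step z w"
      by (rule Schwarz_Pick_disc) (use f_in z w in auto)
    have "norm (F z - F w) ^ 2 = disc_step (f z) (f w) * ((Im (F z) + e) * (Im (F w) + e))"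
      using to_half_plane_diff[of 1 "f z" "f w"] f_in z w by (simp add: f_hp)
    also have "\<dots> \<le> disc_step z w * ((Im (F z) + e) * (Im (F w) + e))"
      using SP Im[OF z] Im[OF w] e by (intro mult_right_mono) auto
    finally show ?thesis .
  qed
  have "((\<lambda>e. disc_step z w * ((Im (F z) + e) * (Im (F w) + e))) \<longlongrightarrow>
      disc_step z w * ((Im (F z) + 0) * (Im (F w) + 0))) (at_right 0)"
    by (intro tendsto_intros)
  then have "norm (F z - F w) ^ 2 \<le> disc_step z w * ((Im (F z) + 0) * (Im (F w) + 0))"
    by (rule tendsto_lowerbound) (use pos in \<open>auto simp: eventually_at_right_less eventually_at_filter\<close>)
  then show ?thesis by simp
qed

section \<open>Julia's lemma and orbits tending to a boundary point\<close>

lemma funpow_disc: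
  assumes "analytic_self_map \<phi>" "z \<in> \<bbbD>"
  shows "(\<phi> ^^ n) z \<in> \<bbbD>"
  using assms by (induction n) (auto simp: analytic_self_map_def image_subset_iff)

text \<open>Schwarz-Pick for \<open>z\<close> and a point \<open>w n\<close> tending radially to
  \<open>p\<close>, with the vanishing factors \<open>1 - norm (w n) ^ 2\<close> and
  \<open>1 - norm (\<phi> (w n)) ^ 2\<close> combined into a quotient; in the limit the angular
  derivative bounds it. Geometrically, horodiscs at \<open>p\<close> go into horodiscs. Both heights
  are positive, so the inequality also yields \<open>d > 0\<close>.\<close>

lemma Julia_half_plane:
  assumes \<phi>: "analytic_self_map \<phi>" and p: "norm p = 1"
    and d: "has_angular_derivative \<phi> p p (complex_of_real d)" and z: "z \<in> \<bbbD>"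
  shows "Im (to_half_plane p z) \<le> d * Im (to_half_plane p (\<phi> z))"
proof -
  define r where "r n = 1 - 1 / (real n + 2)" for n
  define w where "w n = complex_of_real (r n) * p" for n
  have r: "0 < r n" "r n < 1" for n by (auto simp: r_def field_simps)
  have r_lim: "r \<longlonglongrightarrow> 1" unfolding r_def by real_asymp
  have nw: "norm (w n) = r n" for n using r[of n] p by (simp add: w_def norm_mult)
  have wp: "w n - p = - of_real (1 - r n) * p" for n by (simp add: w_def algebra_simps)
  have nwp: "norm (w n - p) = 1 - r n" for n unfolding wp using r[of n] p by (simp add: norm_mult del: of_real_diff)
  have w_disc: "w n \<in> \<bbbD>" for n using nw r[of n] by simp
  have w_ne: "w n \<noteq> p" for n using nwp[of n] r[of n] by auto
  \<comment> \<open>On the radius \<open>norm (w n - p) = 1 - norm (w n)\<close>, so the aperture 2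
    contains it.\<close>
  have w_stolz: "w n \<in> stolz_region p 2" for n
    using w_disc nwp[of n] nw[of n] r[of n] by (auto simp: stolz_region_def)
  have w_lim: "w \<longlonglongrightarrow> p"
    using tendsto_mult[OF tendsto_of_real[OF r_lim] tendsto_const[of p]] by (simp add: w_def[abs_def])
  have filt: "filterlim w (at p within stolz_region p 2) sequentially"
    unfolding filterlim_at using w_lim w_stolz w_ne by auto
  have \<phi>w: "(\<lambda>n. \<phi> (w n)) \<longlonglongrightarrow> p" and
    quot: "(\<lambda>n. (\<phi> (w n) - p) / (w n - p)) \<longlonglongrightarrow> complex_of_real d"
    using d filt unfolding has_angular_derivative_def has_nontangential_limit_def
    by (auto intro: filterlim_compose[rotated] elim!: allE[of _ "2::real"])
  have \<phi>D: "\<phi> u \<in> \<bbbD>" if "u \<in> \<bbbD>" for u using \<phi> that by (auto simp: analytic_self_map_def image_subset_iff)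
  define q where "q n = (\<phi> (w n) - p) / (w n - p)" for n
  have main: "norm (\<phi> z - \<phi> (w n)) ^ 2 / (1 - norm (\<phi> z) ^ 2)
       \<le> norm (z - w n) ^ 2 / (1 - norm z ^ 2) * (2 / (1 + r n) * Re (q n))" for n
  proof -
    have pos: "1 - norm (\<phi> z) ^ 2 > 0" "1 - norm z ^ 2 > 0" "1 - norm (\<phi> (w n)) ^ 2 > 0" "1 - r n ^ 2 > 0"
      using norm_power2_less_1[of z] norm_power2_less_1[of "\<phi> z"] norm_power2_less_1[of "\<phi> (w n)"]
        z \<phi>D[OF z] \<phi>D[OF w_disc] r[of n] by (auto simp: power_less_one_iff)
    have "disc_step (\<phi> z) (\<phi> (w n)) \<le> disc_step z (w n)"
      using \<phi> by (intro Schwarz_Pick_disc z w_disc) (auto simp: analytic_self_map_def)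
    then have "norm (\<phi> z - \<phi> (w n)) ^ 2 / ((1 - norm (\<phi> z) ^ 2) * (1 - norm (\<phi> (w n)) ^ 2))
        \<le> norm (z - w n) ^ 2 / ((1 - norm z ^ 2) * (1 - r n ^ 2))"
      unfolding disc_step_def nw by simp
    then have "norm (\<phi> z - \<phi> (w n)) ^ 2 / (1 - norm (\<phi> z) ^ 2)
        \<le> norm (z - w n) ^ 2 / (1 - norm z ^ 2) * ((1 - norm (\<phi> (w n)) ^ 2) / (1 - r n ^ 2))"
    proof -
      let ?X = "norm (\<phi> z - \<phi> (w n)) ^ 2" and ?A = "1 - norm (\<phi> z) ^ 2" and ?C = "1 - norm (\<phi> (w n)) ^ 2"
      assume le: "?X / (?A * ?C) \<le> norm (z - w n) ^ 2 / ((1 - norm z ^ 2) * (1 - r n ^ 2))"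
      have "?X / ?A = ?X / (?A * ?C) * ?C" using pos by simp
      also have "\<dots> \<le> norm (z - w n) ^ 2 / ((1 - norm z ^ 2) * (1 - r n ^ 2)) * ?C"
        using le pos by (intro mult_right_mono) auto
      finally show ?thesis by simp
    qed
    also have "\<dots> \<le> norm (z - w n) ^ 2 / (1 - norm z ^ 2) * (2 / (1 + r n) * Re (q n))"
    proof (rule mult_left_mono)
      have "1 - norm (\<phi> (w n)) ^ 2 = (1 + norm (\<phi> (w n))) * (1 - norm (\<phi> (w n)))"
        by (simp add: power2_eq_square algebra_simps)
      also have "\<dots> \<le> 2 * (1 - norm (\<phi> (w n)))"
        using \<phi>D[OF w_disc[of n]] by (intro mult_right_mono) auto
      also have "\<dots> \<le> 2 * (1 - Re (cnj p * \<phi> (w n)))"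
        using complex_Re_le_cmod[of "cnj p * \<phi> (w n)"] p by (simp add: norm_mult)
      \<comment> \<open>From \<open>w n - p = - (1 - r n) * p\<close> and
        \<open>cnj p * p = 1\<close>: the defect of \<open>\<phi> (w n)\<close> in the direction
        \<open>p\<close> is the step length times the real part of the difference quotient.\<close>
      also have "1 - Re (cnj p * \<phi> (w n)) = (1 - r n) * Re (q n)"
      proof -
        have "q n * (- of_real (1 - r n) * p) = \<phi> (w n) - p"
          unfolding wp[symmetric] using w_ne[of n] by (simp add: q_def)
        then have "cnj p * (q n * (- of_real (1 - r n) * p)) = cnj p * (\<phi> (w n) - p)" by simp
        moreover have one: "cnj p * p = 1" using complex_norm_square[of p] p by (simp add: mult.commute)
        moreover have "cnj p * (q n * (- of_real (1 - r n) * p)) = - of_real (1 - r n) * q n * (cnj p * p)"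
          by (simp only: mult_ac)
        ultimately have "- of_real (1 - r n) * q n = cnj p * \<phi> (w n) - 1"
          by (simp only: right_diff_distrib one mult_1_right)
        then have "Re (- of_real (1 - r n) * q n) = Re (cnj p * \<phi> (w n) - 1)" by simp
        then show ?thesis by (simp add: algebra_simps)
      qed
      finally have "1 - norm (\<phi> (w n)) ^ 2 \<le> 2 * ((1 - r n) * Re (q n))" by simp
      then have "(1 - norm (\<phi> (w n)) ^ 2) / (1 - r n ^ 2) \<le> 2 * ((1 - r n) * Re (q n)) / (1 - r n ^ 2)"
        using pos by (intro divide_right_mono) auto
      also have "\<dots> = 2 / (1 + r n) * Re (q n)"
      proof -
        have "1 - r n ^ 2 = (1 - r n) * (1 + r n)" by (simp add: power2_eq_square algebra_simps)
        then show ?thesis using r[of n] by simp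
      qed
      finally show "(1 - norm (\<phi> (w n)) ^ 2) / (1 - r n ^ 2) \<le> 2 / (1 + r n) * Re (q n)" .
    qed (use pos in simp)
    finally show ?thesis .
  qed
  have "norm (\<phi> z - p) ^ 2 / (1 - norm (\<phi> z) ^ 2) \<le> norm (z - p) ^ 2 / (1 - norm z ^ 2) * (2 / (1 + 1) * Re (of_real d))"
  proof (rule tendsto_le[OF sequentially_bot])
    show "(\<lambda>n. norm (\<phi> z - \<phi> (w n)) ^ 2 / (1 - norm (\<phi> z) ^ 2)) \<longlonglongrightarrow> norm (\<phi> z - p) ^ 2 / (1 - norm (\<phi> z) ^ 2)"
      using norm_power2_less_1[of "\<phi> z"] \<phi>D[OF z] by (intro tendsto_intros \<phi>w) auto
    show "(\<lambda>n. norm (z - w n) ^ 2 / (1 - norm z ^ 2) * (2 / (1 + r n) * Re (q n)))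
       \<longlonglongrightarrow> norm (z - p) ^ 2 / (1 - norm z ^ 2) * (2 / (1 + 1) * Re (of_real d))"
      using norm_power2_less_1[of z] z quot unfolding q_def by (intro tendsto_intros w_lim r_lim) auto
  qed (use main in simp)
  then have *: "norm (p - \<phi> z) ^ 2 / (1 - norm (\<phi> z) ^ 2) \<le> d * (norm (p - z) ^ 2 / (1 - norm z ^ 2))"
    by (simp add: norm_minus_commute mult_ac)
  have "1 / Im (to_half_plane p (\<phi> z)) \<le> d * (1 / Im (to_half_plane p z))"
    using * by (simp add: Im_to_half_plane p)
  moreover have "Im (to_half_plane p (\<phi> z)) > 0" "Im (to_half_plane p z) > 0"
    using Im_to_half_plane_pos p z \<phi>D[OF z] by auto
  ultimately show ?thesis by (simp add: field_simps)
qed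

text \<open>By Julia's lemma the heights grow at least by the factor \<open>1 / d\<close> per step.
  Dropping the real part in the denominator bounds each term by 4 divided by the height, and a
  geometric series remains.\<close>

lemma hyperbolic_summable:
  assumes \<phi>: "analytic_self_map \<phi>" and p: "norm p = 1"
    and d: "has_angular_derivative \<phi> p p (complex_of_real d)" "d < 1" and z: "z \<in> \<bbbD>"
  shows "summable (\<lambda>n. 1 - norm ((\<phi> ^^ n) z) ^ 2)"
proof -
  define y where "y n = Im (to_half_plane p ((\<phi> ^^ n) z))" for n
  have D: "norm ((\<phi> ^^ n) z) < 1" for n using funpow_disc[OF \<phi> z, of n] by simp
  have y: "y n > 0" for n unfolding y_def by (intro Im_to_half_plane_pos p D)
  have y_step: "y n \<le> d * y (Suc n)" for n
    using Julia_half_plane[OF \<phi> p d(1) funpow_disc[OF \<phi> z, of n]] by (simp add: y_def)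
  have "summable (\<lambda>n. 4 / y n)"
  proof (rule summable_ratio_test[OF d(2)])
    show "norm (4 / y (Suc n)) \<le> d * norm (4 / y n)" for n
      using y_step[of n] y[of n] y[of "Suc n"] by (simp add: field_simps)
  qed
  then show ?thesis
  proof (rule summable_comparison_test'[where N = 0])
    fix n
    have "y n \<le> norm (to_half_plane p ((\<phi> ^^ n) z) + \<i>)"
      using abs_Im_le_cmod[of "to_half_plane p ((\<phi> ^^ n) z) + \<i>"] by (simp add: y_def)
    then have "y n ^ 2 \<le> norm (to_half_plane p ((\<phi> ^^ n) z) + \<i>) ^ 2"
      using y[of n] by (intro power_mono) auto
    then have "4 * y n / norm (to_half_plane p ((\<phi> ^^ n) z) + \<i>) ^ 2 \<le> 4 * y n / y n ^ 2"
      using y[of n] by (intro divide_left_mono) (auto intro!: mult_pos_pos dest: order_less_le_trans[rotated])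
    also have "\<dots> = 4 / y n" by (simp add: power2_eq_square)
    finally have "1 - norm ((\<phi> ^^ n) z) ^ 2 \<le> 4 / y n"
      unfolding one_minus_norm_to_half_plane[OF p D] y_def .
    then show "norm (1 - norm ((\<phi> ^^ n) z) ^ 2) \<le> 4 / y n"
      using norm_power2_less_1[OF D[of n]] by simp
  qed
qed

text \<open>
  Quantitative rigidity in the Schwarz-Pick lemma: a self-map \<open>w + \<psi>(w)\<close> of the half-plane with
  \<open>Im \<psi> \<ge> 0\<close> that nearly preserves the distance of \<open>i\<close> and \<open>i + q\<close>, where \<open>q = \<psi>(i)\<close>, is nearly affine
  there. Here \<open>B = \<psi>(i + q) - \<psi>(i)\<close>.
\<close>

lemma near_isometry_bound:
  fixes q B :: complex and s s1 a \<delta> \<delta>' :: real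
  assumes s: "s \<ge> 0" and a: "a = 1 + s" and s1: "s1 \<ge> 0"
    and q: "norm q ^ 2 = \<delta> * a" and B: "norm B ^ 2 \<le> \<delta> * s * s1"
    and qB: "norm (q + B) ^ 2 = \<delta>' * (1 + s) * (a + s1)"
  shows "norm (B - of_real s * q) ^ 2 \<le> s * (\<delta> - \<delta>') * a * (a + s1)"
proof -
  \<comment> \<open>The cross term occurs in both squares and is eliminated through
    \<open>qB\<close>. What remains is increasing in \<open>norm B ^ 2\<close>, so the bound on
    \<open>B\<close> can be inserted.\<close>
  define X where "X = Re (q * cnj B)"
  have 1: "norm (B - of_real s * q) ^ 2 = norm B ^ 2 - 2 * s * X + s ^ 2 * norm q ^ 2"
    unfolding X_def cmod_power2 by (simp add: power2_eq_square algebra_simps)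
  have 2: "norm (q + B) ^ 2 = norm q ^ 2 + 2 * X + norm B ^ 2"
    unfolding X_def cmod_power2 by (simp add: power2_eq_square algebra_simps)
  have X: "2 * X = \<delta>' * (1 + s) * (a + s1) - \<delta> * a - norm B ^ 2"
    using 2 q qB by simp
  have "norm (B - of_real s * q) ^ 2
      = (1 + s) * norm B ^ 2 + s * \<delta> * a * (1 + s) - s * (\<delta>' * (1 + s) * (a + s1))"
    unfolding 1 q using X by algebra
  also have "\<dots> \<le> (1 + s) * (\<delta> * s * s1) + s * \<delta> * a * (1 + s) - s * (\<delta>' * (1 + s) * (a + s1))"
    using B s by (simp add: mult_left_mono)
  also have "\<dots> = s * (\<delta> - \<delta>') * a * (a + s1)"
    unfolding a by algebra
  finally show ?thesis .
qed

text \<open>In the application \<open>\<delta>\<close> and \<open>\<epsilon>\<close> are the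
  one-step and two-step values of \<open>disc_step\<close> along the orbit, and \<open>SP\<close> is
  Schwarz-Pick for the displacement map, whose value at the \<open>n\<close>-th point is
  \<open>z (Suc n) - z n\<close>.\<close>

lemma type_I_orbit_summable:
  fixes z :: "nat \<Rightarrow> complex"
  defines "y \<equiv> \<lambda>n. Im (z n)"
  assumes y_pos: "\<And>n. y n > 0" and y_mono: "\<And>n. y n \<le> y (Suc n)"
    and step: "\<And>n. norm (z (Suc n) - z n) ^ 2 = \<delta> n * (y n * y (Suc n))"
    and step2: "\<And>n. norm (z (Suc (Suc n)) - z n) ^ 2 = \<epsilon> n * (y n * y (Suc (Suc n)))"
    and SP: "\<And>n. norm ((z (Suc (Suc n)) - z (Suc n)) - (z (Suc n) - z n)) ^ 2
        \<le> \<delta> n * ((y (Suc n) - y n) * (y (Suc (Suc n)) - y (Suc n)))"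
    and dec: "decseq \<delta>" and lim: "\<delta> \<longlonglongrightarrow> d" and d: "d > 0" and lim2: "\<epsilon> \<longlonglongrightarrow> e"
  shows "summable (\<lambda>n. 4 * y n / norm (z n + \<i>) ^ 2)"
proof -
  define q where "q n = (z (Suc n) - z n) / y n" for n
  define a where "a n = y (Suc n) / y n" for n
  have a1: "a n \<ge> 1" for n using y_pos[of n] y_mono[of n] by (simp add: a_def)
  have Im_q: "Im (q n) = a n - 1" for n
    using y_pos[of n] by (simp add: q_def a_def y_def diff_divide_distrib)
  have q_sq: "norm (q n) ^ 2 = \<delta> n * a n" for n
    using y_pos[of n] step[of n] by (simp add: q_def a_def norm_divide power_divide power2_eq_square)
  have q_next: "of_real (a n) * q (Suc n) = (z (Suc (Suc n)) - z (Suc n)) / y n" for n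
    using y_pos[of n] y_pos[of "Suc n"] by (simp add: q_def a_def)
  have a_next: "a n * a (Suc n) = y (Suc (Suc n)) / y n" for n
    using y_pos[of n] y_pos[of "Suc n"] by (simp add: a_def)
  have slow: "norm (q (Suc n) - q n) ^ 2 \<le> (a n - 1) * a (Suc n) * (\<delta> n - \<delta> (Suc n))" for n
  proof -
    \<comment> \<open>Rescaling by \<open>y n\<close> moves \<open>z n\<close> to height 1. With
      \<open>s = a n - 1\<close> and \<open>s1 = a n * a (Suc n) - a n\<close> this is the situation
      of \<open>near_isometry_bound\<close>; \<open>B\<close> is the rescaled increment of the
      displacement.\<close>
    define B where "B = of_real (a n) * q (Suc n) - q n"
    have *: "norm (B - of_real (a n - 1) * q n) ^ 2
        \<le> (a n - 1) * (\<delta> n - \<delta> (Suc n)) * a n * (a n + (a n * a (Suc n) - a n))"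
    proof (rule near_isometry_bound)
      show "norm B ^ 2 \<le> \<delta> n * (a n - 1) * (a n * a (Suc n) - a n)"
      proof -
        have "B = ((z (Suc (Suc n)) - z (Suc n)) - (z (Suc n) - z n)) / y n"
          unfolding B_def q_next unfolding q_def by (simp only: diff_divide_distrib)
        then have "norm B ^ 2 = norm ((z (Suc (Suc n)) - z (Suc n)) - (z (Suc n) - z n)) ^ 2 / y n ^ 2"
          by (simp add: norm_divide power_divide)
        also have "\<dots> \<le> \<delta> n * ((y (Suc n) - y n) * (y (Suc (Suc n)) - y (Suc n))) / y n ^ 2"
          by (intro divide_right_mono SP) simp
        also have "\<dots> = \<delta> n * (a n - 1) * (a n * a (Suc n) - a n)"
          unfolding a_next using y_pos[of n] by (simp add: a_def field_simps power2_eq_square)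
        finally show ?thesis .
      qed
      have "q n + B = (z (Suc (Suc n)) - z (Suc n)) / y n" unfolding B_def q_next by simp
      then have "norm (q n + B) ^ 2 = \<delta> (Suc n) * (y (Suc n) * y (Suc (Suc n))) / y n ^ 2"
        using step[of "Suc n"] by (simp add: norm_divide power_divide)
      also have "\<dots> = \<delta> (Suc n) * (1 + (a n - 1)) * (a n + (a n * a (Suc n) - a n))"
        unfolding a_next using y_pos[of n] by (simp add: a_def power2_eq_square)
      finally show "norm (q n + B) ^ 2 = \<delta> (Suc n) * (1 + (a n - 1)) * (a n + (a n * a (Suc n) - a n))" .
      show "0 \<le> a n * a (Suc n) - a n" using a1[of n] a1[of "Suc n"] by simp
    qed (use a1 q_sq in auto)
    \<comment> \<open>The deviation from an affine map is exactly the change of the normalised step,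
      so it is controlled by \<open>\<delta> n - \<delta> (Suc n)\<close>.\<close>
    have "B - of_real (a n - 1) * q n = of_real (a n) * (q (Suc n) - q n)"
      by (simp add: B_def algebra_simps)
    then have "a n ^ 2 * norm (q (Suc n) - q n) ^ 2 \<le> a n ^ 2 * ((a n - 1) * a (Suc n) * (\<delta> n - \<delta> (Suc n)))"
    proof -
      assume eq: "B - of_real (a n - 1) * q n = of_real (a n) * (q (Suc n) - q n)"
      have "a n ^ 2 * norm (q (Suc n) - q n) ^ 2 = norm (B - of_real (a n - 1) * q n) ^ 2"
        unfolding eq by (simp add: norm_mult power_mult_distrib)
      also note *
      also have "(a n - 1) * (\<delta> n - \<delta> (Suc n)) * a n * (a n + (a n * a (Suc n) - a n))
          = a n ^ 2 * ((a n - 1) * a (Suc n) * (\<delta> n - \<delta> (Suc n)))"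
        by (simp add: power2_eq_square)
      finally show ?thesis .
    qed
    then show ?thesis using a1[of n] by (subst (asm) mult_le_cancel_left_pos) auto
  qed
  have d_le: "\<delta> n \<le> \<delta> 0" for n using dec by (simp add: decseq_def)
  have d_ge: "\<delta> n \<ge> d" for n using dec lim by (rule decseq_ge)
  \<comment> \<open>Since \<open>a n - 1\<close> is the imaginary part of \<open>q n\<close>, the
    number \<open>t = norm (q n)\<close> satisfies \<open>t ^ 2 \<le> \<delta> 0 * (1 + t)\<close>,
    which forces \<open>t \<le> \<delta> 0 + 1\<close>.\<close>
  have a_bd: "a n \<le> \<delta> 0 + 2" for n
  proof -
    have "norm (q n) ^ 2 \<le> \<delta> 0 * a n" unfolding q_sq using d_le[of n] a1[of n] by (intro mult_right_mono) auto
    moreover have Im: "a n - 1 \<le> norm (q n)" using abs_Im_le_cmod[of "q n"] Im_q[of n] by simp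
    ultimately have 1: "norm (q n) ^ 2 \<le> \<delta> 0 * (1 + norm (q n))"
      using d_ge[of 0] d by (smt (verit) mult_left_mono)
    have "norm (q n) \<le> \<delta> 0 + 1"
    proof (rule ccontr)
      assume "\<not> norm (q n) \<le> \<delta> 0 + 1"
      then have n: "norm (q n) > \<delta> 0 + 1" by simp
      then have "(\<delta> 0 + 1) * norm (q n) < norm (q n) * norm (q n)"
        using d_ge[of 0] d by (intro mult_strict_right_mono) auto
      then show False using 1 n d_ge[of 0] d by (simp add: power2_eq_square algebra_simps)
    qed
    then show ?thesis using Im by simp
  qed
  define A where "A = \<delta> 0 + 2"
  have A: "a n \<le> A" "A > 0" for n using a_bd[of n] d_ge[of 0] d by (auto simp: A_def)
  have abd: "Bseq a" by (rule BseqI'[of _ A]) (use a1 A in \<open>auto simp: abs_of_nonneg order_trans[OF zero_le_one]\<close>)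
  have "(\<lambda>n. A * A * (\<delta> n - \<delta> (Suc n))) \<longlonglongrightarrow> A * A * (d - d)"
    by (intro tendsto_intros lim LIMSEQ_Suc[OF lim])
  then have "(\<lambda>n. A * A * (\<delta> n - \<delta> (Suc n))) \<longlonglongrightarrow> 0" by simp
  then have "(\<lambda>n. norm (q (Suc n) - q n) ^ 2) \<longlonglongrightarrow> 0"
  proof (rule Lim_null_comparison[rotated])
    have "norm (q (Suc n) - q n) ^ 2 \<le> A * A * (\<delta> n - \<delta> (Suc n))" for n
    proof -
      have "(a n - 1) * a (Suc n) \<le> A * A" using a1[of n] a1[of "Suc n"] A(1)[of n] A(1)[of "Suc n"] A(2)
        by (intro mult_mono) auto
      moreover have "\<delta> n - \<delta> (Suc n) \<ge> 0" using dec by (simp add: decseq_Suc_iff)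
      ultimately show ?thesis using slow[of n] by (meson mult_right_mono order_trans)
    qed
    then show "\<forall>\<^sub>F n in sequentially. norm (norm (q (Suc n) - q n) ^ 2) \<le> A * A * (\<delta> n - \<delta> (Suc n))" by simp
  qed
  then have q_diff: "(\<lambda>n. norm (q (Suc n) - q n)) \<longlonglongrightarrow> 0"
    using tendsto_real_sqrt[of "\<lambda>n. norm (q (Suc n) - q n) ^ 2" 0] by simp
  have a_diff: "(\<lambda>n. a (Suc n) - a n) \<longlonglongrightarrow> 0"
    using tendsto_Im[OF tendsto_norm_zero_cancel[OF q_diff]] by (simp add: Im_q)
  have q_bd: "norm (q n) \<le> \<delta> 0 * A + 1" for n
  proof -
    have "norm (q n) ^ 2 \<le> \<delta> 0 * A" unfolding q_sq
      using d_le[of n] a1[of n] d_ge[of n] d A(1)[of n] d_ge[of 0] by (intro mult_mono) auto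
    moreover have "2 * norm (q n) \<le> norm (q n) ^ 2 + 1"
      using zero_le_power2[of "norm (q n) - 1"] by (simp add: power2_eq_square algebra_simps)
    ultimately show ?thesis using norm_ge_zero[of "q n"] by linarith
  qed
  have eps_eq: "norm (q n + of_real (a n) * q (Suc n)) ^ 2 = \<epsilon> n * (a n * a (Suc n))" for n
  proof -
    have "q n + of_real (a n) * q (Suc n) = (z (Suc (Suc n)) - z n) / y n"
      unfolding q_next by (simp add: q_def diff_divide_distrib)
    then show ?thesis unfolding a_next using step2[of n] y_pos[of n]
      by (simp add: norm_divide power_divide power2_eq_square)
  qed
  \<comment> \<open>\<open>u\<close> is the exact two-step displacement in units of
    \<open>y n\<close>; \<open>v\<close> pretends that \<open>q\<close> does not change in between,
    and so depends on \<open>\<delta> n\<close> and \<open>a n\<close> alone.\<close>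
  define u where "u n = norm (q n + of_real (a n) * q (Suc n))" for n
  define v where "v n = norm (q n + of_real (a n) * q n)" for n
  have v_sq: "v n ^ 2 = \<delta> n * a n * (1 + a n) ^ 2" for n
  proof -
    have "v n = norm (of_real (1 + a n) * q n)" unfolding v_def by (simp add: algebra_simps)
    then have "v n = (1 + a n) * norm (q n)" using a1[of n] by (simp only: norm_mult norm_of_real)
    then show ?thesis by (simp add: power_mult_distrib q_sq)
  qed
  have uv: "(\<lambda>n. u n - v n) \<longlonglongrightarrow> 0"
  proof (rule Lim_null_comparison)
    have "norm (u n - v n) \<le> A * norm (q (Suc n) - q n)" for n
    proof -
      have "norm (u n - v n) \<le> norm (of_real (a n) * (q (Suc n) - q n))"
        unfolding u_def v_def real_norm_def using norm_triangle_ineq3[of "q n + of_real (a n) * q (Suc n)" "q n + of_real (a n) * q n"]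
        by (simp add: algebra_simps)
      also have "\<dots> \<le> A * norm (q (Suc n) - q n)"
        using a1[of n] A(1)[of n] by (simp add: norm_mult mult_right_mono)
      finally show ?thesis .
    qed
    then show "\<forall>\<^sub>F n in sequentially. norm (u n - v n) \<le> A * norm (q (Suc n) - q n)" by simp
    show "(\<lambda>n. A * norm (q (Suc n) - q n)) \<longlonglongrightarrow> 0" using tendsto_mult_right_zero[OF q_diff] by simp
  qed
  have uv_bd: "Bseq (\<lambda>n. u n + v n)"
  proof (rule BseqI')
    fix n
    let ?Q = "\<delta> 0 * A + 1"
    have n: "norm (of_real (a n) * q m) \<le> A * ?Q" for m
      using a1[of n] A(1)[of n] q_bd[of m] A(2) by (auto simp: norm_mult intro!: mult_mono)
    have "u n \<le> ?Q + A * ?Q" "v n \<le> ?Q + A * ?Q"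
      unfolding u_def v_def using n q_bd by (meson add_mono norm_triangle_ineq order_trans)+
    then show "norm (u n + v n) \<le> 2 * (?Q + A * ?Q)" by (simp add: u_def v_def)
  qed
  have Bz: "(\<lambda>n. f n * g n) \<longlonglongrightarrow> 0" if "f \<longlonglongrightarrow> 0" "Bseq g" for f g :: "nat \<Rightarrow> real"
    using that by (simp add: tendsto_Zfun_iff bounded_bilinear.Zfun_prod_Bfun[OF bounded_bilinear_mult])
  have "(\<lambda>n. (u n - v n) * (u n + v n)) \<longlonglongrightarrow> 0"
    by (rule Bz[OF uv uv_bd])
  moreover have "(u n - v n) * (u n + v n) = \<epsilon> n * (a n * a (Suc n)) - \<delta> n * a n * (1 + a n) ^ 2" for n
    using eps_eq[of n] v_sq[of n] by (simp add: u_def power2_eq_square algebra_simps)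
  ultimately have 1: "(\<lambda>n. \<epsilon> n * (a n * a (Suc n)) - \<delta> n * a n * (1 + a n) ^ 2) \<longlonglongrightarrow> 0" by simp
  have t_lim: "(\<lambda>n. a n + 1 / a n) \<longlonglongrightarrow> e / d - 2"
  proof -
    define w where "w n = 1 / a n" for n
    have wb: "Bseq w" unfolding w_def
      by (rule BseqI'[of _ 1]) (use a1 in \<open>auto simp: divide_le_eq abs_of_nonneg order_trans[OF zero_le_one]\<close>)
    have a0: "a n \<noteq> 0" for n using a1[of n] by auto
    have "(\<lambda>n. (\<epsilon> n * (a n * a (Suc n)) - \<delta> n * a n * (1 + a n) ^ 2) * w n * w n) \<longlonglongrightarrow> 0"
      by (intro Bz wb 1)
    moreover have "(\<epsilon> n * (a n * a (Suc n)) - \<delta> n * a n * (1 + a n) ^ 2) * w n * w n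
        = \<epsilon> n * (1 + (a (Suc n) - a n) * w n) - \<delta> n * (a n + w n + 2)" for n
      using a0[of n] by (simp add: w_def field_simps power2_eq_square)
    ultimately have 2: "(\<lambda>n. \<epsilon> n * (1 + (a (Suc n) - a n) * w n) - \<delta> n * (a n + w n + 2)) \<longlonglongrightarrow> 0" by simp
    have 3: "(\<lambda>n. \<epsilon> n * (1 + (a (Suc n) - a n) * w n)) \<longlonglongrightarrow> e * (1 + 0)"
      by (intro tendsto_intros lim2 Bz wb a_diff)
    have "(\<lambda>n. \<delta> n * (a n + w n + 2)) \<longlonglongrightarrow> e"
      using tendsto_diff[OF 3 2] by simp
    then have "(\<lambda>n. \<delta> n * (a n + w n + 2) / \<delta> n - 2) \<longlonglongrightarrow> e / d - 2"
      using d by (intro tendsto_intros lim) auto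
    moreover have "\<delta> n * (a n + w n + 2) / \<delta> n - 2 = a n + 1 / a n" for n
      using d_ge[of n] d by (simp add: w_def)
    ultimately show ?thesis by simp
  qed
  \<comment> \<open>As \<open>a n \<ge> 1\<close>, it is the larger root of
    \<open>t + 1 / t = s\<close> for its own \<open>s\<close>; \<open>c\<close> is the root formula
    at the limit of \<open>s\<close>. \<open>sqrt\<close> is continuous on the whole real line,
    negative arguments included, so the limit passes without a look at the discriminant.\<close>
  define c where "c = ((e / d - 2) + sqrt ((e / d - 2) ^ 2 - 4)) / 2"
  have "(\<lambda>n. ((a n + 1 / a n) + sqrt ((a n + 1 / a n) ^ 2 - 4)) / 2) \<longlonglongrightarrow> c"
    unfolding c_def by (intro tendsto_intros t_lim) auto
  moreover have "((a n + 1 / a n) + sqrt ((a n + 1 / a n) ^ 2 - 4)) / 2 = a n" for n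
  proof -
    have "(a n + 1 / a n) ^ 2 - 4 = (a n - 1 / a n) ^ 2"
      using a1[of n] by (simp add: power2_eq_square field_simps)
    moreover have "1 / a n \<le> a n" using a1[of n] by (meson divide_le_eq_1_pos order_trans zero_less_one less_le_trans)
    ultimately show ?thesis by simp
  qed
  ultimately have a_lim: "a \<longlonglongrightarrow> c" by simp
  have c1: "c \<ge> 1" using LIMSEQ_le_const[OF a_lim] a1 by auto
  show ?thesis
  proof (cases "c > 1")
    case True
    then obtain b where b: "1 < b" "b < c" using dense by blast
    have "eventually (\<lambda>n. a n > b) sequentially" using a_lim b by (simp add: order_tendsto_iff)
    then obtain N where N: "\<And>n. n \<ge> N \<Longrightarrow> a n > b" unfolding eventually_sequentially by auto
    have "summable (\<lambda>n. 4 / y n)"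
    proof (rule summable_ratio_test[of "1 / b" N])
      fix n assume "n \<ge> N"
      then have "b * y n \<le> y (Suc n)" using N[of n] y_pos[of n] by (simp add: a_def field_simps)
      then show "norm (4 / y (Suc n)) \<le> 1 / b * norm (4 / y n)"
        using y_pos[of n] y_pos[of "Suc n"] b by (simp add: field_simps)
    qed (use b in auto)
    then show ?thesis
    proof (rule summable_comparison_test'[where N = 0])
      fix n
      have "y n \<le> norm (z n + \<i>)" using abs_Im_le_cmod[of "z n + \<i>"] by (simp add: y_def)
      then have "y n ^ 2 \<le> norm (z n + \<i>) ^ 2" using y_pos[of n] by (intro power_mono) auto
      moreover have "0 < y n ^ 2" using y_pos[of n] by simp
      ultimately have "4 * y n / norm (z n + \<i>) ^ 2 \<le> 4 * y n / y n ^ 2"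
        using y_pos[of n] by (intro divide_left_mono mult_pos_pos) auto
      then show "norm (4 * y n / norm (z n + \<i>) ^ 2) \<le> 4 / y n"
        using y_pos[of n] by (simp add: power2_eq_square)
    qed
  next
    case False
    then have c: "c = 1" using c1 by simp
    define x where "x n = Re (z n)" for n
    \<comment> \<open>Now \<open>a\<close> tends to 1 and
      \<open>Re (q n) ^ 2 = \<delta> n * a n - (a n - 1) ^ 2\<close> tends to \<open>d\<close>, so
      \<open>\<bar>Re (q n)\<bar>\<close> is eventually above half of \<open>sqrt d\<close>. A
      change of sign would need a jump of more than \<open>2 * b\<close>, which slow variation
      excludes.\<close>
    define b where "b = sqrt d / 2"
    have b: "b > 0" using d by (simp add: b_def)
    have "(\<lambda>n. \<delta> n * a n - (a n - 1) ^ 2) \<longlonglongrightarrow> d * c - (c - 1) ^ 2"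
      by (intro tendsto_intros lim a_lim)
    moreover have "\<delta> n * a n - (a n - 1) ^ 2 = Re (q n) ^ 2" for n
      using q_sq[of n] unfolding cmod_power2 Im_q by simp
    ultimately have "(\<lambda>n. Re (q n) ^ 2) \<longlonglongrightarrow> d" by (simp add: c)
    from tendsto_real_sqrt[OF this] have "(\<lambda>n. \<bar>Re (q n)\<bar>) \<longlonglongrightarrow> sqrt d" by simp
    then have "eventually (\<lambda>n. \<bar>Re (q n)\<bar> > b) sequentially"
      using d by (intro order_tendstoD(1)) (auto simp: b_def)
    moreover have "eventually (\<lambda>n. norm (q (Suc n) - q n) < b) sequentially"
      using q_diff b by (intro order_tendstoD(2)) auto
    ultimately have "eventually (\<lambda>n. \<bar>Re (q n)\<bar> > b \<and> norm (q (Suc n) - q n) < b) sequentially"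
      by eventually_elim auto
    then obtain N where N: "\<And>n. n \<ge> N \<Longrightarrow> \<bar>Re (q n)\<bar> > b" "\<And>n. n \<ge> N \<Longrightarrow> norm (q (Suc n) - q n) < b"
      unfolding eventually_sequentially by auto
    define \<sigma> where "\<sigma> = sgn (Re (q N))"
    have \<sigma>: "\<sigma> = 1 \<or> \<sigma> = -1" using N(1)[of N] b by (auto simp: \<sigma>_def sgn_if)
    have Req: "\<sigma> * Re (q n) > b" if "n \<ge> N" for n
      using that
    proof (induction n rule: dec_induct)
      case base
      then show ?case using N(1)[of N] by (simp add: \<sigma>_def sgn_mult_abs abs_sgn mult.commute)
    next
      case (step n)
      have "\<bar>Re (q (Suc n)) - Re (q n)\<bar> < b"
        using N(2)[OF step(1)] abs_Re_le_cmod[of "q (Suc n) - q n"] by simp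
      moreover have "\<bar>Re (q (Suc n))\<bar> > b" using N(1)[of "Suc n"] step by simp
      ultimately show ?case using step \<sigma> by auto
    qed
    have x_step: "\<sigma> * x (Suc n) \<ge> \<sigma> * x n + b * y n" if "n \<ge> N" for n
    proof -
      have "Re (q n) = (x (Suc n) - x n) / y n" by (simp add: q_def x_def)
      then have "\<sigma> * ((x (Suc n) - x n) / y n) > b" using Req[OF that] by simp
      then show ?thesis using y_pos[of n] by (simp add: field_simps)
    qed
    have y0: "y n \<ge> y 0" for n using y_mono by (induction n) (auto intro: order_trans)
    \<comment> \<open>Heights never drop below \<open>y 0\<close>, so each step of
      \<open>\<sigma> * x\<close> gains at least \<open>b * y 0\<close> and the sequence becomes
      positive.\<close>
    have x_lin: "\<sigma> * x (N + k) \<ge> \<sigma> * x N + k * (b * y 0)" for k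
    proof (induction k)
      case (Suc k)
      have "b * y 0 \<le> b * y (N + k)" using b y0 by (intro mult_left_mono) auto
      then show ?case using x_step[of "N + k"] Suc by (simp add: algebra_simps)
    qed simp
    obtain k :: nat where k: "- (\<sigma> * x N) / (b * y 0) < k" using reals_Archimedean2 by blast
    have "\<sigma> * x N + k * (b * y 0) > 0" using k b y_pos[of 0] by (simp add: field_simps)
    then have X0: "\<sigma> * x (N + k) > 0" using x_lin[of k] by linarith
    define X where "X j = \<sigma> * x (N + k + j)" for j
    have X_step: "X (Suc j) \<ge> X j + b * y (N + k + j)" for j using x_step[of "N + k + j"] by (simp add: X_def)
    have X_inc: "X j \<le> X (Suc j)" for j using X_step[of j] mult_pos_pos[OF b y_pos[of "N + k + j"]] by linarith
    have X_pos: "X j > 0" for j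
      by (induction j) (use X0 X_inc in \<open>auto simp: X_def intro: less_le_trans\<close>)
    have dec_X: "decseq (\<lambda>j. 1 / X j)"
      unfolding decseq_Suc_iff using X_inc X_pos by (auto intro!: divide_left_mono)
    have "Bseq (\<lambda>j. 1 / X j)" using dec_X by (rule decseq_bounded[where B = 0]) (use X_pos in \<open>auto intro: less_imp_le\<close>)
    then have "convergent (\<lambda>j. 1 / X j)" using dec_X by (intro Bseq_monoseq_convergent) (auto simp: monoseq_iff)
    then obtain m where "(\<lambda>j. 1 / X j) \<longlonglongrightarrow> m" by (auto simp: convergent_def)
    from summable_mult[OF telescope_summable'[OF this], of "4 * A / b"]
    have "summable (\<lambda>j. 4 * A / b * (1 / X j - 1 / X (Suc j)))" .
    \<comment> \<open>Each term is compared with the step leading to it: its height is at most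
      \<open>A\<close> times the previous one, hence at most
      \<open>A * (X (Suc j) - X j) / b\<close>. Replacing one factor \<open>X (Suc j)\<close> of the
      denominator by the smaller \<open>X j\<close> makes the bound telescope.\<close>
    then have "summable (\<lambda>j. 4 * y (N + k + Suc j) / norm (z (N + k + Suc j) + \<i>) ^ 2)"
    proof (rule summable_comparison_test'[where N = 0])
      fix j
      let ?n = "N + k + j"
      have "X (Suc j) ^ 2 = x (Suc ?n) ^ 2" using \<sigma> by (auto simp: X_def)
      moreover have "x (Suc ?n) ^ 2 \<le> norm (z (Suc ?n) + \<i>) ^ 2" unfolding cmod_power2 by (simp add: x_def)
      ultimately have le: "X (Suc j) ^ 2 \<le> norm (z (Suc ?n) + \<i>) ^ 2" by simp
      have "4 * y (Suc ?n) / norm (z (Suc ?n) + \<i>) ^ 2 \<le> 4 * y (Suc ?n) / X (Suc j) ^ 2"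
        using y_pos[of "Suc ?n"] X_pos[of "Suc j"] le
        by (intro divide_left_mono mult_pos_pos) (auto intro: less_le_trans[OF _ le])
      also have "\<dots> = 4 * (a ?n * y ?n) / X (Suc j) ^ 2" using y_pos[of ?n] by (simp add: a_def)
      also have "4 * (a ?n * y ?n) / X (Suc j) ^ 2 \<le> 4 * (A * y ?n) / X (Suc j) ^ 2"
        using A(1)[of ?n] y_pos[of ?n] by (intro divide_right_mono mult_left_mono mult_right_mono) auto
      also have "\<dots> \<le> 4 * (A * ((X (Suc j) - X j) / b)) / X (Suc j) ^ 2"
        using X_step[of j] b A(2) by (intro divide_right_mono mult_left_mono) (auto simp: field_simps)
      also have "\<dots> \<le> 4 * (A * ((X (Suc j) - X j) / b)) / (X j * X (Suc j))"
        using X_pos[of j] X_pos[of "Suc j"] X_inc[of j] A(2) b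
        by (intro divide_left_mono) (auto simp: power2_eq_square)
      also have "\<dots> = 4 * A / b * (1 / X j - 1 / X (Suc j))"
        using X_pos[of j] X_pos[of "Suc j"] b by (simp add: field_simps)
      finally show "norm (4 * y (N + k + Suc j) / norm (z (N + k + Suc j) + \<i>) ^ 2)
          \<le> 4 * A / b * (1 / X j - 1 / X (Suc j))"
        using y_pos[of "Suc ?n"] by simp
    qed
    then have "summable (\<lambda>j. 4 * y (j + Suc (N + k)) / norm (z (j + Suc (N + k)) + \<i>) ^ 2)"
      by (simp add: add_ac)
    then show ?thesis by (subst (asm) summable_iff_shift)
  qed
qed

lemma type_I_summable:
  assumes \<phi>: "analytic_self_map \<phi>" and p: "norm p = 1"
    and ang: "has_angular_derivative \<phi> p p 1" and z0: "z0 \<in> \<bbbD>"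
    and s: "s > 0" "(\<lambda>n. hyperbolic_distance ((\<phi> ^^ n) z0) ((\<phi> ^^ Suc n) z0)) \<longlonglongrightarrow> s"
  shows "summable (\<lambda>n. 1 - norm ((\<phi> ^^ n) z0) ^ 2)"
proof -
  define w where "w n = (\<phi> ^^ n) z0" for n
  have w: "w n \<in> \<bbbD>" "norm (w n) < 1" for n using funpow_disc[OF \<phi> z0, of n] by (auto simp: w_def)
  have wS: "w (Suc n) = \<phi> (w n)" for n by (simp add: w_def)
  have hol: "\<phi> holomorphic_on \<bbbD>" and im: "\<phi> ` \<bbbD> \<subseteq> \<bbbD>" using \<phi> by (auto simp: analytic_self_map_def)
  define z where "z n = to_half_plane p (w n)" for n
  define \<delta> where "\<delta> n = disc_step (w n) (w (Suc n))" for n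
  define \<epsilon> where "\<epsilon> n = disc_step (w n) (w (Suc (Suc n)))" for n
  have dec: "decseq \<delta>" "decseq \<epsilon>"
    unfolding decseq_Suc_iff \<delta>_def \<epsilon>_def
    using Schwarz_Pick_disc[OF hol im w(1) w(1)] unfolding wS[symmetric] by simp_all
  have nonneg: "\<delta> n \<ge> 0" "\<epsilon> n \<ge> 0" for n
    unfolding \<delta>_def \<epsilon>_def by (intro disc_step_nonneg w)+
  have conv: "\<exists>L. f \<longlonglongrightarrow> L" if "decseq f" "\<And>n. f n \<ge> 0" for f :: "nat \<Rightarrow> real"
    using decseq_convergent[of f 0] that by metis
  obtain d where d: "\<delta> \<longlonglongrightarrow> d" using conv dec nonneg by blast
  obtain e where e: "\<epsilon> \<longlonglongrightarrow> e" using conv dec nonneg by blast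
  have "d \<ge> 0" using LIMSEQ_le_const[OF d] nonneg by blast
  \<comment> \<open>This is where type I enters. Solving
    \<open>\<delta> = 4 * t ^ 2 / (1 - t ^ 2)\<close> for \<open>t\<close> shows that a vanishing
    \<open>d\<close> would make the hyperbolic steps tend to 0 instead of \<open>s\<close>.\<close>
  moreover have "d \<noteq> 0"
  proof
    assume d0: "d = 0"
    define t where "t n = norm ((w n - w (Suc n)) / (1 - cnj (w (Suc n)) * w n))" for n
    have t: "t n = sqrt (\<delta> n / (4 + \<delta> n))" for n
    proof -
      have \<delta>: "\<delta> n = 4 * t n ^ 2 / (1 - t n ^ 2)" and t1: "t n < 1"
        unfolding \<delta>_def t_def by (intro disc_step_eq w)+
      have t0: "t n \<ge> 0" by (simp add: t_def)
      then have "t n ^ 2 < 1" using t1 by (simp add: power_less_one_iff)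
      then have "\<delta> n / (4 + \<delta> n) = t n ^ 2" unfolding \<delta> by (simp add: field_simps)
      then show ?thesis using t0 by simp
    qed
    have "(\<lambda>n. sqrt (\<delta> n / (4 + \<delta> n))) \<longlonglongrightarrow> sqrt (d / (4 + d))"
      by (intro tendsto_intros d) (simp add: d0)
    then have "t \<longlonglongrightarrow> 0" by (simp add: t[abs_def] d0)
    then have "(\<lambda>n. ln ((1 + t n) / (1 - t n))) \<longlonglongrightarrow> ln ((1 + 0) / (1 - 0))"
      by (intro tendsto_intros) auto
    then have "(\<lambda>n. hyperbolic_distance ((\<phi> ^^ n) z0) ((\<phi> ^^ Suc n) z0)) \<longlonglongrightarrow> 0"
      by (simp add: hyperbolic_distance_def t_def w_def)
    then show False using s LIMSEQ_unique by blast
  qed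
  ultimately have d_pos: "d > 0" by simp
  \<comment> \<open>Displacement in half-plane coordinates, viewed as a function on the disc.
    Julia's lemma with angular derivative 1 makes its imaginary part nonnegative, so Schwarz-Pick
    applies to it as well as to \<open>\<phi>\<close>.\<close>
  define \<Psi> where "\<Psi> u = to_half_plane p (\<phi> u) - to_half_plane p u" for u
  have p_ne: "p - u \<noteq> 0" if "norm u < 1" for u using p that by auto
  have H: "to_half_plane p holomorphic_on \<bbbD>"
    unfolding to_half_plane_def by (intro holomorphic_intros) (use p_ne in auto)
  have \<Psi>: "\<Psi> holomorphic_on \<bbbD>"
    unfolding \<Psi>_def by (intro holomorphic_on_diff H holomorphic_on_compose_gen[OF hol H im, unfolded comp_def])
  have Im_\<Psi>: "Im (\<Psi> u) \<ge> 0" if "u \<in> \<bbbD>" for u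
    using Julia_half_plane[OF \<phi> p, of 1 u] ang that by (simp add: \<Psi>_def)
  have \<Psi>_w: "\<Psi> (w n) = z (Suc n) - z n" for n by (simp add: \<Psi>_def z_def wS)
  have "summable (\<lambda>n. 4 * Im (z n) / norm (z n + \<i>) ^ 2)"
  proof (rule type_I_orbit_summable[OF _ _ _ _ _ dec(1) d d_pos e])
    show "0 < Im (z n)" for n unfolding z_def by (intro Im_to_half_plane_pos p w)
    show "Im (z n) \<le> Im (z (Suc n))" for n using Im_\<Psi>[OF w(1)[of n]] by (simp add: \<Psi>_w)
    show "norm (z (Suc n) - z n) ^ 2 = \<delta> n * (Im (z n) * Im (z (Suc n)))" for n
      using to_half_plane_diff[OF p w(2)[of n] w(2)[of "Suc n"]] by (simp add: z_def \<delta>_def norm_minus_commute)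
    show "norm (z (Suc (Suc n)) - z n) ^ 2 = \<epsilon> n * (Im (z n) * Im (z (Suc (Suc n))))" for n
      using to_half_plane_diff[OF p w(2)[of n] w(2)[of "Suc (Suc n)"]] by (simp add: z_def \<epsilon>_def norm_minus_commute)
    show "norm ((z (Suc (Suc n)) - z (Suc n)) - (z (Suc n) - z n)) ^ 2
        \<le> \<delta> n * ((Im (z (Suc n)) - Im (z n)) * (Im (z (Suc (Suc n))) - Im (z (Suc n))))" for n
      using Schwarz_Pick_half_plane[OF \<Psi> Im_\<Psi> w(1)[of n] w(1)[of "Suc n"]]
      unfolding \<Psi>_w \<delta>_def minus_complex.simps by (subst norm_minus_commute)
  qed
  then show ?thesis
    using one_minus_norm_to_half_plane[OF p w(2)] by (simp add: z_def w_def)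
qed

subsection \<open>Boundary functions\<close>

text \<open>A Borel version of the radial boundary function; measurability of \<open>radial_boundary\<close> itself
  is not at hand because of its unspecified values.\<close>

definition boundary :: "(complex \<Rightarrow> complex) \<Rightarrow> complex \<Rightarrow> complex" where
  "boundary f \<zeta> = lim (\<lambda>n. f (of_real (radii n) * \<zeta>))"

definition bounded_holomorphic :: "(complex \<Rightarrow> complex) \<Rightarrow> real \<Rightarrow> bool" where
  "bounded_holomorphic f B \<longleftrightarrow> f holomorphic_on \<bbbD> \<and> (\<forall>z\<in>\<bbbD>. norm (f z) \<le> B)"

lemma radii_mult_disc: "norm \<zeta> \<le> 1 \<Longrightarrow> of_real (radii n) * \<zeta> \<in> \<bbbD>"
  using radii(1,2)[of n] by (auto simp: norm_mult intro: le_less_trans[OF mult_left_le])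

lemma continuous_on_radii:
  assumes "continuous_on \<bbbD> f"
  shows "continuous_on (sphere 0 1) (\<lambda>\<zeta>. f (of_real (radii n) * \<zeta>))"
  by (rule continuous_on_compose2[OF assms]) (auto intro!: continuous_intros radii_mult_disc simp del: mem_ball)

lemma measurable_radii:
  assumes "f holomorphic_on \<bbbD>"
  shows "(\<lambda>\<zeta>. f (of_real (radii n) * \<zeta>)) \<in> borel_measurable \<mu>"
  by (intro borel_measurable_circle_continuous continuous_on_radii holomorphic_on_imp_continuous_on assms)

lemma boundary_measurable:
  assumes "f holomorphic_on \<bbbD>"
  shows "boundary f \<in> borel_measurable \<mu>"
  unfolding boundary_def[abs_def] by (intro borel_measurable_lim_metric measurable_radii assms)

lemma has_radial_limit_radii:
  assumes "has_radial_limit f \<zeta> l"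
  shows "(\<lambda>n. f (of_real (radii n) * \<zeta>)) \<longlonglongrightarrow> l" "boundary f \<zeta> = l"
proof -
  show *: "(\<lambda>n. f (of_real (radii n) * \<zeta>)) \<longlonglongrightarrow> l"
    using filterlim_compose[OF assms[unfolded has_radial_limit_def] filterlim_radii] .
  show "boundary f \<zeta> = l" unfolding boundary_def by (rule limI[OF *])
qed

text \<open>Off a null set the Borel function \<open>boundary f\<close> is the genuine radial limit,
  so it can replace \<open>radial_boundary f\<close> in every almost-everywhere statement.\<close>

lemma AE_boundary:
  assumes "bounded_holomorphic f B"
  shows "AE \<zeta> in \<mu>. norm \<zeta> = 1 \<and> has_radial_limit f \<zeta> (boundary f \<zeta>) \<and>
     (\<lambda>n. f (of_real (radii n) * \<zeta>)) \<longlonglongrightarrow> boundary f \<zeta> \<and>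
     radial_boundary f \<zeta> = boundary f \<zeta> \<and> norm (boundary f \<zeta>) \<le> B"
proof -
  have "AE \<zeta> in \<mu>. \<exists>l. has_radial_limit f \<zeta> l"
    using assms by (intro fatou_radial_limits[of f B]) (auto simp: bounded_holomorphic_def)
  then show ?thesis using AE_circle_norm
  proof eventually_elim
    case (elim \<zeta>)
    then obtain l where l: "has_radial_limit f \<zeta> l" by blast
    note r = has_radial_limit_radii[OF l]
    have "norm (f (of_real (radii n) * \<zeta>)) \<le> B" for n
      using assms radii_mult_disc[of \<zeta> n] elim by (auto simp: bounded_holomorphic_def simp del: mem_ball)
    then have "norm l \<le> B" using LIMSEQ_le_const2[OF tendsto_norm[OF r(1)]] by blast
    then show ?case using elim l r radial_boundary_eq[OF l] by simp
  qed
qed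

lemma AE_boundary_le: "bounded_holomorphic f B \<Longrightarrow> AE \<zeta> in \<mu>. norm (boundary f \<zeta>) \<le> B"
  by (drule AE_boundary) (auto elim!: eventually_mono)

lemma weighted_dominated_convergence:
  fixes F :: "complex \<Rightarrow> 'a::{real_normed_field, banach, second_countable_topology}"
  assumes Fn: "\<And>n. Fn n \<in> borel_measurable \<mu>" "\<And>n. AE \<zeta> in \<mu>. norm (Fn n \<zeta>) \<le> B"
    and F: "F \<in> borel_measurable \<mu>" "AE \<zeta> in \<mu>. (\<lambda>n. Fn n \<zeta>) \<longlonglongrightarrow> F \<zeta>"
    and g: "integrable \<mu> g"
  shows "(\<lambda>n. \<integral>\<zeta>. of_real (g \<zeta>) * Fn n \<zeta> \<partial>\<mu>) \<longlonglongrightarrow> (\<integral>\<zeta>. of_real (g \<zeta>) * F \<zeta> \<partial>\<mu>)"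
proof (rule integral_dominated_convergence[where w = "\<lambda>\<zeta>. \<bar>B * g \<zeta>\<bar>"])
  note [measurable] = Fn(1) F(1) borel_measurable_integrable[OF g]
  show "(\<lambda>\<zeta>. of_real (g \<zeta>) * F \<zeta>) \<in> borel_measurable \<mu>" by measurable
  show "(\<lambda>\<zeta>. of_real (g \<zeta>) * Fn n \<zeta>) \<in> borel_measurable \<mu>" for n by measurable
  show "integrable \<mu> (\<lambda>\<zeta>. \<bar>B * g \<zeta>\<bar>)" using g by simp
  show "AE \<zeta> in \<mu>. (\<lambda>n. of_real (g \<zeta>) * Fn n \<zeta>) \<longlonglongrightarrow> of_real (g \<zeta>) * F \<zeta>"
    using F(2) by eventually_elim (intro tendsto_intros)
  show "AE \<zeta> in \<mu>. norm (of_real (g \<zeta>) * Fn n \<zeta>) \<le> \<bar>B * g \<zeta>\<bar>" for n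
    using Fn(2)[of n]
  proof eventually_elim
    case (elim \<zeta>)
    have "\<bar>g \<zeta>\<bar> * norm (Fn n \<zeta>) \<le> \<bar>g \<zeta>\<bar> * \<bar>B\<bar>" using elim by (intro mult_left_mono) auto
    then show ?case by (simp add: norm_mult abs_mult mult_ac)
  qed
qed

text \<open>The dilations of \<open>f\<close> are holomorphic past the closed disc and obey the
  Poisson formula; bounded convergence along \<open>radii\<close> carries it over to the boundary
  function.\<close>

lemma poisson_boundary:
  assumes f: "bounded_holomorphic f B" and a: "norm a < 1"
  shows "(\<integral>\<zeta>. of_real (poisson a \<zeta>) * boundary f \<zeta> \<partial>\<mu>) = f a"
proof -
  have hol: "f holomorphic_on \<bbbD>" and bd: "\<And>z. z \<in> \<bbbD> \<Longrightarrow> norm (f z) \<le> B"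
    using f by (auto simp: bounded_holomorphic_def)
  have "(\<lambda>n. \<integral>\<zeta>. of_real (poisson a \<zeta>) * f (of_real (radii n) * \<zeta>) \<partial>\<mu>)
      \<longlonglongrightarrow> (\<integral>\<zeta>. of_real (poisson a \<zeta>) * boundary f \<zeta> \<partial>\<mu>)"
  proof (rule weighted_dominated_convergence[where B = B])
    show "AE \<zeta> in \<mu>. norm (f (of_real (radii n) * \<zeta>)) \<le> B" for n
      using AE_circle_norm by eventually_elim (auto intro!: bd radii_mult_disc simp del: mem_ball)
    show "AE \<zeta> in \<mu>. (\<lambda>n. f (of_real (radii n) * \<zeta>)) \<longlonglongrightarrow> boundary f \<zeta>"
      using AE_boundary[OF f] by (auto elim!: eventually_mono)
  qed (use hol a in \<open>auto intro!: measurable_radii boundary_measurable integrable_poisson\<close>)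
  moreover have "(\<integral>\<zeta>. of_real (poisson a \<zeta>) * f (of_real (radii n) * \<zeta>) \<partial>\<mu>) = f (of_real (radii n) * a)" for n
  proof (rule poisson_integral_disc[OF _ _ a, of _ "1 / radii n"])
    show "(\<lambda>z. f (of_real (radii n) * z)) holomorphic_on ball 0 (1 / radii n)"
      by (rule holomorphic_on_compose_gen[OF _ hol, of "\<lambda>z. of_real (radii n) * z", unfolded comp_def])
         (use radii(1)[of n] in \<open>auto intro!: holomorphic_intros simp: norm_mult field_simps\<close>)
  qed (use radii(1,2)[of n] in auto)
  moreover have "(\<lambda>n. f (of_real (radii n) * a)) \<longlonglongrightarrow> f a"
  proof (rule continuous_on_tendsto_compose[OF holomorphic_on_imp_continuous_on[OF hol]])
    show "(\<lambda>n. of_real (radii n) * a) \<longlonglongrightarrow> a"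
      using tendsto_mult[OF tendsto_of_real[OF radii(3)] tendsto_const[of a]] by simp
  qed (use a radii_mult_disc[of a] in \<open>auto simp del: mem_ball simp: mem_ball_0\<close>)
  ultimately show ?thesis by (simp add: LIMSEQ_unique)
qed

text \<open>The boundary value of \<open>f\<close> lies inside the disc, so continuity of
  \<open>g\<close> at that point is enough.\<close>

lemma boundary_comp:
  assumes "(\<lambda>n. f (of_real (radii n) * \<zeta>)) \<longlonglongrightarrow> boundary f \<zeta>" "norm (boundary f \<zeta>) < 1"
    and g: "g holomorphic_on \<bbbD>" and f: "\<And>z. z \<in> \<bbbD> \<Longrightarrow> f z \<in> \<bbbD>" and \<zeta>: "norm \<zeta> = 1"
  shows "boundary (\<lambda>z. g (f z)) \<zeta> = g (boundary f \<zeta>)"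
  unfolding boundary_def[of "\<lambda>z. g (f z)"]
  by (rule limI, rule continuous_on_tendsto_compose[OF holomorphic_on_imp_continuous_on[OF g] assms(1)])
     (use assms(2) f radii_mult_disc[of \<zeta>] \<zeta> in auto)

text \<open>The difference of the two sides is the variance of \<open>boundary f\<close> under
  \<open>poisson z\<close>.\<close>

lemma poisson_boundary_defect:
  assumes f: "bounded_holomorphic f B" and z: "norm z < 1"
  shows "norm (f z) ^ 2 \<le> (\<integral>\<eta>. poisson z \<eta> * norm (boundary f \<eta>) ^ 2 \<partial>\<mu>)"
proof -
  have "(\<integral>\<eta>. poisson z \<eta> * norm (boundary f \<eta> - f z) ^ 2 \<partial>\<mu>)
      = (\<integral>\<eta>. poisson z \<eta> * norm (boundary f \<eta>) ^ 2 \<partial>\<mu>) - norm (f z) ^ 2"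
    using f by (intro poisson_variance[OF _ AE_boundary_le[OF f] z poisson_boundary[OF f z]] boundary_measurable)
      (simp add: bounded_holomorphic_def)
  moreover have "(\<integral>\<eta>. poisson z \<eta> * norm (boundary f \<eta> - f z) ^ 2 \<partial>\<mu>) \<ge> 0"
    by (rule Bochner_Integration.integral_nonneg_AE)
       (use AE_circle_norm in eventually_elim, simp add: poisson_bounds(3)[OF z] less_imp_le)
  ultimately show ?thesis by simp
qed

lemma boundary_eqI:
  assumes "(\<lambda>n. f (of_real (radii n) * \<zeta>)) \<longlonglongrightarrow> l"
  shows "boundary f \<zeta> = l"
  unfolding boundary_def by (rule limI[OF assms])

lemma bounded_holomorphic_comp:
  assumes "bounded_holomorphic f B" "\<psi> holomorphic_on \<bbbD>" "\<psi> ` \<bbbD> \<subseteq> \<bbbD>"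
  shows "bounded_holomorphic (\<lambda>z. f (\<psi> z)) B"
  using assms holomorphic_on_compose_gen[of \<psi> \<bbbD> f \<bbbD>]
  by (auto simp: bounded_holomorphic_def comp_def image_subset_iff)

lemma bounded_holomorphic_power:
  assumes "\<psi> holomorphic_on \<bbbD>" "\<psi> ` \<bbbD> \<subseteq> \<bbbD>"
  shows "bounded_holomorphic (\<lambda>z. \<psi> z ^ k) 1"
proof -
  have "norm (\<psi> z ^ k) \<le> 1" if "z \<in> \<bbbD>" for z
  proof -
    have "norm (\<psi> z) < 1" using assms(2) that by (auto simp: image_subset_iff)
    then show ?thesis by (simp add: norm_power power_le_one)
  qed
  then show ?thesis using assms(1) by (auto simp: bounded_holomorphic_def intro!: holomorphic_intros)
qed

section \<open>Moments and composition of inner functions\<close>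

lemma borel_measurable_cnj' [measurable (raw)]:
  "f \<in> borel_measurable M \<Longrightarrow> (\<lambda>x. cnj (f x)) \<in> borel_measurable M"
  by (rule measurable_compose[of f M borel cnj]) (auto intro!: borel_measurable_continuous_onI continuous_intros)

lemma AE_poisson_pos: "norm a < 1 \<Longrightarrow> AE \<zeta> in \<mu>. poisson a \<zeta> > 0"
  using AE_circle_norm by eventually_elim (rule poisson_bounds)

text \<open>\<open>h\<close> is the backward shift of \<open>F\<close>, used to lower the power in
  \<open>inner_moment_step\<close>. It is bounded near 0 by continuity, and for
  \<open>norm z > 1/2\<close> by \<open>2 * B\<close> divided by \<open>1/2\<close>.\<close>

lemma difference_quotient_bounded:
  assumes F: "bounded_holomorphic F B"
  obtains h B' where "bounded_holomorphic h B'" "\<And>z. z \<in> \<bbbD> \<Longrightarrow> F z = F 0 + z * h z"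
proof -
  define h where "h z = (if z = 0 then deriv F 0 else (F z - F 0) / (z - 0))" for z
  have Fh: "F holomorphic_on \<bbbD>" and FB: "\<And>z. z \<in> \<bbbD> \<Longrightarrow> norm (F z) \<le> B" using F by (auto simp: bounded_holomorphic_def)
  have h: "h holomorphic_on \<bbbD>" unfolding h_def by (rule pole_lemma_open[OF Fh]) simp
  have "continuous_on (cball 0 (1/2)) h"
    by (intro holomorphic_on_imp_continuous_on holomorphic_on_subset[OF h]) auto
  then have "bounded (h ` cball 0 (1/2))" by (intro compact_imp_bounded compact_continuous_image) auto
  then obtain C where "\<forall>x\<in>h ` cball 0 (1/2). norm x \<le> C" unfolding bounded_iff by blast
  then have C: "norm (h z) \<le> C" if "norm z \<le> 1/2" for z using that by simp
  have "norm (h z) \<le> max C (4 * B)" if z: "norm z < 1" for z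
  proof (cases "norm z \<le> 1/2")
    case False
    then have "norm (h z) = norm (F z - F 0) / norm z" by (auto simp: h_def norm_divide)
    also have "\<dots> \<le> (2 * B) / (1/2)"
      using FB[of z] FB[of 0] order_trans[OF norm_ge_zero FB[of 0]] z False norm_triangle_ineq4[of "F z" "F 0"] by (intro frac_le) auto
    finally show ?thesis by simp
  qed (use C in \<open>auto simp: le_max_iff_disj\<close>)
  then have "bounded_holomorphic h (max C (4 * B))" using h by (simp add: bounded_holomorphic_def)
  then show ?thesis by (rule that) (simp add: h_def)
qed

text \<open>Almost everywhere
  \<open>boundary \<psi> \<zeta> * cnj (boundary \<psi> \<zeta>) = 1\<close>, so the factor split
  off from \<open>F\<close> cancels one conjugate power. The constant \<open>F 0\<close> is left
  with the conjugate of a power of \<open>boundary \<psi>\<close>, which the Poisson formula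
  integrates.\<close>

lemma inner_moment_step:
  assumes \<psi>: "\<psi> holomorphic_on \<bbbD>" "\<psi> ` \<bbbD> \<subseteq> \<bbbD>" "AE \<zeta> in \<mu>. norm (boundary \<psi> \<zeta>) = 1"
    and c: "norm c < 1" and h: "bounded_holomorphic h B" and F: "\<And>z. z \<in> \<bbbD> \<Longrightarrow> F z = F 0 + z * h z"
  shows "(\<integral>\<zeta>. of_real (poisson c \<zeta>) * (boundary (\<lambda>z. F (\<psi> z)) \<zeta> * cnj (boundary \<psi> \<zeta>) ^ Suc k) \<partial>\<mu>)
    = F 0 * cnj (\<psi> c) ^ Suc k +
      (\<integral>\<zeta>. of_real (poisson c \<zeta>) * (boundary (\<lambda>z. h (\<psi> z)) \<zeta> * cnj (boundary \<psi> \<zeta>) ^ k) \<partial>\<mu>)"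
proof -
  note hc = bounded_holomorphic_comp[OF h \<psi>(1,2)]
  have \<psi>1: "bounded_holomorphic \<psi> 1" using bounded_holomorphic_power[OF \<psi>(1,2), of 1] by simp
  have \<psi>D: "\<psi> z \<in> \<bbbD>" if "z \<in> \<bbbD>" for z using \<psi>(2) that by blast
  define H where "H = boundary (\<lambda>z. h (\<psi> z))"
  define K where "K = boundary (\<lambda>z. F (\<psi> z))"
  have [measurable]: "boundary \<psi> \<in> borel_measurable \<mu>"
      "H \<in> borel_measurable \<mu>"
    unfolding H_def using hc \<psi>(1) by (auto intro!: boundary_measurable simp: bounded_holomorphic_def)
  have pow: "(\<integral>\<zeta>. of_real (poisson c \<zeta>) * boundary \<psi> \<zeta> ^ Suc k \<partial>\<mu>) = \<psi> c ^ Suc k"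
  proof -
    have "AE \<zeta> in \<mu>. boundary (\<lambda>z. \<psi> z ^ Suc k) \<zeta> = boundary \<psi> \<zeta> ^ Suc k"
      using AE_boundary[OF \<psi>1] by eventually_elim (intro boundary_eqI tendsto_power, blast)
    then have "(\<integral>\<zeta>. of_real (poisson c \<zeta>) * boundary \<psi> \<zeta> ^ Suc k \<partial>\<mu>)
        = (\<integral>\<zeta>. of_real (poisson c \<zeta>) * boundary (\<lambda>z. \<psi> z ^ Suc k) \<zeta> \<partial>\<mu>)"
      using bounded_holomorphic_power[OF \<psi>(1,2), of "Suc k"]
      by (intro integral_cong_AE borel_measurable_times)
         (auto intro!: boundary_measurable elim!: eventually_mono simp: bounded_holomorphic_def simp del: power_Suc)
    then show ?thesis using poisson_boundary[OF bounded_holomorphic_power[OF \<psi>(1,2), of "Suc k"] c] by simp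
  qed
  have i1: "integrable \<mu> (\<lambda>\<zeta>. of_real (poisson c \<zeta>) * boundary \<psi> \<zeta> ^ Suc k)"
  proof (rule integrable_mult_bounded[OF _ _ integrable_poisson[OF c]])
    show "AE \<zeta> in \<mu>. norm (boundary \<psi> \<zeta> ^ Suc k) \<le> 1"
      using \<psi>(3) by eventually_elim (simp only: norm_power power_one)
  qed measurable
  have i2: "integrable \<mu> (\<lambda>\<zeta>. of_real (poisson c \<zeta>) * (H \<zeta> * cnj (boundary \<psi> \<zeta>) ^ k))"
  proof (rule integrable_mult_bounded[OF _ _ integrable_poisson[OF c]])
    show "AE \<zeta> in \<mu>. norm (H \<zeta> * cnj (boundary \<psi> \<zeta>) ^ k) \<le> B"
      using \<psi>(3) AE_boundary_le[OF hc, folded H_def] by eventually_elim (simp add: norm_mult norm_power)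
  qed measurable
  have AE_eq: "AE \<zeta> in \<mu>. K \<zeta> = F 0 + boundary \<psi> \<zeta> * H \<zeta>"
    using AE_boundary[OF \<psi>1] AE_boundary[OF hc, folded H_def]
  proof eventually_elim
    case (elim \<zeta>)
    have "(\<lambda>n. F 0 + \<psi> (of_real (radii n) * \<zeta>) * h (\<psi> (of_real (radii n) * \<zeta>)))
        \<longlonglongrightarrow> F 0 + boundary \<psi> \<zeta> * H \<zeta>"
      using elim by (intro tendsto_intros) auto
    moreover have "F 0 + \<psi> (of_real (radii n) * \<zeta>) * h (\<psi> (of_real (radii n) * \<zeta>)) = F (\<psi> (of_real (radii n) * \<zeta>))" for n
      using elim by (intro F[symmetric] \<psi>D radii_mult_disc) simp
    ultimately show ?case unfolding K_def by (intro boundary_eqI) simp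
  qed
  have Fm: "K \<in> borel_measurable \<mu>"
    unfolding K_def
  proof (rule boundary_measurable)
    have "(\<lambda>z. F 0 + \<psi> z * h (\<psi> z)) holomorphic_on \<bbbD>"
      using hc \<psi>(1) by (intro holomorphic_intros) (auto simp: bounded_holomorphic_def)
    then show "(\<lambda>z. F (\<psi> z)) holomorphic_on \<bbbD>"
      by (rule holomorphic_transform) (use F[OF \<psi>D] in simp)
  qed
  note [measurable] = Fm
  have "(\<integral>\<zeta>. of_real (poisson c \<zeta>) * (K \<zeta> * cnj (boundary \<psi> \<zeta>) ^ Suc k) \<partial>\<mu>)
      = (\<integral>\<zeta>. F 0 * cnj (of_real (poisson c \<zeta>) * boundary \<psi> \<zeta> ^ Suc k)
         + of_real (poisson c \<zeta>) * (H \<zeta> * cnj (boundary \<psi> \<zeta>) ^ k) \<partial>\<mu>)"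
  proof (rule integral_cong_AE)
    show "AE \<zeta> in \<mu>. of_real (poisson c \<zeta>) * (K \<zeta> * cnj (boundary \<psi> \<zeta>) ^ Suc k)
      = F 0 * cnj (of_real (poisson c \<zeta>) * boundary \<psi> \<zeta> ^ Suc k)
         + of_real (poisson c \<zeta>) * (H \<zeta> * cnj (boundary \<psi> \<zeta>) ^ k)"
      using AE_eq \<psi>(3)
    proof eventually_elim
      case (elim \<zeta>)
      then have "boundary \<psi> \<zeta> * cnj (boundary \<psi> \<zeta>) = 1" using complex_norm_square[of "boundary \<psi> \<zeta>"] by simp
      then have "boundary \<psi> \<zeta> * H \<zeta> * cnj (boundary \<psi> \<zeta>) ^ Suc k
         = H \<zeta> * cnj (boundary \<psi> \<zeta>) ^ k"
        by (metis mult.assoc mult.commute mult_1 power_Suc)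
      then show ?case unfolding elim(1) by (simp add: distrib_left distrib_right del: power_Suc)
    qed
  qed measurable
  also have "\<dots> = (\<integral>\<zeta>. F 0 * cnj (of_real (poisson c \<zeta>) * boundary \<psi> \<zeta> ^ Suc k) \<partial>\<mu>)
      + (\<integral>\<zeta>. of_real (poisson c \<zeta>) * (H \<zeta> * cnj (boundary \<psi> \<zeta>) ^ k) \<partial>\<mu>)"
    by (intro Bochner_Integration.integral_add i2 integrable_mult_right integrable_cnj i1)
  also have "(\<integral>\<zeta>. F 0 * cnj (of_real (poisson c \<zeta>) * boundary \<psi> \<zeta> ^ Suc k) \<partial>\<mu>)
      = F 0 * cnj (\<psi> c) ^ Suc k"
  proof -
    have "(\<integral>\<zeta>. cnj (of_real (poisson c \<zeta>) * boundary \<psi> \<zeta> ^ Suc k) \<partial>\<mu>) = cnj (\<psi> c ^ Suc k)"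
      unfolding pow[symmetric] by (rule Bochner_Integration.integral_cnj)
    then show ?thesis by (simp only: integral_mult_right_zero complex_cnj_power)
  qed
  finally show ?thesis unfolding H_def K_def .
qed

text \<open>The recursion sees \<open>\<psi>\<close> and \<open>c\<close> only through
  \<open>\<psi> c\<close>. With \<open>\<tau>\<close> the identity and \<open>d = \<psi> c\<close>
  this is Loewner's lemma in moment form: an inner map carries harmonic measure at \<open>c\<close>
  to harmonic measure at \<open>\<psi> c\<close>. Keeping \<open>F (\<psi> z)\<close> as one
  function avoids evaluating \<open>boundary F\<close> at boundary values of
  \<open>\<psi>\<close>.\<close>

lemma inner_moments_agree:
  assumes \<psi>: "\<psi> holomorphic_on \<bbbD>" "\<psi> ` \<bbbD> \<subseteq> \<bbbD>" "AE \<zeta> in \<mu>. norm (boundary \<psi> \<zeta>) = 1"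
    and \<tau>: "\<tau> holomorphic_on \<bbbD>" "\<tau> ` \<bbbD> \<subseteq> \<bbbD>" "AE \<zeta> in \<mu>. norm (boundary \<tau> \<zeta>) = 1"
    and c: "norm c < 1" and d: "norm d < 1" and eq: "\<psi> c = \<tau> d" and F: "bounded_holomorphic F B"
  shows "(\<integral>\<zeta>. of_real (poisson c \<zeta>) * (boundary (\<lambda>z. F (\<psi> z)) \<zeta> * cnj (boundary \<psi> \<zeta>) ^ k) \<partial>\<mu>)
    = (\<integral>\<zeta>. of_real (poisson d \<zeta>) * (boundary (\<lambda>z. F (\<tau> z)) \<zeta> * cnj (boundary \<tau> \<zeta>) ^ k) \<partial>\<mu>)"
  using F
proof (induction k arbitrary: F B)
  case 0
  then show ?case
    using poisson_boundary[OF bounded_holomorphic_comp[OF 0 \<psi>(1,2)] c]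
      poisson_boundary[OF bounded_holomorphic_comp[OF 0 \<tau>(1,2)] d] by (simp add: eq)
next
  case (Suc k)
  obtain h B' where h: "bounded_holomorphic h B'" "\<And>z. z \<in> \<bbbD> \<Longrightarrow> F z = F 0 + z * h z"
    using difference_quotient_bounded[OF Suc.prems] by blast
  show ?case
    by (rule trans[OF inner_moment_step[OF \<psi> c h] trans[OF _ inner_moment_step[OF \<tau> d h, symmetric]]])
       (simp_all only: eq Suc.IH[OF h(1)])
qed

text \<open>Composing with the dilations \<open>F (r z)\<close>, which extend continuously to the boundary, and pairing
  with \<open>F \<circ> \<phi>\<close> gives \<open>\<integral> |(F \<circ> \<phi>)\<^sup>*| \<ge> 1\<close>.\<close>

lemma inner_comp:
  assumes F: "bounded_holomorphic F 1" "AE \<zeta> in \<mu>. norm (boundary F \<zeta>) = 1"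
    and \<phi>: "\<phi> holomorphic_on \<bbbD>" "\<phi> ` \<bbbD> \<subseteq> \<bbbD>" "AE \<zeta> in \<mu>. norm (boundary \<phi> \<zeta>) = 1"
  shows "AE \<zeta> in \<mu>. norm (boundary (\<lambda>z. F (\<phi> z)) \<zeta>) = 1"
proof -
  have Fh: "F holomorphic_on \<bbbD>" and FB: "\<And>z. z \<in> \<bbbD> \<Longrightarrow> norm (F z) \<le> 1"
    using F(1) by (auto simp: bounded_holomorphic_def)
  define a where "a = \<phi> 0"
  have a: "norm a < 1" using \<phi>(2) by (auto simp: a_def image_subset_iff)
  note Fc = bounded_holomorphic_comp[OF F(1) \<phi>(1,2)]
  define H where "H = boundary (\<lambda>z. F (\<phi> z))"
  have [measurable]: "H \<in> borel_measurable \<mu>" "boundary \<phi> \<in> borel_measurable \<mu>"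
      "boundary F \<in> borel_measurable \<mu>"
    using Fc \<phi>(1) Fh unfolding H_def by (auto intro!: boundary_measurable simp: bounded_holomorphic_def)
  have H1: "AE \<zeta> in \<mu>. norm (H \<zeta>) \<le> 1" using AE_boundary_le[OF Fc] by (simp add: H_def)
  have iH: "integrable \<mu> (\<lambda>\<zeta>. poisson 0 \<zeta> * norm (H \<zeta>))"
    by (rule integrable_poisson_mult[where B = 1]) (use H1 in auto)
  have id_bd: "boundary (\<lambda>z. z) \<zeta> = \<zeta>" for \<zeta>
    using tendsto_mult[OF tendsto_of_real[OF radii(3)] tendsto_const[of \<zeta>]] by (intro boundary_eqI) simp
  define c where "c k = (deriv ^^ k) F 0 / fact k" for k
  have sums: "(\<lambda>k. c k * z ^ k) sums F z" if "norm z < 1" for z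
    using holomorphic_power_series[OF Fh, of z] that by (simp add: c_def)
  \<comment> \<open>Tends to 1, because \<open>boundary F\<close> is unimodular. The moment identity
    rewrites it as an integral containing \<open>H\<close>, which bounds the mean of
    \<open>norm (H \<zeta>)\<close> from below.\<close>
  define A where "A m = (\<integral>\<zeta>. of_real (poisson a \<zeta>) * (boundary F \<zeta> * cnj (F (of_real (radii m) * \<zeta>))) \<partial>\<mu>)" for m
  have pair: "norm (A m) \<le> (\<integral>\<zeta>. poisson 0 \<zeta> * norm (H \<zeta>) \<partial>\<mu>)" for m
  proof -
    define r where "r = radii m"
    have r: "0 < r" "r < 1" unfolding r_def by (rule radii)+
    \<comment> \<open>Taylor polynomials of the dilation of \<open>F\<close>; their conjugates
      produce exactly the moments compared in \<open>inner_moments_agree\<close>.\<close>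
    define S where "S K z = (\<Sum>k<K. c k * of_real r ^ k * z ^ k)" for K z
    have S_lim: "(\<lambda>K. S K z) \<longlonglongrightarrow> F (of_real r * z)" if "norm z = 1" for z
    proof -
      have "norm (of_real r * z) < 1" using r that by (simp add: norm_mult)
      from sums[OF this] show ?thesis by (simp add: S_def sums_def power_mult_distrib mult_ac)
    qed
    have "summable (\<lambda>k. norm (c k * of_real r ^ k))"
      unfolding c_def using r by (intro summable_norm_taylor[OF Fh]) auto
    then have S_bd: "norm (S K z) \<le> (\<Sum>k. norm (c k * of_real r ^ k))" if "norm z = 1" for K z
    proof -
      have "norm (S K z) \<le> (\<Sum>k<K. norm (c k * of_real r ^ k * z ^ k))" unfolding S_def by (rule norm_sum)
      also have "\<dots> = (\<Sum>k<K. norm (c k * of_real r ^ k))" using that by (simp add: norm_mult norm_power)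
      also have "\<dots> \<le> (\<Sum>k. norm (c k * of_real r ^ k))"
        using \<open>summable _\<close> by (intro sum_le_suminf) auto
      finally show ?thesis .
    qed
    define C where "C = (\<Sum>k. norm (c k * of_real r ^ k))"
    have S_meas[measurable]: "S K \<in> borel_measurable borel" for K
      unfolding S_def by (intro borel_measurable_continuous_onI continuous_intros)
    \<comment> \<open>As a limit of polynomials this is Borel on the whole plane, so its composition
      with \<open>boundary \<phi>\<close> is measurable even though \<open>boundary \<phi>\<close>
      may leave the circle on a null set.\<close>
    define Fr where "Fr z = lim (\<lambda>K. S K z)" for z
    have [measurable]: "Fr \<in> borel_measurable borel"
      unfolding Fr_def[abs_def] by (rule borel_measurable_lim_metric) (rule S_meas)
    have Fr: "Fr z = F (of_real r * z)" if "norm z = 1" for z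
      unfolding Fr_def using S_lim[OF that] by (rule limI)
    have lim: "(\<lambda>K. \<integral>\<zeta>. of_real (poisson b \<zeta>) * (G \<zeta> * cnj (S K (\<psi> \<zeta>))) \<partial>\<mu>)
        \<longlonglongrightarrow> (\<integral>\<zeta>. of_real (poisson b \<zeta>) * (G \<zeta> * cnj (Fr (\<psi> \<zeta>))) \<partial>\<mu>)"
      if [measurable]: "G \<in> borel_measurable \<mu>" "\<psi> \<in> borel_measurable \<mu>"
        and G: "AE \<zeta> in \<mu>. norm (G \<zeta>) \<le> 1" and \<psi>: "AE \<zeta> in \<mu>. norm (\<psi> \<zeta>) = 1"
        and b: "norm b < 1" for G \<psi> b
    proof (rule weighted_dominated_convergence[where B = C])
      show "AE \<zeta> in \<mu>. norm (G \<zeta> * cnj (S K (\<psi> \<zeta>))) \<le> C" for K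
        using G \<psi>
      proof eventually_elim
        case (elim \<zeta>)
        have "norm (G \<zeta>) * norm (S K (\<psi> \<zeta>)) \<le> 1 * C"
          using elim S_bd[OF elim(2)] unfolding C_def by (intro mult_mono) auto
        then show ?case by (simp add: norm_mult)
      qed
      show "AE \<zeta> in \<mu>. (\<lambda>K. G \<zeta> * cnj (S K (\<psi> \<zeta>))) \<longlonglongrightarrow> G \<zeta> * cnj (Fr (\<psi> \<zeta>))"
        using \<psi>
      proof eventually_elim
        case (elim \<zeta>)
        show ?case unfolding Fr[OF elim] by (intro tendsto_intros S_lim[OF elim])
      qed
    qed (use b in \<open>auto simp: integrable_poisson\<close>)
    have expand: "(\<integral>\<zeta>. of_real (poisson b \<zeta>) * (G \<zeta> * cnj (S K (\<psi> \<zeta>))) \<partial>\<mu>)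
        = (\<Sum>k<K. cnj (c k * of_real r ^ k) * (\<integral>\<zeta>. of_real (poisson b \<zeta>) * (G \<zeta> * cnj (\<psi> \<zeta>) ^ k) \<partial>\<mu>))"
      if [measurable]: "G \<in> borel_measurable \<mu>" "\<psi> \<in> borel_measurable \<mu>"
        and G: "AE \<zeta> in \<mu>. norm (G \<zeta>) \<le> 1" and \<psi>: "AE \<zeta> in \<mu>. norm (\<psi> \<zeta>) = 1"
        and b: "norm b < 1" for G \<psi> b K
    proof -
      have i: "integrable \<mu> (\<lambda>\<zeta>. of_real (poisson b \<zeta>) * (G \<zeta> * cnj (\<psi> \<zeta>) ^ k))" for k
      proof (rule integrable_mult_bounded[OF _ _ integrable_poisson[OF b]])
        show "AE \<zeta> in \<mu>. norm (G \<zeta> * cnj (\<psi> \<zeta>) ^ k) \<le> 1"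
          using G \<psi> by eventually_elim (simp add: norm_mult norm_power)
      qed measurable
      have "of_real (poisson b \<zeta>) * (G \<zeta> * cnj (S K (\<psi> \<zeta>)))
         = (\<Sum>k<K. cnj (c k * of_real r ^ k) * (of_real (poisson b \<zeta>) * (G \<zeta> * cnj (\<psi> \<zeta>) ^ k)))" for \<zeta>
        by (simp add: S_def sum_distrib_left mult_ac)
      then show ?thesis
        using i by (simp only:) (subst Bochner_Integration.integral_sum, auto simp del: complex_cnj_mult)
    qed
    have F1: "AE \<zeta> in \<mu>. norm (boundary F \<zeta>) \<le> 1" by (rule AE_boundary_le[OF F(1)])
    have idm: "(\<lambda>z::complex. z) holomorphic_on \<bbbD>" "(\<lambda>z::complex. z) ` \<bbbD> \<subseteq> \<bbbD>"
        "AE \<zeta> in \<mu>. norm (boundary (\<lambda>z. z) \<zeta>) = 1"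
      using AE_circle_norm by (auto simp: id_bd)
    have "(\<integral>\<zeta>. of_real (poisson 0 \<zeta>) * (H \<zeta> * cnj (S K (boundary \<phi> \<zeta>))) \<partial>\<mu>)
        = (\<integral>\<zeta>. of_real (poisson a \<zeta>) * (boundary F \<zeta> * cnj (S K \<zeta>)) \<partial>\<mu>)" for K
    proof -
      have "(\<integral>\<zeta>. of_real (poisson 0 \<zeta>) * (H \<zeta> * cnj (boundary \<phi> \<zeta>) ^ k) \<partial>\<mu>)
        = (\<integral>\<zeta>. of_real (poisson a \<zeta>) * (boundary F \<zeta> * cnj \<zeta> ^ k) \<partial>\<mu>)" for k
        using inner_moments_agree[OF \<phi> idm _ a _ F(1), of 0 k] by (simp add: H_def id_bd a_def)
      then show ?thesis
        using expand[of H "boundary \<phi>" 0 K] expand[of "boundary F" "\<lambda>\<zeta>. \<zeta>" a K] H1 \<phi>(3) F1 AE_circle_norm a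
        by simp
    qed
    moreover note lim[of H "boundary \<phi>" 0]
    ultimately have "(\<lambda>K. \<integral>\<zeta>. of_real (poisson a \<zeta>) * (boundary F \<zeta> * cnj (S K \<zeta>)) \<partial>\<mu>)
       \<longlonglongrightarrow> (\<integral>\<zeta>. of_real (poisson 0 \<zeta>) * (H \<zeta> * cnj (Fr (boundary \<phi> \<zeta>))) \<partial>\<mu>)"
      using H1 \<phi>(3) by simp
    moreover have "(\<lambda>K. \<integral>\<zeta>. of_real (poisson a \<zeta>) * (boundary F \<zeta> * cnj (S K \<zeta>)) \<partial>\<mu>)
       \<longlonglongrightarrow> (\<integral>\<zeta>. of_real (poisson a \<zeta>) * (boundary F \<zeta> * cnj (Fr \<zeta>)) \<partial>\<mu>)"
      using lim[of "boundary F" "\<lambda>\<zeta>. \<zeta>" a] F1 AE_circle_norm a by simp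
    ultimately have "(\<integral>\<zeta>. of_real (poisson 0 \<zeta>) * (H \<zeta> * cnj (Fr (boundary \<phi> \<zeta>))) \<partial>\<mu>)
        = (\<integral>\<zeta>. of_real (poisson a \<zeta>) * (boundary F \<zeta> * cnj (Fr \<zeta>)) \<partial>\<mu>)"
      by (rule LIMSEQ_unique)
    also have "\<dots> = A m"
      unfolding A_def
      by (rule Bochner_Integration.integral_cong[OF refl]) (simp add: Fr space_circle_measure r_def)
    finally have A_eq: "A m = (\<integral>\<zeta>. of_real (poisson 0 \<zeta>) * (H \<zeta> * cnj (Fr (boundary \<phi> \<zeta>))) \<partial>\<mu>)" ..
    have Fr1: "norm (Fr z) \<le> 1" if "norm z = 1" for z
      unfolding Fr[OF that] r_def using that by (intro FB radii_mult_disc) simp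
    have "norm (A m) \<le> (\<integral>\<zeta>. norm (of_real (poisson 0 \<zeta>) * (H \<zeta> * cnj (Fr (boundary \<phi> \<zeta>)))) \<partial>\<mu>)"
      unfolding A_eq by (rule integral_norm_bound)
    also have "\<dots> \<le> (\<integral>\<zeta>. poisson 0 \<zeta> * norm (H \<zeta>) \<partial>\<mu>)"
    proof (rule integral_mono_AE'[OF iH])
      show "AE \<zeta> in \<mu>. norm (of_real (poisson 0 \<zeta>) * (H \<zeta> * cnj (Fr (boundary \<phi> \<zeta>)))) \<le> poisson 0 \<zeta> * norm (H \<zeta>)"
        using \<phi>(3) AE_poisson_pos[of 0, simplified]
      proof eventually_elim
        case (elim \<zeta>)
        have "norm (H \<zeta>) * norm (Fr (boundary \<phi> \<zeta>)) \<le> norm (H \<zeta>) * 1"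
          by (intro mult_left_mono Fr1 elim) simp
        then show ?case using elim by (simp add: norm_mult mult_left_mono)
      qed
      show "AE \<zeta> in \<mu>. 0 \<le> poisson 0 \<zeta> * norm (H \<zeta>)"
        using AE_poisson_pos[of 0, simplified] by eventually_elim simp
    qed
    finally show ?thesis .
  qed
  have "A \<longlonglongrightarrow> (\<integral>\<zeta>. of_real (poisson a \<zeta>) * (boundary F \<zeta> * cnj (boundary F \<zeta>)) \<partial>\<mu>)"
    unfolding A_def[abs_def]
  proof (rule weighted_dominated_convergence[where B = 1])
    show "AE \<zeta> in \<mu>. norm (boundary F \<zeta> * cnj (F (of_real (radii m) * \<zeta>))) \<le> 1" for m
      using F(2) AE_circle_norm
    proof eventually_elim
      case (elim \<zeta>)
      then show ?case using FB[OF radii_mult_disc[of \<zeta> m]] by (simp add: norm_mult)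
    qed
    show "AE \<zeta> in \<mu>. (\<lambda>m. boundary F \<zeta> * cnj (F (of_real (radii m) * \<zeta>))) \<longlonglongrightarrow> boundary F \<zeta> * cnj (boundary F \<zeta>)"
      using AE_boundary[OF F(1)] by eventually_elim (intro tendsto_intros, blast)
    have [measurable]: "(\<lambda>\<zeta>. F (of_real (radii m) * \<zeta>)) \<in> borel_measurable \<mu>" for m
      by (rule measurable_radii[OF Fh])
    show "(\<lambda>\<zeta>. boundary F \<zeta> * cnj (F (of_real (radii m) * \<zeta>))) \<in> borel_measurable \<mu>" for m by measurable
  qed (use a in \<open>auto simp: integrable_poisson\<close>)
  moreover have "(\<integral>\<zeta>. of_real (poisson a \<zeta>) * (boundary F \<zeta> * cnj (boundary F \<zeta>)) \<partial>\<mu>)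
      = (\<integral>\<zeta>. complex_of_real (poisson a \<zeta>) \<partial>\<mu>)"
  proof (rule integral_cong_AE)
    show "AE \<zeta> in \<mu>. of_real (poisson a \<zeta>) * (boundary F \<zeta> * cnj (boundary F \<zeta>)) = complex_of_real (poisson a \<zeta>)"
      using F(2) by eventually_elim (simp flip: complex_norm_square)
  qed measurable
  ultimately have "A \<longlonglongrightarrow> 1" by (simp add: integral_poisson[OF a])
  from tendsto_norm[OF this] have "(\<lambda>m. norm (A m)) \<longlonglongrightarrow> 1" by simp
  \<comment> \<open>A mean of at least 1 together with \<open>norm (H \<zeta>) \<le> 1\<close>
    forces equality almost everywhere.\<close>
  then have ge: "1 \<le> (\<integral>\<zeta>. poisson 0 \<zeta> * norm (H \<zeta>) \<partial>\<mu>)"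
    by (rule LIMSEQ_le_const2) (use pair in auto)
  have i0: "integrable \<mu> (poisson 0)" by (rule integrable_poisson) simp
  have nonneg: "AE \<zeta> in \<mu>. 0 \<le> poisson 0 \<zeta> - poisson 0 \<zeta> * norm (H \<zeta>)"
    using H1 AE_poisson_pos[of 0, simplified]
    by eventually_elim (simp add: mult_left_le less_imp_le)
  have "(\<integral>\<zeta>. poisson 0 \<zeta> - poisson 0 \<zeta> * norm (H \<zeta>) \<partial>\<mu>) \<le> 0"
    using ge iH i0 integral_poisson[of 0] by simp
  moreover have "(\<integral>\<zeta>. poisson 0 \<zeta> - poisson 0 \<zeta> * norm (H \<zeta>) \<partial>\<mu>) \<ge> 0"
    by (rule Bochner_Integration.integral_nonneg_AE[OF nonneg])
  ultimately have "(\<integral>\<zeta>. poisson 0 \<zeta> - poisson 0 \<zeta> * norm (H \<zeta>) \<partial>\<mu>) = 0" by simp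
  then have "AE \<zeta> in \<mu>. poisson 0 \<zeta> - poisson 0 \<zeta> * norm (H \<zeta>) = 0"
    using integral_nonneg_eq_0_iff_AE[OF Bochner_Integration.integrable_diff[OF i0 iH] nonneg] by simp
  then show ?thesis using AE_poisson_pos[of 0, simplified]
    unfolding H_def by eventually_elim simp
qed

text \<open>For fixed \<open>\<eta>\<close> the kernel \<open>poisson u \<eta>\<close> is the real
  part of a holomorphic function of \<open>u\<close>, so its composition with \<open>\<phi>\<close>
  is harmonic. The dilation extends it past the closed disc, where the Poisson formula
  applies.\<close>

lemma poisson_average:
  assumes \<phi>: "\<phi> holomorphic_on \<bbbD>" "\<phi> ` \<bbbD> \<subseteq> \<bbbD>" and p: "norm p < 1" and \<eta>: "norm \<eta> = 1"
  shows "(\<integral>\<zeta>. poisson p \<zeta> * poisson (\<phi> (of_real (radii m) * \<zeta>)) \<eta> \<partial>\<mu>)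
       = poisson (\<phi> (of_real (radii m) * p)) \<eta>"
proof -
  define G where "G z = (1 + cnj \<eta> * \<phi> (of_real (radii m) * z)) / (1 - cnj \<eta> * \<phi> (of_real (radii m) * z))" for z
  have in_disc: "of_real (radii m) * z \<in> \<bbbD>" if "z \<in> ball 0 (1 / radii m)" for z :: complex
    using that radii(1)[of m] by (simp add: norm_mult field_simps)
  have \<phi>n: "norm (\<phi> u) < 1" if "u \<in> \<bbbD>" for u using \<phi>(2) that by (auto simp: image_subset_iff)
  have nz: "1 - cnj \<eta> * u \<noteq> 0" if "norm u < 1" for u
  proof
    assume "1 - cnj \<eta> * u = 0"
    then have "norm (cnj \<eta> * u) = 1" by simp
    then show False using that \<eta> by (simp add: norm_mult)
  qed
  have G: "G holomorphic_on ball 0 (1 / radii m)"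
  proof -
    have "(\<lambda>z. \<phi> (of_real (radii m) * z)) holomorphic_on ball 0 (1 / radii m)"
      by (rule holomorphic_on_compose_gen[OF _ \<phi>(1), of "\<lambda>z. of_real (radii m) * z", unfolded comp_def])
         (auto intro!: holomorphic_intros in_disc simp del: mem_ball)
    then show ?thesis unfolding G_def using nz \<phi>n in_disc by (intro holomorphic_intros) auto
  qed
  have pk: "poisson u \<eta> = Re ((1 + cnj \<eta> * u) / (1 - cnj \<eta> * u)) / (2 * pi)" if "norm u < 1" for u
  proof -
    \<comment> \<open>The kernel of \<open>poisson_Re\<close> is holomorphic in the circle variable;
      conjugation keeps the real part and makes it holomorphic in the disc variable.\<close>
    have "(1 + cnj u * \<eta>) / (1 - cnj u * \<eta>) = cnj ((1 + cnj \<eta> * u) / (1 - cnj \<eta> * u))"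
      by (simp add: mult.commute)
    then have "2 * pi * poisson u \<eta> = Re ((1 + cnj \<eta> * u) / (1 - cnj \<eta> * u))"
      unfolding poisson_Re[OF that \<eta>] by (simp only: cnj.simps)
    then show ?thesis by (metis nonzero_mult_div_cancel_left pi_neq_zero mult_eq_0_iff zero_neq_numeral)
  qed
  have R: "1 / radii m > 1" using radii(1,2)[of m] by simp
  have I: "(\<integral>\<zeta>. of_real (poisson p \<zeta>) * G \<zeta> \<partial>\<mu>) = G p"
    by (rule poisson_integral_disc[OF G R p])
  have Gc: "continuous_on (sphere 0 1) G"
    by (intro holomorphic_on_imp_continuous_on holomorphic_on_subset[OF G]) (use R in auto)
  from continuous_circle_bounded[OF Gc]
  obtain B where B: "\<And>\<zeta>. norm \<zeta> = 1 \<Longrightarrow> norm (G \<zeta>) \<le> B" by blast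
  have int: "integrable \<mu> (\<lambda>\<zeta>. of_real (poisson p \<zeta>) * G \<zeta>)"
    by (rule integrable_mult_bounded[OF borel_measurable_circle_continuous[OF Gc] _ integrable_poisson[OF p], of B])
       (use AE_circle_norm in eventually_elim, rule B)
  have "(\<integral>\<zeta>. poisson p \<zeta> * poisson (\<phi> (of_real (radii m) * \<zeta>)) \<eta> \<partial>\<mu>)
      = (\<integral>\<zeta>. Re (of_real (poisson p \<zeta>) * G \<zeta>) / (2 * pi) \<partial>\<mu>)"
  proof (rule Bochner_Integration.integral_cong[OF refl])
    fix \<zeta> assume "\<zeta> \<in> space \<mu>"
    then have "norm \<zeta> = 1" by (simp add: space_circle_measure)
    then have "norm (\<phi> (of_real (radii m) * \<zeta>)) < 1" by (intro \<phi>n radii_mult_disc) simp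
    from pk[OF this, folded G_def] show "poisson p \<zeta> * poisson (\<phi> (of_real (radii m) * \<zeta>)) \<eta>
        = Re (of_real (poisson p \<zeta>) * G \<zeta>) / (2 * pi)"
    proof -
      assume "poisson (\<phi> (of_real (radii m) * \<zeta>)) \<eta> = Re (G \<zeta>) / (2 * pi)"
      then show ?thesis by simp
    qed
  qed
  also have "\<dots> = Re (G p) / (2 * pi)" using integral_Re[OF int] I by simp
  also have "\<dots> = poisson (\<phi> (of_real (radii m) * p)) \<eta>"
    unfolding G_def using p by (intro pk[symmetric] \<phi>n radii_mult_disc) simp
  finally show ?thesis .
qed

lemma continuous_poisson_integral:
  assumes w: "w \<in> borel_measurable \<mu>" "AE \<eta> in \<mu>. norm (w \<eta>) \<le> (B::real)"
    and z: "norm z < 1" and lim: "x \<longlonglongrightarrow> z"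
  shows "(\<lambda>n. \<integral>\<eta>. poisson (x n) \<eta> * w \<eta> \<partial>\<mu>) \<longlonglongrightarrow> (\<integral>\<eta>. poisson z \<eta> * w \<eta> \<partial>\<mu>)"
proof -
  note [measurable] = w(1)
  define \<rho> where "\<rho> = (1 + norm z) / 2"
  have \<rho>: "norm z < \<rho>" "\<rho> < 1" using z by (auto simp: \<rho>_def)
  have "eventually (\<lambda>n. norm (x n) < \<rho>) sequentially"
    using order_tendstoD(2)[OF tendsto_norm[OF lim] \<rho>(1)] .
  then obtain N where N: "norm (x (n + N)) < \<rho>" for n unfolding eventually_sequentially by (metis le_add2)
  have "(\<lambda>n. \<integral>\<eta>. poisson (x (n + N)) \<eta> * w \<eta> \<partial>\<mu>) \<longlonglongrightarrow> (\<integral>\<eta>. poisson z \<eta> * w \<eta> \<partial>\<mu>)"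
  proof (rule integral_dominated_convergence[where w = "\<lambda>_. 2 / (2 * pi * (1 - \<rho>)) * B"])
    show "AE \<eta> in \<mu>. norm (poisson (x (n + N)) \<eta> * w \<eta>) \<le> 2 / (2 * pi * (1 - \<rho>)) * B" for n
      using w(2) AE_circle_norm
    proof eventually_elim
      case (elim \<eta>)
      have x1: "norm (x (n + N)) < 1" using N[of n] \<rho> by simp
      note b = poisson_bounds[OF x1 elim(2)]
      have "poisson (x (n + N)) \<eta> \<le> 2 / (2 * pi * (1 - \<rho>))"
        using N[of n] \<rho> x1 by (intro order_trans[OF b(2)] frac_le) auto
      then have "\<bar>poisson (x (n + N)) \<eta>\<bar> * \<bar>w \<eta>\<bar> \<le> 2 / (2 * pi * (1 - \<rho>)) * B"
        using b(3) elim(1) \<rho> by (intro mult_mono) auto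
      then show ?case by (simp add: abs_mult)
    qed
    show "AE \<eta> in \<mu>. (\<lambda>n. poisson (x (n + N)) \<eta> * w \<eta>) \<longlonglongrightarrow> poisson z \<eta> * w \<eta>"
      using AE_circle_norm
    proof eventually_elim
      case (elim \<eta>)
      then have "\<eta> \<noteq> z" using z by auto
      then show ?case unfolding poisson_def
        by (intro tendsto_intros LIMSEQ_ignore_initial_segment[OF lim]) auto
    qed
  qed (auto)
  then show ?thesis by (rule LIMSEQ_offset)
qed

lemma poisson_integral_le:
  assumes w: "w \<in> borel_measurable \<mu>" "AE \<eta> in \<mu>. 0 \<le> w \<eta> \<and> w \<eta> \<le> (B::real)" and z: "norm z < 1"
  shows "0 \<le> (\<integral>\<eta>. poisson z \<eta> * w \<eta> \<partial>\<mu>)" "(\<integral>\<eta>. poisson z \<eta> * w \<eta> \<partial>\<mu>) \<le> B"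
proof -
  show "0 \<le> (\<integral>\<eta>. poisson z \<eta> * w \<eta> \<partial>\<mu>)"
    by (rule Bochner_Integration.integral_nonneg_AE)
       (use w(2) AE_poisson_pos[OF z] in eventually_elim, auto intro: less_imp_le)
  have i: "integrable \<mu> (\<lambda>\<eta>. poisson z \<eta> * w \<eta>)"
  proof -
    have "AE \<eta> in \<mu>. norm (w \<eta>) \<le> B" using w(2) by eventually_elim auto
    from integrable_poisson_mult[OF w(1) this z] show ?thesis .
  qed
  have "(\<integral>\<eta>. poisson z \<eta> * w \<eta> \<partial>\<mu>) \<le> (\<integral>\<eta>. poisson z \<eta> * B \<partial>\<mu>)"
    by (rule integral_mono_AE[OF i integrable_mult_left[OF integrable_poisson[OF z]]])
       (use w(2) AE_poisson_pos[OF z] in eventually_elim, auto intro: mult_left_mono less_imp_le)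
  then show "(\<integral>\<eta>. poisson z \<eta> * w \<eta> \<partial>\<mu>) \<le> B"
    by (simp add: integral_poisson[OF z])
qed

lemma poisson_integral_borel:
  assumes [measurable]: "w \<in> borel_measurable \<mu>"
  shows "(\<lambda>z. \<integral>\<eta>. poisson z \<eta> * (w \<eta> :: real) \<partial>\<mu>) \<in> borel_measurable borel"
proof (rule circle.borel_measurable_lebesgue_integral)
  have [measurable]: "(\<lambda>x. snd x) \<in> borel_measurable (borel \<Otimes>\<^sub>M \<mu>)" 
    by (rule measurable_compose[OF measurable_snd id_measurable_circle])
  show "(\<lambda>(z, \<eta>). poisson z \<eta> * w \<eta>) \<in> borel_measurable (borel \<Otimes>\<^sub>M \<mu>)"
    unfolding case_prod_beta by measurable
qed

text \<open>Fubini reduces the claim from the Poisson integral of \<open>w\<close> to the kernel,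
  that is to \<open>poisson_average\<close>. On the circle the dilated map stays in a smaller closed
  disc, where the kernel is bounded; this makes the double integrand integrable.\<close>

lemma poisson_integral_fubini:
  assumes \<phi>: "\<phi> holomorphic_on \<bbbD>" "\<phi> ` \<bbbD> \<subseteq> \<bbbD>" and p: "norm p < 1"
    and w[measurable]: "w \<in> borel_measurable \<mu>"
    and wB: "AE \<eta> in \<mu>. norm (w \<eta>) \<le> (B::real)" and B: "B \<ge> 0"
  shows "(\<integral>\<zeta>. poisson p \<zeta> * (\<integral>\<eta>. poisson (\<phi> (of_real (radii m) * \<zeta>)) \<eta> * w \<eta> \<partial>\<mu>) \<partial>\<mu>)
     = (\<integral>\<eta>. poisson (\<phi> (of_real (radii m) * p)) \<eta> * w \<eta> \<partial>\<mu>)"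
proof -
  interpret pair_sigma_finite \<mu> \<mu> ..
  define f where "f \<zeta> \<eta> = poisson p \<zeta> * (poisson (\<phi> (of_real (radii m) * \<zeta>)) \<eta> * w \<eta>)" for \<zeta> \<eta>
  have \<phi>n: "norm (\<phi> u) < 1" if "u \<in> \<bbbD>" for u using \<phi>(2) that by (auto simp: image_subset_iff)
  have [measurable]: "(\<lambda>\<zeta>. \<phi> (of_real (radii m) * \<zeta>)) \<in> borel_measurable \<mu>"
    by (rule measurable_radii[OF \<phi>(1)])
  have [measurable]: "(\<lambda>x. snd x) \<in> borel_measurable (\<mu> \<Otimes>\<^sub>M \<mu>)"
    "(\<lambda>x. fst x) \<in> borel_measurable (\<mu> \<Otimes>\<^sub>M \<mu>)"
    by (auto intro: measurable_compose[OF measurable_snd id_measurable_circle] measurable_compose[OF measurable_fst id_measurable_circle])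
  have [measurable]: "(\<lambda>x. \<phi> (of_real (radii m) * fst x)) \<in> borel_measurable (\<mu> \<Otimes>\<^sub>M \<mu>)"
    by (rule measurable_compose[OF measurable_fst measurable_radii[OF \<phi>(1)]])
  have [measurable]: "case_prod f \<in> borel_measurable (\<mu> \<Otimes>\<^sub>M \<mu>)"
    unfolding f_def case_prod_beta by measurable
  have "continuous_on (sphere 0 1) (\<lambda>\<zeta>. norm (\<phi> (of_real (radii m) * \<zeta>)))"
    by (intro continuous_intros continuous_on_radii holomorphic_on_imp_continuous_on \<phi>)
  then obtain \<zeta>0 where \<zeta>0: "\<zeta>0 \<in> sphere 0 1" "\<And>\<zeta>. \<zeta> \<in> sphere 0 1 \<Longrightarrow> norm (\<phi> (of_real (radii m) * \<zeta>)) \<le> norm (\<phi> (of_real (radii m) * \<zeta>0))"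
    using continuous_attains_sup[of "sphere (0::complex) 1"] by (metis compact_sphere mem_sphere_0 norm_one empty_iff)
  define \<rho> where "\<rho> = norm (\<phi> (of_real (radii m) * \<zeta>0))"
  have \<rho>: "\<rho> < 1" unfolding \<rho>_def using \<zeta>0(1) by (intro \<phi>n radii_mult_disc) simp
  have bound: "norm (poisson (\<phi> (of_real (radii m) * \<zeta>)) \<eta>) \<le> 2 / (2 * pi * (1 - \<rho>))"
    if "norm \<zeta> = 1" "norm \<eta> = 1" for \<zeta> \<eta>
  proof -
    have x1: "norm (\<phi> (of_real (radii m) * \<zeta>)) < 1" using that by (intro \<phi>n radii_mult_disc) simp
    have x2: "norm (\<phi> (of_real (radii m) * \<zeta>)) \<le> \<rho>" using \<zeta>0(2) that by (simp add: \<rho>_def)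
    note b = poisson_bounds[OF x1 that(2)]
    have "poisson (\<phi> (of_real (radii m) * \<zeta>)) \<eta> \<le> 2 / (2 * pi * (1 - \<rho>))"
      using x1 x2 \<rho> by (intro order_trans[OF b(2)] frac_le) auto
    then show ?thesis using b(3) by simp
  qed
  have "integrable (\<mu> \<Otimes>\<^sub>M \<mu>) (case_prod f)"
  proof (rule Fubini_integrable)
    have in1: "(\<integral>\<eta>. norm (f \<zeta> \<eta>) \<partial>\<mu>) \<le> poisson p \<zeta> * (2 / (2 * pi * (1 - \<rho>)) * B * (2 * pi))"
      if "norm \<zeta> = 1" for \<zeta>
    proof -
      have "(\<integral>\<eta>. norm (f \<zeta> \<eta>) \<partial>\<mu>) \<le> (\<integral>\<eta>. poisson p \<zeta> * (2 / (2 * pi * (1 - \<rho>)) * B) \<partial>\<mu>)"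
      proof (rule integral_mono_AE')
        show "AE \<eta> in \<mu>. norm (f \<zeta> \<eta>) \<le> poisson p \<zeta> * (2 / (2 * pi * (1 - \<rho>)) * B)"
          using wB AE_circle_norm
        proof eventually_elim
          case (elim \<eta>)
          have "norm (f \<zeta> \<eta>) = poisson p \<zeta> * (norm (poisson (\<phi> (of_real (radii m) * \<zeta>)) \<eta>) * norm (w \<eta>))"
            unfolding f_def using poisson_bounds(3)[OF p that] by (simp add: abs_mult)
          also have "\<dots> \<le> poisson p \<zeta> * (2 / (2 * pi * (1 - \<rho>)) * B)"
            using poisson_bounds(3)[OF p that] elim bound[OF that elim(2)] \<rho> by (intro mult_left_mono mult_mono) auto
          finally show ?case .
        qed
        show "AE \<eta> in \<mu>. 0 \<le> poisson p \<zeta> * (2 / (2 * pi * (1 - \<rho>)) * B)"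
          using poisson_bounds(3)[OF p that] \<rho> B by (intro AE_I2 mult_nonneg_nonneg divide_nonneg_nonneg) auto
      qed auto
      then show ?thesis by (simp add: measure_circle_space mult_ac)
    qed
    show "integrable \<mu> (\<lambda>\<zeta>. \<integral>\<eta>. norm (case (\<zeta>, \<eta>) of (x, y) \<Rightarrow> f x y) \<partial>\<mu>)"
    proof (rule Bochner_Integration.integrable_bound)
      show "integrable \<mu> (\<lambda>\<zeta>. poisson p \<zeta> * (2 / (2 * pi * (1 - \<rho>)) * B * (2 * pi)))"
        using integrable_poisson[OF p] by (rule integrable_mult_left)
      show "AE \<zeta> in \<mu>. norm (\<integral>\<eta>. norm (case (\<zeta>, \<eta>) of (x, y) \<Rightarrow> f x y) \<partial>\<mu>)
          \<le> norm (poisson p \<zeta> * (2 / (2 * pi * (1 - \<rho>)) * B * (2 * pi)))"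
        using AE_circle_norm
      proof eventually_elim
        case (elim \<zeta>)
        have "(\<integral>\<eta>. norm (f \<zeta> \<eta>) \<partial>\<mu>) \<ge> 0" by simp
        then have "norm (\<integral>\<eta>. norm (f \<zeta> \<eta>) \<partial>\<mu>)
            \<le> poisson p \<zeta> * (2 / (2 * pi * (1 - \<rho>)) * B * (2 * pi))"
          using in1[OF elim] by (simp only: real_norm_def abs_of_nonneg)
        then show ?case unfolding prod.case real_norm_def by (rule order_trans[OF _ abs_ge_self])
      qed
    qed measurable
    show "AE \<zeta> in \<mu>. integrable \<mu> (\<lambda>\<eta>. case (\<zeta>, \<eta>) of (x, y) \<Rightarrow> f x y)"
      using AE_circle_norm
    proof eventually_elim
      case (elim \<zeta>)
      have "integrable \<mu> (\<lambda>\<eta>. of_real (poisson (\<phi> (of_real (radii m) * \<zeta>)) \<eta>) * w \<eta>)"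
        using elim by (intro integrable_mult_bounded[OF w wB] integrable_poisson \<phi>n radii_mult_disc) simp
      then have "integrable \<mu> (\<lambda>\<eta>. poisson p \<zeta> * (poisson (\<phi> (of_real (radii m) * \<zeta>)) \<eta> * w \<eta>))"
        by simp
      then show ?case by (simp add: f_def)
    qed
  qed measurable
  from Fubini_integral[OF this]
  have "(\<integral>\<zeta>. (\<integral>\<eta>. f \<zeta> \<eta> \<partial>\<mu>) \<partial>\<mu>) = (\<integral>\<eta>. (\<integral>\<zeta>. f \<zeta> \<eta> \<partial>\<mu>) \<partial>\<mu>)"
    by simp
  moreover have "(\<integral>\<zeta>. f \<zeta> \<eta> \<partial>\<mu>) = poisson (\<phi> (of_real (radii m) * p)) \<eta> * w \<eta>" if "norm \<eta> = 1" for \<eta>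
  proof -
    have "(\<integral>\<zeta>. f \<zeta> \<eta> \<partial>\<mu>) = (\<integral>\<zeta>. poisson p \<zeta> * poisson (\<phi> (of_real (radii m) * \<zeta>)) \<eta> * w \<eta> \<partial>\<mu>)"
      by (simp add: f_def mult.assoc)
    then show ?thesis by (simp add: poisson_average[OF \<phi> p that])
  qed
  then have "(\<integral>\<eta>. (\<integral>\<zeta>. f \<zeta> \<eta> \<partial>\<mu>) \<partial>\<mu>)
      = (\<integral>\<eta>. poisson (\<phi> (of_real (radii m) * p)) \<eta> * w \<eta> \<partial>\<mu>)"
    by (intro Bochner_Integration.integral_cong[OF refl]) (simp add: space_circle_measure)
  ultimately show ?thesis by (simp add: f_def)
qed

subsection \<open>Iterates on the boundary\<close>

lemma iterate_self_map:
  assumes "analytic_self_map \<phi>"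
  shows "(\<phi> ^^ n) holomorphic_on \<bbbD>" "(\<phi> ^^ n) ` \<bbbD> \<subseteq> \<bbbD>" "bounded_holomorphic (\<phi> ^^ n) 1"
proof -
  show im: "(\<phi> ^^ n) ` \<bbbD> \<subseteq> \<bbbD>" for n using funpow_disc[OF assms] by blast
  show hol: "(\<phi> ^^ n) holomorphic_on \<bbbD>"
  proof (induction n)
    case (Suc n)
    then show ?case
      using holomorphic_on_compose_gen[OF Suc, of \<phi> \<bbbD>] im[of n] assms
      unfolding analytic_self_map_def funpow.simps by blast
  qed (simp add: id_def)
  show "bounded_holomorphic (\<phi> ^^ n) 1"
    using hol im[of n] by (force simp: bounded_holomorphic_def image_subset_iff)
qed

text \<open>Integrate the nonnegative defect \<open>U - |f|\<^sup>2\<close>, where \<open>U\<close> is the Poisson integral of \<open>|f\<^sup>*|\<^sup>2\<close>,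
  along \<open>\<phi>\<close>: harmonicity of \<open>U\<close> evaluates the integral, and dominated convergence keeps the part where
  \<open>\<phi>\<^sup>*\<close> lies in the disc.\<close>

lemma boundary_energy_decrease:
  assumes \<phi>: "\<phi> holomorphic_on \<bbbD>" "\<phi> ` \<bbbD> \<subseteq> \<bbbD>" and p: "norm p < 1" "\<phi> p = p" and f: "bounded_holomorphic f B" "B \<ge> 0"
  defines "U \<equiv> \<lambda>z. \<integral>\<eta>. poisson z \<eta> * norm (boundary f \<eta>) ^ 2 \<partial>\<mu>"
  defines "E \<equiv> {\<zeta>. norm (boundary \<phi> \<zeta>) < 1}"
  shows "(\<integral>\<zeta>. poisson p \<zeta> * norm (boundary (\<lambda>z. f (\<phi> z)) \<zeta>) ^ 2 \<partial>\<mu>)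
    + (\<integral>\<zeta>. poisson p \<zeta> * (indicator E \<zeta> * (U (boundary \<phi> \<zeta>) - norm (boundary (\<lambda>z. f (\<phi> z)) \<zeta>) ^ 2)) \<partial>\<mu>)
    \<le> U p"
proof -
  have fh: "f holomorphic_on \<bbbD>" and fB: "\<And>z. z \<in> \<bbbD> \<Longrightarrow> norm (f z) \<le> B" using f by (auto simp: bounded_holomorphic_def)
  note f\<phi> = bounded_holomorphic_comp[OF f(1) \<phi>]
  define H where "H = boundary (\<lambda>z. f (\<phi> z))"
  define w where "w \<eta> = norm (boundary f \<eta>) ^ 2" for \<eta>
  have \<phi>1: "bounded_holomorphic \<phi> 1" using bounded_holomorphic_power[OF \<phi>, of 1] by simp
  have \<phi>n: "norm (\<phi> u) < 1" if "u \<in> \<bbbD>" for u using \<phi>(2) that by (auto simp: image_subset_iff)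
  have [measurable]: "boundary \<phi> \<in> borel_measurable \<mu>" "boundary f \<in> borel_measurable \<mu>"
    "H \<in> borel_measurable \<mu>"
    unfolding H_def using \<phi> fh f\<phi> by (auto intro!: boundary_measurable simp: bounded_holomorphic_def)
  have w[measurable]: "w \<in> borel_measurable \<mu>" unfolding w_def by measurable
  have wB: "AE \<eta> in \<mu>. 0 \<le> w \<eta> \<and> w \<eta> \<le> B ^ 2"
    using AE_boundary_le[OF f(1)] by eventually_elim (auto simp: w_def intro!: power_mono)
  have wB': "AE \<eta> in \<mu>. norm (w \<eta>) \<le> B ^ 2" using wB by eventually_elim auto
  have U_eq: "U = (\<lambda>z. \<integral>\<eta>. poisson z \<eta> * w \<eta> \<partial>\<mu>)" by (simp add: U_def w_def)
  have U_meas[measurable]: "U \<in> borel_measurable borel" unfolding U_eq by (rule poisson_integral_borel[OF w])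
  have U_bd: "0 \<le> U z" "U z \<le> B ^ 2" if "norm z < 1" for z
    unfolding U_eq by (rule poisson_integral_le[OF w wB that])+
  have U_lim: "(\<lambda>n. U (x n)) \<longlonglongrightarrow> U z" if "norm z < 1" "x \<longlonglongrightarrow> z" for x z
    unfolding U_eq by (rule continuous_poisson_integral[OF w wB' that])
  have defect: "norm (f z) ^ 2 \<le> U z" if "norm z < 1" for z
    unfolding U_def by (rule poisson_boundary_defect[OF f(1) that])
  let ?\<phi> = "\<lambda>m \<zeta>. \<phi> (of_real (radii m) * \<zeta>)"
  have [measurable]: "?\<phi> m \<in> borel_measurable \<mu>" for m by (rule measurable_radii[OF \<phi>(1)])
  have [measurable]: "(\<lambda>\<zeta>. f (?\<phi> m \<zeta>)) \<in> borel_measurable \<mu>" for m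
    using f\<phi> by (intro measurable_radii[of "\<lambda>z. f (\<phi> z)"]) (simp add: bounded_holomorphic_def)
  have \<phi>m: "norm (?\<phi> m \<zeta>) < 1" if "norm \<zeta> = 1" for m \<zeta> using that by (intro \<phi>n radii_mult_disc) simp
  have ik: "integrable \<mu> (poisson p)" by (rule integrable_poisson[OF p(1)])
  define D where "D m \<zeta> = U (?\<phi> m \<zeta>) - norm (f (?\<phi> m \<zeta>)) ^ 2" for m \<zeta>
  have D_bd: "0 \<le> D m \<zeta>" "D m \<zeta> \<le> B ^ 2" if "norm \<zeta> = 1" for m \<zeta>
    using defect[OF \<phi>m[OF that], of m] U_bd[OF \<phi>m[OF that], of m] zero_le_power2[of "norm (f (?\<phi> m \<zeta>))"]
    unfolding D_def by linarith+
  have [measurable]: "D m \<in> borel_measurable \<mu>" for m unfolding D_def by measurable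
  have Em[measurable]: "(\<lambda>\<zeta>. indicator E \<zeta> :: real) \<in> borel_measurable \<mu>"
  proof -
    have "indicator E = (\<lambda>\<zeta>. if norm (boundary \<phi> \<zeta>) < 1 then 1 else 0 :: real)" by (auto simp: E_def indicator_def)
    then show ?thesis by simp
  qed
  note int_bd = integrable_poisson_mult[where B = "B ^ 2", OF _ _ p(1)]
  have fub: "(\<integral>\<zeta>. poisson p \<zeta> * U (?\<phi> m \<zeta>) \<partial>\<mu>) = U (?\<phi> m p)" for m
    unfolding U_eq by (rule poisson_integral_fubini[OF \<phi> p(1) w wB']) simp
  have f\<phi>B: "AE \<zeta> in \<mu>. norm (norm (f (?\<phi> m \<zeta>)) ^ 2) \<le> B ^ 2" for m
    using AE_circle_norm by eventually_elim (use fB \<phi>m in \<open>auto intro!: power_mono\<close>)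
  have step: "(\<integral>\<zeta>. poisson p \<zeta> * norm (f (?\<phi> m \<zeta>)) ^ 2 \<partial>\<mu>)
      + (\<integral>\<zeta>. poisson p \<zeta> * (indicator E \<zeta> * D m \<zeta>) \<partial>\<mu>) \<le> U (?\<phi> m p)" for m
  proof -
    have i1: "integrable \<mu> (\<lambda>\<zeta>. poisson p \<zeta> * norm (f (?\<phi> m \<zeta>)) ^ 2)"
      by (rule int_bd[OF _ f\<phi>B]) measurable
    have i2: "integrable \<mu> (\<lambda>\<zeta>. poisson p \<zeta> * (indicator E \<zeta> * D m \<zeta>))"
    proof (rule int_bd)
      show "AE \<zeta> in \<mu>. norm (indicator E \<zeta> * D m \<zeta>) \<le> B ^ 2"
        using AE_circle_norm by eventually_elim (use D_bd in \<open>auto simp: indicator_def\<close>)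
    qed measurable
    have i3: "integrable \<mu> (\<lambda>\<zeta>. poisson p \<zeta> * D m \<zeta>)"
    proof (rule int_bd)
      show "AE \<zeta> in \<mu>. norm (D m \<zeta>) \<le> B ^ 2"
        using AE_circle_norm by eventually_elim (use D_bd in auto)
    qed measurable
    \<comment> \<open>Continuity of \<open>U\<close> is available only inside the disc, so off
      \<open>E\<close> the limit of the defect is not controlled. That part is nonnegative and is
      dropped, which leaves an inequality.\<close>
    have "(\<integral>\<zeta>. poisson p \<zeta> * (indicator E \<zeta> * D m \<zeta>) \<partial>\<mu>) \<le> (\<integral>\<zeta>. poisson p \<zeta> * D m \<zeta> \<partial>\<mu>)"
      by (rule integral_mono_AE[OF i2 i3])
         (use AE_circle_norm AE_poisson_pos[OF p(1)] in eventually_elim, use D_bd in \<open>auto simp: indicator_def\<close>)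
    moreover have "(\<integral>\<zeta>. poisson p \<zeta> * norm (f (?\<phi> m \<zeta>)) ^ 2 \<partial>\<mu>) + (\<integral>\<zeta>. poisson p \<zeta> * D m \<zeta> \<partial>\<mu>)
        = (\<integral>\<zeta>. poisson p \<zeta> * U (?\<phi> m \<zeta>) \<partial>\<mu>)"
      unfolding Bochner_Integration.integral_add[OF i1 i3, symmetric] by (simp add: D_def right_diff_distrib)
    ultimately show ?thesis unfolding fub by linarith
  qed
  have lim1: "(\<lambda>m. \<integral>\<zeta>. poisson p \<zeta> * norm (f (?\<phi> m \<zeta>)) ^ 2 \<partial>\<mu>)
      \<longlonglongrightarrow> (\<integral>\<zeta>. poisson p \<zeta> * norm (H \<zeta>) ^ 2 \<partial>\<mu>)"
  proof -
    have "AE \<zeta> in \<mu>. (\<lambda>m. norm (f (?\<phi> m \<zeta>)) ^ 2) \<longlonglongrightarrow> norm (H \<zeta>) ^ 2"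
      using AE_boundary[OF f\<phi>] unfolding H_def by eventually_elim (intro tendsto_intros, blast)
    from weighted_dominated_convergence[OF _ f\<phi>B _ this ik] show ?thesis by simp
  qed
  have lim2: "(\<lambda>m. \<integral>\<zeta>. poisson p \<zeta> * (indicator E \<zeta> * D m \<zeta>) \<partial>\<mu>)
      \<longlonglongrightarrow> (\<integral>\<zeta>. poisson p \<zeta> * (indicator E \<zeta> * (U (boundary \<phi> \<zeta>) - norm (H \<zeta>) ^ 2)) \<partial>\<mu>)"
  proof -
    have "AE \<zeta> in \<mu>. (\<lambda>m. indicator E \<zeta> * D m \<zeta>) \<longlonglongrightarrow> indicator E \<zeta> * (U (boundary \<phi> \<zeta>) - norm (H \<zeta>) ^ 2)"
      using AE_boundary[OF f\<phi>] AE_boundary[OF \<phi>1]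
    proof eventually_elim
      case (elim \<zeta>)
      show ?case
      proof (cases "\<zeta> \<in> E")
        case True
        then have "norm (boundary \<phi> \<zeta>) < 1" by (simp add: E_def)
        then have "(\<lambda>m. D m \<zeta>) \<longlonglongrightarrow> U (boundary \<phi> \<zeta>) - norm (H \<zeta>) ^ 2"
          unfolding D_def H_def using elim by (intro tendsto_intros U_lim) auto
        then show ?thesis using True by simp
      qed simp
    qed
    moreover have "AE \<zeta> in \<mu>. norm (indicator E \<zeta> * D m \<zeta>) \<le> B ^ 2" for m
      using AE_circle_norm by eventually_elim (use D_bd in \<open>auto simp: indicator_def\<close>)
    ultimately have "(\<lambda>m. \<integral>\<zeta>. of_real (poisson p \<zeta>) * (indicator E \<zeta> * D m \<zeta>) \<partial>\<mu>)
      \<longlonglongrightarrow> (\<integral>\<zeta>. of_real (poisson p \<zeta>) * (indicator E \<zeta> * (U (boundary \<phi> \<zeta>) - norm (H \<zeta>) ^ 2)) \<partial>\<mu>)"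
      by (intro weighted_dominated_convergence[where B = "B ^ 2"] ik) measurable
    then show ?thesis by simp
  qed
  \<comment> \<open>Here the fixed point enters: the averages tend to \<open>U (\<phi> p)\<close>,
    which is \<open>U p\<close> again.\<close>
  have lim3: "(\<lambda>m. U (?\<phi> m p)) \<longlonglongrightarrow> U p"
  proof (rule U_lim[OF p(1)])
    have "(\<lambda>m. of_real (radii m) * p) \<longlonglongrightarrow> p"
      using tendsto_mult[OF tendsto_of_real[OF radii(3)] tendsto_const[of p]] by simp
    then have "(\<lambda>m. ?\<phi> m p) \<longlonglongrightarrow> \<phi> p"
      by (rule continuous_on_tendsto_compose[OF holomorphic_on_imp_continuous_on[OF \<phi>(1)]])
         (use p radii_mult_disc[of p] in auto)
    then show "(\<lambda>m. ?\<phi> m p) \<longlonglongrightarrow> p" by (simp add: p)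
  qed
  show ?thesis
    using tendsto_le[OF sequentially_bot lim3 tendsto_add[OF lim1 lim2]] step by (simp add: H_def)
qed

text \<open>The lower kernel bound at \<open>a\<close> over the upper kernel bound at
  \<open>p\<close>. The energy argument asks only for a positive factor that depends measurably on
  \<open>a\<close>.\<close>

lemma Harnack_poisson:
  assumes "norm a < 1" "norm p < 1" "norm \<eta> = 1"
  shows "(1 - norm a) / (1 + norm a) * ((1 - norm p) / (1 + norm p)) * poisson p \<eta> \<le> poisson a \<eta>"
proof -
  have n: "0 < 1 - norm p" "0 < 1 + norm p" "0 < 1 + norm a" "0 < 1 - norm a"
    using assms by (auto intro: add_pos_nonneg)
  have "(1 - norm a) / (1 + norm a) * ((1 - norm p) / (1 + norm p)) * poisson p \<eta>
     \<le> (1 - norm a) / (1 + norm a) * ((1 - norm p) / (1 + norm p)) * ((1 + norm p) / (2 * pi * (1 - norm p)))"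
    using n poisson_bounds(2)[OF assms(2,3)] by (intro mult_left_mono) auto
  also have "\<dots> = (1 - norm a) / (2 * pi * (1 + norm a))" using n by simp
  also have "\<dots> \<le> poisson a \<eta>" by (rule poisson_bounds(1)[OF assms(1,3)])
  finally show ?thesis .
qed

section \<open>Convergence of boundary iterates to the Denjoy-Wolff point\<close>

lemma denjoy_wolff_pointwise:
  assumes "denjoy_wolff_point \<phi> p" "a \<in> \<bbbD>"
  shows "(\<lambda>n. (\<phi> ^^ n) a) \<longlonglongrightarrow> p"
proof -
  have "uniform_limit {a} (\<lambda>n. \<phi> ^^ n) (\<lambda>_. p) sequentially"
  proof -
    have "\<forall>K. compact K \<and> K \<subseteq> \<bbbD> \<longrightarrow> uniform_limit K (\<lambda>n. \<phi> ^^ n) (\<lambda>_. p) sequentially"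
      using assms(1) unfolding denjoy_wolff_point_def by (rule conjunct2)
    from spec[OF this, of "{a}"] show ?thesis by (rule mp) (use assms(2) in simp)
  qed
  then show ?thesis by (rule tendsto_uniform_limitI) simp
qed

lemma denjoy_wolff_unique: "denjoy_wolff_point \<phi> p \<Longrightarrow> denjoy_wolff_point \<phi> q \<Longrightarrow> p = q"
  using denjoy_wolff_pointwise[of \<phi> _ 0] LIMSEQ_unique by (metis centre_in_ball zero_less_one)

lemma AE_boundary_iterates:
  assumes "analytic_self_map \<phi>"
  shows "AE \<zeta> in \<mu>. \<forall>n. norm \<zeta> = 1 \<and> has_radial_limit (\<phi> ^^ n) \<zeta> (boundary (\<phi> ^^ n) \<zeta>) \<and>
     (\<lambda>m. (\<phi> ^^ n) (of_real (radii m) * \<zeta>)) \<longlonglongrightarrow> boundary (\<phi> ^^ n) \<zeta> \<and>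
     radial_boundary (\<phi> ^^ n) \<zeta> = boundary (\<phi> ^^ n) \<zeta> \<and> norm (boundary (\<phi> ^^ n) \<zeta>) \<le> 1"
  unfolding AE_all_countable using AE_boundary[OF iterate_self_map(3)[OF assms]] by blast

text \<open>From index \<open>k\<close> on, the boundary values form an ordinary orbit inside the
  disc.\<close>

lemma boundary_orbit_converges:
  assumes \<phi>: "analytic_self_map \<phi>" and p: "denjoy_wolff_point \<phi> p"
    and \<zeta>: "norm \<zeta> = 1" "(\<lambda>m. (\<phi> ^^ k) (of_real (radii m) * \<zeta>)) \<longlonglongrightarrow> boundary (\<phi> ^^ k) \<zeta>" "norm (boundary (\<phi> ^^ k) \<zeta>) < 1"
  shows "(\<lambda>n. boundary (\<phi> ^^ n) \<zeta>) \<longlonglongrightarrow> p"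
proof -
  have "boundary (\<phi> ^^ (n + k)) \<zeta> = (\<phi> ^^ n) (boundary (\<phi> ^^ k) \<zeta>)" for n
  proof -
    have "\<phi> ^^ (n + k) = (\<lambda>z. (\<phi> ^^ n) ((\<phi> ^^ k) z))" by (auto simp: funpow_add)
    then show ?thesis
      using boundary_comp[OF \<zeta>(2,3) iterate_self_map(1)[OF \<phi>, of n] funpow_disc[OF \<phi>] \<zeta>(1)] by simp
  qed
  then have "(\<lambda>n. boundary (\<phi> ^^ (n + k)) \<zeta>) \<longlonglongrightarrow> p"
    using denjoy_wolff_pointwise[OF p, of "boundary (\<phi> ^^ k) \<zeta>"] \<zeta>(3) by simp
  then show ?thesis by (rule LIMSEQ_offset)
qed

text \<open>The proportion lost by the energy \<open>V n\<close> comes from Harnack's inequality: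
  \<open>K\<close> is the mean over \<open>E\<close> of the factor \<open>\<kappa>\<close> at the
  boundary value of \<open>\<phi>\<close>, and it is positive because \<open>\<phi>\<close> is not
  inner. The error \<open>L n\<close> is the energy on \<open>E\<close> after the step; it tends to
  0 since boundary orbits starting in \<open>E\<close> run inside the disc.\<close>

lemma elliptic_not_inner:
  assumes \<phi>: "analytic_self_map \<phi>" and dw: "denjoy_wolff_point \<phi> p" and p: "norm p < 1"
    and ni: "\<not> (AE \<zeta> in \<mu>. norm (boundary \<phi> \<zeta>) = 1)"
  shows "AE \<zeta> in \<mu>. (\<lambda>n. boundary (\<phi> ^^ n) \<zeta>) \<longlonglongrightarrow> p"
proof -
  have \<phi>h: "\<phi> holomorphic_on \<bbbD>" "\<phi> ` \<bbbD> \<subseteq> \<bbbD>" using \<phi> by (auto simp: analytic_self_map_def)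
  have \<phi>1: "bounded_holomorphic \<phi> 1" using iterate_self_map(3)[OF \<phi>, of 1] by simp
  have fix_p: "\<phi> p = p"
  proof -
    have "(\<lambda>n. \<phi> ((\<phi> ^^ n) p)) \<longlonglongrightarrow> \<phi> p"
      by (rule continuous_on_tendsto_compose[OF holomorphic_on_imp_continuous_on[OF \<phi>h(1)] denjoy_wolff_pointwise[OF dw]])
         (use p funpow_disc[OF \<phi>, of p] in auto)
    moreover have "(\<lambda>n. \<phi> ((\<phi> ^^ n) p)) \<longlonglongrightarrow> p"
      using LIMSEQ_Suc[OF denjoy_wolff_pointwise[OF dw, of p]] p by simp
    ultimately show ?thesis by (rule LIMSEQ_unique)
  qed
  define f where "f n z = (\<phi> ^^ n) z - p" for n z
  have fb: "bounded_holomorphic (f n) 2" for n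
    unfolding bounded_holomorphic_def f_def
  proof (intro conjI ballI)
    show "(\<lambda>z. (\<phi> ^^ n) z - p) holomorphic_on \<bbbD>" by (intro holomorphic_intros iterate_self_map(1)[OF \<phi>])
    fix z assume "z \<in> \<bbbD>"
    then have "norm ((\<phi> ^^ n) z) < 1" using funpow_disc[OF \<phi>, of z n] by simp
    then show "norm ((\<phi> ^^ n) z - p) \<le> 2" using p norm_triangle_ineq4[of "(\<phi> ^^ n) z" p] by simp
  qed
  have f_Suc: "f (Suc n) = (\<lambda>z. f n (\<phi> z))" for n by (rule ext) (simp add: f_def funpow_swap1)
  have f_bd: "AE \<zeta> in \<mu>. \<forall>n. boundary (f n) \<zeta> = boundary (\<phi> ^^ n) \<zeta> - p"
    using AE_boundary_iterates[OF \<phi>]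
  proof eventually_elim
    case (elim \<zeta>)
    show ?case unfolding f_def by (intro allI boundary_eqI tendsto_intros) (use elim in blast)
  qed
  have [measurable]: "boundary (f n) \<in> borel_measurable \<mu>" for n
    using fb[of n] by (intro boundary_measurable) (simp add: bounded_holomorphic_def)
  have b\<phi>[measurable]: "boundary (\<phi> ^^ n) \<in> borel_measurable \<mu>" for n
    by (rule boundary_measurable[OF iterate_self_map(1)[OF \<phi>]])
  have [measurable]: "boundary \<phi> \<in> borel_measurable \<mu>" using b\<phi>[of 1] by simp
  define E where "E = {\<zeta>. norm (boundary \<phi> \<zeta>) < 1}"
  have Em[measurable]: "(\<lambda>\<zeta>. indicator E \<zeta> :: real) \<in> borel_measurable \<mu>"
  proof -
    have "indicator E = (\<lambda>\<zeta>. if norm (boundary \<phi> \<zeta>) < 1 then 1 else 0 :: real)" by (auto simp: E_def indicator_def)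
    then show ?thesis by simp
  qed
  define U where "U n z = (\<integral>\<eta>. poisson z \<eta> * norm (boundary (f n) \<eta>) ^ 2 \<partial>\<mu>)" for n z
  define V where "V n = U n p" for n
  have ik: "integrable \<mu> (poisson p)" by (rule integrable_poisson[OF p])
  have w4: "AE \<eta> in \<mu>. 0 \<le> norm (boundary (f n) \<eta>) ^ 2 \<and> norm (boundary (f n) \<eta>) ^ 2 \<le> 4" for n
    using AE_boundary_le[OF fb[of n]]
  proof eventually_elim
    case (elim \<zeta>)
    then show ?case using power_mono[OF elim, of 2] by simp
  qed
  have iU: "integrable \<mu> (\<lambda>\<eta>. poisson z \<eta> * norm (boundary (f n) \<eta>) ^ 2)" if "norm z < 1" for n z
  proof -
    have "AE \<eta> in \<mu>. norm (norm (boundary (f n) \<eta>) ^ 2) \<le> 4" using w4[of n] by eventually_elim simp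
    then show ?thesis by (intro integrable_poisson_mult that) measurable
  qed
  have U_bd: "0 \<le> U n z" "U n z \<le> 4" if "norm z < 1" for n z
    unfolding U_def by (rule poisson_integral_le[OF _ w4 that]; measurable)+
  have U_meas[measurable]: "U n \<in> borel_measurable borel" for n
    unfolding U_def by (rule poisson_integral_borel) measurable
  define \<kappa> where "\<kappa> a = (1 - norm a) / (1 + norm a) * ((1 - norm p) / (1 + norm p))" for a :: complex
  have \<kappa>_pos: "\<kappa> a > 0" if "norm a < 1" for a
    unfolding \<kappa>_def using that p by (intro mult_pos_pos divide_pos_pos) (auto intro: add_pos_nonneg)
  have \<kappa>_le: "\<kappa> a \<le> 1" if "norm a < 1" for a
  proof -
    have "(1 - norm a) / (1 + norm a) \<le> 1" "(1 - norm p) / (1 + norm p) \<le> 1" "(1 - norm p) / (1 + norm p) \<ge> 0"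
      using that p by (auto simp: divide_le_eq add_pos_nonneg)
    then show ?thesis unfolding \<kappa>_def using that by (intro mult_le_one) auto
  qed
  have \<kappa>_meas[measurable]: "\<kappa> \<in> borel_measurable borel" unfolding \<kappa>_def by measurable
  have harnack: "\<kappa> a * V n \<le> U n a" if a: "norm a < 1" for a n
  proof -
    have "\<kappa> a * V n = (\<integral>\<eta>. \<kappa> a * (poisson p \<eta> * norm (boundary (f n) \<eta>) ^ 2) \<partial>\<mu>)"
      by (simp add: V_def U_def)
    also have "\<dots> \<le> U n a" unfolding U_def
    proof (rule integral_mono_AE[OF integrable_mult_right[OF iU[OF p]] iU[OF a]])
      show "AE \<eta> in \<mu>. \<kappa> a * (poisson p \<eta> * norm (boundary (f n) \<eta>) ^ 2) \<le> poisson a \<eta> * norm (boundary (f n) \<eta>) ^ 2"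
        using AE_circle_norm
      proof eventually_elim
        case (elim \<eta>)
        show ?case using mult_right_mono[OF Harnack_poisson[OF a p elim], of "norm (boundary (f n) \<eta>) ^ 2"]
          by (simp add: \<kappa>_def mult.assoc)
      qed
    qed
    finally show ?thesis .
  qed
  define K where "K = (\<integral>\<zeta>. poisson p \<zeta> * (indicator E \<zeta> * \<kappa> (boundary \<phi> \<zeta>)) \<partial>\<mu>)"
  define L where "L n = (\<integral>\<zeta>. poisson p \<zeta> * (indicator E \<zeta> * norm (boundary (f (Suc n)) \<zeta>) ^ 2) \<partial>\<mu>)" for n
  note int_bd = integrable_poisson_mult[OF _ _ p]
  have iK: "integrable \<mu> (\<lambda>\<zeta>. poisson p \<zeta> * (indicator E \<zeta> * \<kappa> (boundary \<phi> \<zeta>)))"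
  proof (rule int_bd[where B = 1])
    show "AE \<zeta> in \<mu>. norm (indicator E \<zeta> * \<kappa> (boundary \<phi> \<zeta>)) \<le> 1"
    proof (rule AE_I2)
      fix \<zeta> show "norm (indicator E \<zeta> * \<kappa> (boundary \<phi> \<zeta>)) \<le> 1"
        using \<kappa>_pos[of "boundary \<phi> \<zeta>"] \<kappa>_le[of "boundary \<phi> \<zeta>"] by (auto simp: indicator_def E_def)
    qed
  qed measurable
  have iL: "integrable \<mu> (\<lambda>\<zeta>. poisson p \<zeta> * (indicator E \<zeta> * norm (boundary (f n) \<zeta>) ^ 2))" for n
  proof (rule int_bd[where B = 4])
    show "AE \<zeta> in \<mu>. norm (indicator E \<zeta> * norm (boundary (f n) \<zeta>) ^ 2) \<le> 4"
      using w4[of n] by eventually_elim (auto simp: indicator_def)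
  qed measurable
  have iUE: "integrable \<mu> (\<lambda>\<zeta>. poisson p \<zeta> * (indicator E \<zeta> * U n (boundary \<phi> \<zeta>)))" for n
  proof (rule int_bd[where B = 4])
    show "AE \<zeta> in \<mu>. norm (indicator E \<zeta> * U n (boundary \<phi> \<zeta>)) \<le> 4"
    proof (rule AE_I2)
      fix \<zeta> show "norm (indicator E \<zeta> * U n (boundary \<phi> \<zeta>)) \<le> 4"
        using U_bd[of "boundary \<phi> \<zeta>" n] by (auto simp: indicator_def E_def)
    qed
  qed measurable
  have energy: "V (Suc n) + (\<integral>\<zeta>. poisson p \<zeta> * (indicator E \<zeta> * U n (boundary \<phi> \<zeta>)) \<partial>\<mu>) - L n \<le> V n" for n
  proof -
    have "V (Suc n) + (\<integral>\<zeta>. poisson p \<zeta> * (indicator E \<zeta> * (U n (boundary \<phi> \<zeta>) - norm (boundary (f (Suc n)) \<zeta>) ^ 2)) \<partial>\<mu>) \<le> V n"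
      using boundary_energy_decrease[OF \<phi>h p fix_p fb[of n]] by (simp add: V_def U_def f_Suc E_def)
    moreover have "(\<integral>\<zeta>. poisson p \<zeta> * (indicator E \<zeta> * (U n (boundary \<phi> \<zeta>) - norm (boundary (f (Suc n)) \<zeta>) ^ 2)) \<partial>\<mu>)
        = (\<integral>\<zeta>. poisson p \<zeta> * (indicator E \<zeta> * U n (boundary \<phi> \<zeta>)) \<partial>\<mu>) - L n"
      unfolding L_def Bochner_Integration.integral_diff[OF iUE iL, symmetric] by (simp add: right_diff_distrib)
    ultimately show ?thesis by simp
  qed
  have KV: "K * V n \<le> (\<integral>\<zeta>. poisson p \<zeta> * (indicator E \<zeta> * U n (boundary \<phi> \<zeta>)) \<partial>\<mu>)" for n
  proof -
    have "K * V n = (\<integral>\<zeta>. poisson p \<zeta> * (indicator E \<zeta> * \<kappa> (boundary \<phi> \<zeta>)) * V n \<partial>\<mu>)" by (simp add: K_def)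
    also have "\<dots> \<le> (\<integral>\<zeta>. poisson p \<zeta> * (indicator E \<zeta> * U n (boundary \<phi> \<zeta>)) \<partial>\<mu>)"
    proof (rule integral_mono_AE[OF integrable_mult_left[OF iK] iUE])
      show "AE \<zeta> in \<mu>. poisson p \<zeta> * (indicator E \<zeta> * \<kappa> (boundary \<phi> \<zeta>)) * V n
          \<le> poisson p \<zeta> * (indicator E \<zeta> * U n (boundary \<phi> \<zeta>))"
        using AE_poisson_pos[OF p]
      proof eventually_elim
        case (elim \<zeta>)
        have "indicator E \<zeta> * \<kappa> (boundary \<phi> \<zeta>) * V n \<le> indicator E \<zeta> * U n (boundary \<phi> \<zeta>)"
          using harnack[of "boundary \<phi> \<zeta>" n] by (auto simp: indicator_def E_def)
        then show ?case using elim by (simp add: mult.assoc)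
      qed
    qed
    finally show ?thesis .
  qed
  have L_lim: "L \<longlonglongrightarrow> 0"
  proof -
    have "(\<lambda>n. \<integral>\<zeta>. of_real (poisson p \<zeta>) * (indicator E \<zeta> * norm (boundary (f (Suc n)) \<zeta>) ^ 2) \<partial>\<mu>)
        \<longlonglongrightarrow> (\<integral>\<zeta>. of_real (poisson p \<zeta>) * (0::real) \<partial>\<mu>)"
    proof (rule weighted_dominated_convergence[where B = 4])
      show "AE \<zeta> in \<mu>. norm (indicator E \<zeta> * norm (boundary (f (Suc n)) \<zeta>) ^ 2) \<le> 4" for n
        using w4[of "Suc n"] by eventually_elim (auto simp: indicator_def)
      show "AE \<zeta> in \<mu>. (\<lambda>n. indicator E \<zeta> * norm (boundary (f (Suc n)) \<zeta>) ^ 2) \<longlonglongrightarrow> 0"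
        using f_bd AE_boundary_iterates[OF \<phi>]
      proof eventually_elim
        case (elim \<zeta>)
        show ?case
        proof (cases "\<zeta> \<in> E")
          case True
          have "(\<lambda>m. (\<phi> ^^ 1) (of_real (radii m) * \<zeta>)) \<longlonglongrightarrow> boundary (\<phi> ^^ 1) \<zeta>" using elim(2) by blast
          then have "(\<lambda>n. boundary (\<phi> ^^ n) \<zeta>) \<longlonglongrightarrow> p"
            using True elim(2) by (intro boundary_orbit_converges[OF \<phi> dw, of _ 1]) (auto simp: E_def)
          then have "(\<lambda>n. norm (boundary (\<phi> ^^ Suc n) \<zeta> - p) ^ 2) \<longlonglongrightarrow> norm (p - p) ^ 2"
            by (intro tendsto_intros LIMSEQ_Suc)
          then show ?thesis using True elim(1) by simp
        qed simp
      qed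
    qed (use ik in auto)
    then show ?thesis by (simp add: L_def[abs_def])
  qed
  have V_nonneg: "V n \<ge> 0" for n unfolding V_def by (rule U_bd[OF p])
  \<comment> \<open>Monotonicity supplies a limit of \<open>V\<close>, so that
    \<open>V n - V (Suc n)\<close> drops out of the energy inequality in the limit. It holds because
    on \<open>E\<close> the boundary value of \<open>f (Suc n)\<close> is \<open>f n\<close> at an
    interior point, where its square is at most \<open>U n\<close>.\<close>
  have V_dec: "V (Suc n) \<le> V n" for n
  proof -
    have "L n \<le> (\<integral>\<zeta>. poisson p \<zeta> * (indicator E \<zeta> * U n (boundary \<phi> \<zeta>)) \<partial>\<mu>)"
      unfolding L_def
    proof (rule integral_mono_AE[OF iL iUE])
      show "AE \<zeta> in \<mu>. poisson p \<zeta> * (indicator E \<zeta> * norm (boundary (f (Suc n)) \<zeta>) ^ 2)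
          \<le> poisson p \<zeta> * (indicator E \<zeta> * U n (boundary \<phi> \<zeta>))"
        using AE_boundary[OF \<phi>1] AE_poisson_pos[OF p]
      proof eventually_elim
        case (elim \<zeta>)
        show ?case
        proof (cases "\<zeta> \<in> E")
          case True
          then have a: "norm (boundary \<phi> \<zeta>) < 1" by (simp add: E_def)
          have "boundary (f (Suc n)) \<zeta> = f n (boundary \<phi> \<zeta>)"
            unfolding f_Suc using elim a fb[of n] \<phi>h(2)
            by (intro boundary_comp) (auto simp: bounded_holomorphic_def image_subset_iff)
          moreover have "norm (f n (boundary \<phi> \<zeta>)) ^ 2 \<le> U n (boundary \<phi> \<zeta>)"
            unfolding U_def by (rule poisson_boundary_defect[OF fb a])
          ultimately show ?thesis using elim by (simp add: True)
        qed simp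
      qed
    qed
    then show ?thesis using energy[of n] by simp
  qed
  have "decseq V" using V_dec by (simp add: decseq_Suc_iff)
  then obtain v where v: "V \<longlonglongrightarrow> v" using decseq_convergent[of V 0] V_nonneg by metis
  have "(\<lambda>n. V n - V (Suc n) + L n) \<longlonglongrightarrow> v - v + 0" by (intro tendsto_intros v LIMSEQ_Suc L_lim)
  moreover have "(\<lambda>n. K * V n) \<longlonglongrightarrow> K * v" by (intro tendsto_intros v)
  moreover have "K * V n \<le> V n - V (Suc n) + L n" for n using energy[of n] KV[of n] by linarith
  ultimately have "K * v \<le> v - v + 0" by (intro LIMSEQ_le) auto
  then have Kv: "K * v \<le> 0" by simp
  have "K > 0"
  proof -
    have nn: "AE \<zeta> in \<mu>. 0 \<le> poisson p \<zeta> * (indicator E \<zeta> * \<kappa> (boundary \<phi> \<zeta>))"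
      using AE_poisson_pos[OF p]
    proof eventually_elim
      case (elim \<zeta>)
      then show ?case using \<kappa>_pos[of "boundary \<phi> \<zeta>"] by (auto simp: indicator_def E_def)
    qed
    have "K \<noteq> 0"
    proof
      assume "K = 0"
      then have "AE \<zeta> in \<mu>. poisson p \<zeta> * (indicator E \<zeta> * \<kappa> (boundary \<phi> \<zeta>)) = 0"
        using integral_nonneg_eq_0_iff_AE[OF iK nn] by (simp add: K_def)
      then have "AE \<zeta> in \<mu>. norm (boundary \<phi> \<zeta>) = 1"
        using AE_poisson_pos[OF p] AE_boundary_le[OF \<phi>1]
      proof eventually_elim
        case (elim \<zeta>)
        have "\<zeta> \<notin> E"
        proof
          assume "\<zeta> \<in> E"
          then have "\<kappa> (boundary \<phi> \<zeta>) > 0" "indicator E \<zeta> = (1::real)" by (auto simp: E_def intro: \<kappa>_pos)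
          then show False using elim by simp
        qed
        then show ?case using elim by (simp add: E_def)
      qed
      with ni show False by blast
    qed
    moreover have "K \<ge> 0" unfolding K_def by (rule Bochner_Integration.integral_nonneg_AE[OF nn])
    ultimately show ?thesis by simp
  qed
  moreover have "v \<ge> 0" using LIMSEQ_le_const[OF v] V_nonneg by blast
  ultimately have v0: "v = 0" using Kv by (simp add: mult_le_0_iff)
  \<comment> \<open>Points whose boundary values never enter the disc. They stay at distance at
    least \<open>1 - norm p\<close> from \<open>p\<close>, so every \<open>V n\<close> bounds the
    mass of \<open>A\<close> up to a constant.\<close>
  define A where "A = {\<zeta>. \<forall>n. norm (boundary (\<phi> ^^ n) \<zeta>) \<ge> 1}"
  have Am[measurable]: "(\<lambda>\<zeta>. indicator A \<zeta> :: real) \<in> borel_measurable \<mu>"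
  proof -
    have "indicator A = (\<lambda>\<zeta>. if \<forall>n. norm (boundary (\<phi> ^^ n) \<zeta>) \<ge> 1 then 1 else 0 :: real)" by (auto simp: A_def indicator_def)
    moreover have "(\<lambda>\<zeta>. if \<forall>n. norm (boundary (\<phi> ^^ n) \<zeta>) \<ge> 1 then 1 else 0 :: real) \<in> borel_measurable \<mu>"
      by measurable
    ultimately show ?thesis by (simp only:)
  qed
  have iA: "integrable \<mu> (\<lambda>\<zeta>. poisson p \<zeta> * indicator A \<zeta>)"
    by (rule int_bd[OF Am, where B = 1]) (auto simp: indicator_def)
  define \<alpha> where "\<alpha> = (\<integral>\<zeta>. poisson p \<zeta> * indicator A \<zeta> \<partial>\<mu>)"
  have nnA: "AE \<zeta> in \<mu>. 0 \<le> poisson p \<zeta> * indicator A \<zeta>"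
    using AE_poisson_pos[OF p] by eventually_elim (simp add: indicator_def)
  have "\<alpha> * (1 - norm p) ^ 2 \<le> V n" for n
  proof -
    have "\<alpha> * (1 - norm p) ^ 2 = (\<integral>\<zeta>. poisson p \<zeta> * indicator A \<zeta> * (1 - norm p) ^ 2 \<partial>\<mu>)"
      by (simp add: \<alpha>_def)
    also have "\<dots> \<le> V n" unfolding V_def U_def
    proof (rule integral_mono_AE[OF integrable_mult_left[OF iA] iU[OF p]])
      show "AE \<zeta> in \<mu>. poisson p \<zeta> * indicator A \<zeta> * (1 - norm p) ^ 2 \<le> poisson p \<zeta> * norm (boundary (f n) \<zeta>) ^ 2"
        using AE_poisson_pos[OF p] f_bd
      proof eventually_elim
        case (elim \<zeta>)
        have "indicator A \<zeta> * (1 - norm p) ^ 2 \<le> norm (boundary (f n) \<zeta>) ^ 2"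
        proof (cases "\<zeta> \<in> A")
          case True
          then have "1 - norm p \<le> norm (boundary (f n) \<zeta>)"
            using norm_triangle_ineq2[of "boundary (\<phi> ^^ n) \<zeta>" p] elim by (auto simp: A_def dest: spec[of _ n])
          then show ?thesis using p True by (simp add: power_mono)
        qed simp
        then show ?case using elim by (simp add: mult.assoc)
      qed
    qed
    finally show ?thesis .
  qed
  then have "\<alpha> * (1 - norm p) ^ 2 \<le> 0" using LIMSEQ_le_const[OF v] v0 by blast
  moreover have "(1 - norm p) ^ 2 > 0" using p by simp
  ultimately have "\<alpha> \<le> 0" by (simp add: mult_le_0_iff)
  moreover have "\<alpha> \<ge> 0" unfolding \<alpha>_def by (rule Bochner_Integration.integral_nonneg_AE[OF nnA])
  ultimately have "AE \<zeta> in \<mu>. poisson p \<zeta> * indicator A \<zeta> = 0"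
    using integral_nonneg_eq_0_iff_AE[OF iA nnA] by (simp add: \<alpha>_def)
  then show ?thesis using AE_poisson_pos[OF p] AE_boundary_iterates[OF \<phi>]
  proof eventually_elim
    case (elim \<zeta>)
    then have "\<zeta> \<notin> A" by auto
    then obtain k where "norm (boundary (\<phi> ^^ k) \<zeta>) < 1" by (auto simp: A_def not_le)
    then show ?case using elim(3) by (intro boundary_orbit_converges[OF \<phi> dw, of _ k]) auto
  qed
qed

lemma summable_orbit_converges:
  assumes \<phi>: "analytic_self_map \<phi>" and dw: "denjoy_wolff_point \<phi> p" and a: "a \<in> \<bbbD>"
    and summ: "summable (\<lambda>n. 1 - norm ((\<phi> ^^ n) a) ^ 2)"
  shows "AE \<zeta> in \<mu>. (\<lambda>n. boundary (\<phi> ^^ n) \<zeta>) \<longlonglongrightarrow> p"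
proof -
  have a1: "norm a < 1" using a by simp
  have m[measurable]: "boundary (\<phi> ^^ n) \<in> borel_measurable \<mu>" for n
    by (rule boundary_measurable[OF iterate_self_map(1)[OF \<phi>]])
  define g where "g n \<zeta> = poisson a \<zeta> * norm (boundary (\<phi> ^^ n) \<zeta> - (\<phi> ^^ n) a) ^ 2" for n \<zeta>
  have [measurable]: "g n \<in> borel_measurable \<mu>" for n unfolding g_def by measurable
  have nn: "AE \<zeta> in \<mu>. 0 \<le> g n \<zeta>" for n
    unfolding g_def using AE_poisson_pos[OF a1] by eventually_elim simp
  note bh = iterate_self_map(3)[OF \<phi>]
  have ig: "integrable \<mu> (g n)" for n
  proof -
    have "AE \<zeta> in \<mu>. norm (norm (boundary (\<phi> ^^ n) \<zeta> - (\<phi> ^^ n) a) ^ 2) \<le> 2 ^ 2"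
      using AE_boundary_le[OF bh[of n]]
    proof eventually_elim
      case (elim \<zeta>)
      have "norm ((\<phi> ^^ n) a) < 1" using funpow_disc[OF \<phi> a, of n] by simp
      then have "norm (boundary (\<phi> ^^ n) \<zeta> - (\<phi> ^^ n) a) \<le> 2"
        using elim norm_triangle_ineq4[of "boundary (\<phi> ^^ n) \<zeta>" "(\<phi> ^^ n) a"] by simp
      then have "norm (boundary (\<phi> ^^ n) \<zeta> - (\<phi> ^^ n) a) ^ 2 \<le> 2 ^ 2" by (rule power_mono) simp
      then show ?case by simp
    qed
    then show ?thesis unfolding g_def by (intro integrable_poisson_mult a1) measurable
  qed
  have Ig: "(\<integral>\<zeta>. g n \<zeta> \<partial>\<mu>) \<le> 1 - norm ((\<phi> ^^ n) a) ^ 2" for n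
  proof -
    have "(\<integral>\<zeta>. poisson a \<zeta> * norm (boundary (\<phi> ^^ n) \<zeta>) ^ 2 \<partial>\<mu>) \<le> 1"
    proof (rule poisson_integral_le(2)[OF _ _ a1])
      show "AE \<zeta> in \<mu>. 0 \<le> norm (boundary (\<phi> ^^ n) \<zeta>) ^ 2 \<and> norm (boundary (\<phi> ^^ n) \<zeta>) ^ 2 \<le> 1"
        using AE_boundary_le[OF bh[of n]] by eventually_elim (simp add: power_le_one)
    qed measurable
    then show ?thesis
      unfolding g_def using poisson_variance[OF m AE_boundary_le[OF bh] a1 poisson_boundary[OF bh a1]] by simp
  qed
  have Ig0: "(\<integral>\<zeta>. g n \<zeta> \<partial>\<mu>) \<ge> 0" for n by (rule Bochner_Integration.integral_nonneg_AE[OF nn])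
  have sI: "summable (\<lambda>n. \<integral>\<zeta>. g n \<zeta> \<partial>\<mu>)"
    by (rule summable_comparison_test'[OF summ, of 0]) (use Ig Ig0 in simp)
  \<comment> \<open>The sum of all \<open>g n\<close> has finite integral, so it is finite almost
    everywhere and its terms tend to 0. Summability, not mere convergence of the integrals to 0, is
    what gives the full sequence.\<close>
  have "(\<integral>\<^sup>+\<zeta>. (\<Sum>n. ennreal (g n \<zeta>)) \<partial>\<mu>) = (\<Sum>n. \<integral>\<^sup>+\<zeta>. ennreal (g n \<zeta>) \<partial>\<mu>)"
    by (rule nn_integral_suminf) measurable
  also have "\<dots> = (\<Sum>n. ennreal (\<integral>\<zeta>. g n \<zeta> \<partial>\<mu>))"
    unfolding nn_integral_eq_integral[OF ig nn] ..
  also have "\<dots> = ennreal (\<Sum>n. \<integral>\<zeta>. g n \<zeta> \<partial>\<mu>)"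
    by (rule suminf_ennreal2[OF Ig0 sI])
  finally have "(\<integral>\<^sup>+\<zeta>. (\<Sum>n. ennreal (g n \<zeta>)) \<partial>\<mu>) \<noteq> \<infinity>" by (simp only: ennreal_neq_top infinity_ennreal_def not_False_eq_True)
  then have "AE \<zeta> in \<mu>. (\<Sum>n. ennreal (g n \<zeta>)) \<noteq> \<infinity>"
    by (rule nn_integral_noteq_infinite[rotated]) measurable
  moreover have "AE \<zeta> in \<mu>. \<forall>n. 0 \<le> g n \<zeta>" unfolding AE_all_countable using nn by (rule allI)
  ultimately show ?thesis using AE_poisson_pos[OF a1]
  proof eventually_elim
    case (elim \<zeta>)
    have "summable (\<lambda>n. g n \<zeta>)"
      by (rule summable_suminf_not_top) (use elim(1,2) in \<open>simp_all only: infinity_ennreal_def not_False_eq_True\<close>)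
    then have "(\<lambda>n. g n \<zeta>) \<longlonglongrightarrow> 0" by (rule summable_LIMSEQ_zero)
    then have "(\<lambda>n. g n \<zeta> / poisson a \<zeta>) \<longlonglongrightarrow> 0 / poisson a \<zeta>"
      using elim(3) by (intro tendsto_intros) auto
    then have "(\<lambda>n. norm (boundary (\<phi> ^^ n) \<zeta> - (\<phi> ^^ n) a) ^ 2) \<longlonglongrightarrow> 0"
      using elim(3) by (simp add: g_def)
    from tendsto_real_sqrt[OF this] have "(\<lambda>n. boundary (\<phi> ^^ n) \<zeta> - (\<phi> ^^ n) a) \<longlonglongrightarrow> 0"
      by (subst tendsto_norm_zero_iff[symmetric]) simp
    from tendsto_add[OF this denjoy_wolff_pointwise[OF dw a]] show ?case by simp
  qed
qed

theorem theorem1p2: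
  fixes \<phi> :: "complex \<Rightarrow> complex" and p :: complex
  assumes "analytic_self_map \<phi>"
    and "\<not> elliptic_automorphism \<phi>"
    and "denjoy_wolff_point \<phi> p"
  shows "(AE \<zeta> in circle_measure. \<forall>n\<ge>1. \<exists>l. has_radial_limit (\<phi> ^^ n) \<zeta> l) \<and>
         (elliptic_map \<phi> \<longrightarrow>
           ((AE \<zeta> in circle_measure. (\<lambda>n. radial_boundary (\<phi> ^^ n) \<zeta>) \<longlonglongrightarrow> p)
              \<longleftrightarrow> \<not> inner_function \<phi>)) \<and>
         (hyperbolic_map \<phi> \<or> type_I_parabolic \<phi> \<longrightarrow>
           (AE \<zeta> in circle_measure. (\<lambda>n. radial_boundary (\<phi> ^^ n) \<zeta>) \<longlonglongrightarrow> p))"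
proof -
  note \<phi> = assms(1) note dw = assms(3)
  note AEi = AE_boundary_iterates[OF \<phi>]
  \<comment> \<open>The claim is about \<open>radial_boundary\<close>, the arguments about
    \<open>boundary\<close>; they agree off one null set for all \<open>n\<close> at once.\<close>
  have conv_iff: "(AE \<zeta> in \<mu>. (\<lambda>n. radial_boundary (\<phi> ^^ n) \<zeta>) \<longlonglongrightarrow> p)
      \<longleftrightarrow> (AE \<zeta> in \<mu>. (\<lambda>n. boundary (\<phi> ^^ n) \<zeta>) \<longlonglongrightarrow> p)"
  proof -
    have "AE \<zeta> in \<mu>. ((\<lambda>n. radial_boundary (\<phi> ^^ n) \<zeta>) \<longlonglongrightarrow> p) = ((\<lambda>n. boundary (\<phi> ^^ n) \<zeta>) \<longlonglongrightarrow> p)"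
      using AEi by eventually_elim simp
    from eventually_subst[OF this] show ?thesis .
  qed
  have \<phi>1: "bounded_holomorphic \<phi> 1" using iterate_self_map(3)[OF \<phi>, of 1] by simp
  have \<phi>h: "\<phi> holomorphic_on \<bbbD>" "\<phi> ` \<bbbD> \<subseteq> \<bbbD>" using \<phi> by (auto simp: analytic_self_map_def)
  have inner_iff: "inner_function \<phi> \<longleftrightarrow> (AE \<zeta> in \<mu>. norm (boundary \<phi> \<zeta>) = 1)"
  proof -
    have "bounded (\<phi> ` \<bbbD>)" using \<phi>h(2) bounded_ball bounded_subset by blast
    then have "inner_function \<phi> \<longleftrightarrow> (AE \<zeta> in \<mu>. norm (radial_boundary \<phi> \<zeta>) = 1)"
      using \<phi>h by (simp add: inner_function_def)
    moreover have "AE \<zeta> in \<mu>. (norm (radial_boundary \<phi> \<zeta>) = 1) = (norm (boundary \<phi> \<zeta>) = 1)"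
      using AE_boundary[OF \<phi>1] by eventually_elim simp
    from eventually_subst[OF this]
    have "(AE \<zeta> in \<mu>. norm (radial_boundary \<phi> \<zeta>) = 1) \<longleftrightarrow> (AE \<zeta> in \<mu>. norm (boundary \<phi> \<zeta>) = 1)" .
    ultimately show ?thesis by simp
  qed
  have part0: "AE \<zeta> in \<mu>. \<forall>n\<ge>1. \<exists>l. has_radial_limit (\<phi> ^^ n) \<zeta> l"
    using AEi by eventually_elim blast
  have part1: "(AE \<zeta> in \<mu>. (\<lambda>n. boundary (\<phi> ^^ n) \<zeta>) \<longlonglongrightarrow> p) \<longleftrightarrow> \<not> inner_function \<phi>" if "elliptic_map \<phi>"
  proof -
    from that obtain q where q: "denjoy_wolff_point \<phi> q" "q \<in> \<bbbD>" unfolding elliptic_map_def by blast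
    have p: "norm p < 1" using denjoy_wolff_unique[OF dw q(1)] q(2) by simp
    show ?thesis
    proof
      assume conv: "AE \<zeta> in \<mu>. (\<lambda>n. boundary (\<phi> ^^ n) \<zeta>) \<longlonglongrightarrow> p"
      show "\<not> inner_function \<phi>"
      proof
        assume "inner_function \<phi>"
        then have in\<phi>: "AE \<zeta> in \<mu>. norm (boundary \<phi> \<zeta>) = 1" by (simp add: inner_iff)
        have "AE \<zeta> in \<mu>. norm (boundary (\<phi> ^^ Suc n) \<zeta>) = 1" for n
        proof (induction n)
          case 0
          then show ?case using in\<phi> by simp
        next
          case (Suc n)
          have "\<phi> ^^ Suc (Suc n) = (\<lambda>z. (\<phi> ^^ Suc n) (\<phi> z))"
            by (rule ext) (simp only: funpow_Suc_right comp_apply)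
          then show ?case
            using inner_comp[OF iterate_self_map(3)[OF \<phi>, of "Suc n"] Suc \<phi>h in\<phi>] by simp
        qed
        then have "AE \<zeta> in \<mu>. \<forall>n. norm (boundary (\<phi> ^^ Suc n) \<zeta>) = 1"
          unfolding AE_all_countable by (rule allI)
        \<comment> \<open>Moduli constantly 1 cannot converge to \<open>norm p\<close>, which is
          below 1. Falsity almost everywhere then contradicts the total mass
          \<open>2 * pi\<close>.\<close>
        with conv have "AE \<zeta> in \<mu>. False"
        proof eventually_elim
          case (elim \<zeta>)
          from tendsto_norm[OF LIMSEQ_Suc[OF elim(1)]] have "(\<lambda>n. 1::real) \<longlonglongrightarrow> norm p" using elim(2) by simp
          then show False using p LIMSEQ_unique[OF tendsto_const] by fastforce
        qed
        then have "emeasure \<mu> (space \<mu>) = 0" by (simp add: AE_iff_measurable[OF _ refl])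
        then show False by (simp add: space_circle_measure emeasure_circle_measure_space)
      qed
    next
      assume "\<not> inner_function \<phi>"
      then show "AE \<zeta> in \<mu>. (\<lambda>n. boundary (\<phi> ^^ n) \<zeta>) \<longlonglongrightarrow> p"
        using elliptic_not_inner[OF \<phi> dw p] by (simp add: inner_iff)
    qed
  qed
  have part2: "AE \<zeta> in \<mu>. (\<lambda>n. boundary (\<phi> ^^ n) \<zeta>) \<longlonglongrightarrow> p" if "hyperbolic_map \<phi> \<or> type_I_parabolic \<phi>"
    using that
  proof
    assume "hyperbolic_map \<phi>"
    then obtain q d where q: "denjoy_wolff_point \<phi> q" "q \<in> sphere 0 1"
        "has_angular_derivative \<phi> q q (complex_of_real d)" "d < 1"
      unfolding hyperbolic_map_def by blast
    have "q = p" using denjoy_wolff_unique[OF q(1) dw] .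
    then have "norm p = 1" "has_angular_derivative \<phi> p p (complex_of_real d)" "d < 1" using q by auto
    \<comment> \<open>Every hyperbolic orbit is summable, so the base point 0 is a free choice; the
      parabolic case uses the point \<open>z0\<close> given with the positive limit.\<close>
    then show ?thesis
      by (intro summable_orbit_converges[OF \<phi> dw, of 0] hyperbolic_summable[OF \<phi>]) auto
  next
    assume t: "type_I_parabolic \<phi>"
    then obtain q where q: "denjoy_wolff_point \<phi> q" "q \<in> sphere 0 1" "has_angular_derivative \<phi> q q 1"
      unfolding type_I_parabolic_def parabolic_map_def by blast
    have "q = p" using denjoy_wolff_unique[OF q(1) dw] .
    then have "norm p = 1" "has_angular_derivative \<phi> p p 1" using q by auto
    moreover obtain z0 s where "z0 \<in> \<bbbD>" "s > 0"
        "(\<lambda>n. hyperbolic_distance ((\<phi> ^^ n) z0) ((\<phi> ^^ Suc n) z0)) \<longlonglongrightarrow> s"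
      using t unfolding type_I_parabolic_def by blast
    ultimately show ?thesis
      by (intro summable_orbit_converges[OF \<phi> dw, of z0] type_I_summable[OF \<phi>])
  qed
  show ?thesis unfolding conv_iff using part0 part1 part2 by blast
qed

end
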